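(* For all $i\in\{0,\dots,n\}$, with $q=e^{-\delta}$ and the colours specialised as in the context, $$\sum_{\pi\in\mathcal P_{i,\rho}}C(\pi)q^{|\pi|}=e^{-\Lambda_i}\mathrm{ch}(L(\Lambda_i)).$$
   Context: $\mathfrak g$ is the affine Lie algebra of type $C_n^{(1)}$ with simple roots $\alpha_0,\dots,\alpha_n$, fundamental weights $\Lambda_i$, null root $\delta=\alpha_0+2\sum_{j=1}^{n-1}\alpha_j+\alpha_n$; $L(\Lambda)$ is the irreducible highest weight module, $\mathrm{ch}$ its character. $\overline{[n]}=\{1,\dots,n,\overline n,\dots,\overline 1\}$ ordered $1<\dots<n<\overline n<\dots<\overline 1$, $\overline{\overline k}=k$. $\mathcal B=\{\emptyset\}\sqcup\{(x,y):x\le y\in\overline{[n]}\}$ with energy $H$: $H(\emptyset\otimes\emptyset)=0$, $H(\emptyset\otimes(x,y))=H((x,y)\otimes\emptyset)=1$, and for $x\le y$, $x'\le y'$, $H((x,y)\otimes(x',y'))=\chi(x\ge x')+\chi(y\ge y')-\chi(y\ge y'>x\ge x')$ if $\overline{y'}\ne x$, $=\chi(x>x')+\chi(y>y')-\chi(y>y'>x>x')$ if $\overline{y'}=x$ ($\chi$ = truth value in $\{0,1\}$). Colours $c_b$ ($b\in\mathcal B$), $c_{x,y}:=c_{(x,y)}$; $b_0=\emptyset$, $b_k=(k,\overline k)$. Let $\mathcal S=\{c_{x,y}\}$, $c_\infty$ a new colour, and $\rho_i$ on $\mathcal S\times(\mathcal S\sqcup\{c_\infty\})$: $\rho_i(c_{b_i},c_\infty)=1$,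 $\rho_i(c_b,c_\infty)=H(b_i\otimes b)$ for $c_b\in\mathcal S\setminus\{c_{b_i}\}$, $\rho_i(c_{x',y'},c_{x,y})=\chi(x\ge x')+\chi(y\ge y')-\chi(y\ge y'>x\ge x')$. $\mathcal P_{i,\rho}$ is the set of sequences $(\pi_0,\dots,\pi_{s-1},0_{c_{b_i}})$ of coloured integers $k_c$ ($k\in\mathbb Z$) with $c(\pi_j)\in\mathcal S$ for $j<s$ such that, with the last part read as $0_{c_\infty}$, $|\pi_j|-|\pi_{j+1}|\ge\rho_i(c(\pi_j),c(\pi_{j+1}))$ for all $j<s$. $|\pi|$ = sum of sizes, $C(\pi)$ = product of colours of all parts. Specialisation: $c_\emptyset=1$, $c_{x,y}=c_xc_y$ with $c_j=e^{\frac12\alpha_n+\sum_{u=j}^{n-1}\alpha_u}$, $c_{\overline j}=c_j^{-1}$ ($j=1,\dots,n$). *)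

theory Defs
  imports Complex_Main
begin

section \<open>The affine Lie algebra of type \<open>C\<^sub>n\<^sup>(\<^sup>1\<^sup>)\<close>\<close>

locale complex_lie_algebra = vector_space scale
  for scale :: "complex \<Rightarrow> 'g::ab_group_add \<Rightarrow> 'g" +
  fixes bracket :: "'g \<Rightarrow> 'g \<Rightarrow> 'g"
  assumes bracket_add_left: "bracket (x + y) z = bracket x z + bracket y z"
    and bracket_add_right: "bracket x (y + z) = bracket x y + bracket x z"
    and bracket_scale_left: "bracket (scale c x) y = scale c (bracket x y)"
    and bracket_scale_right: "bracket x (scale c y) = scale c (bracket x y)"
    and bracket_self: "bracket x x = 0"
    and jacobi: "bracket x (bracket y z) + bracket y (bracket z x) + bracket z (bracket x y) = 0"
begin

definition lie_subalgebra :: "'g set \<Rightarrow> bool" where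
  "lie_subalgebra S \<longleftrightarrow> subspace S \<and> (\<forall>x\<in>S. \<forall>y\<in>S. bracket x y \<in> S)"

definition lie_ideal :: "'g set \<Rightarrow> bool" where
  "lie_ideal J \<longleftrightarrow> subspace J \<and> (\<forall>x. \<forall>y\<in>J. bracket x y \<in> J)"

end

text \<open>The dual space of a subspace \<open>H\<close>. A functional is made a function on the whole type by
  giving it the value \<open>0\<close> outside \<open>H\<close>, so that equality of functionals is equality on \<open>H\<close>.\<close>

definition dual_of :: "(complex \<Rightarrow> 'g::ab_group_add \<Rightarrow> 'g) \<Rightarrow> 'g set \<Rightarrow> ('g \<Rightarrow> complex) set" where
  "dual_of scale H = {\<mu>. (\<forall>x\<in>H. \<forall>y\<in>H. \<mu> (x + y) = \<mu> x + \<mu> y) \<and>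
                        (\<forall>c. \<forall>x\<in>H. \<mu> (scale c x) = c * \<mu> x) \<and>
                        (\<forall>x. x \<notin> H \<longrightarrow> \<mu> x = 0)}"

text \<open>The entry \<open>(i, j)\<close> is \<open>\<langle>h\<^sub>i, \<alpha>\<^sub>j\<rangle>\<close>; the simple roots \<open>\<alpha>\<^sub>0\<close> and \<open>\<alpha>\<^sub>n\<close> are long, the others short.\<close>

definition cartan_C :: "nat \<Rightarrow> nat \<Rightarrow> nat \<Rightarrow> int" where
  "cartan_C n i j =
     (if i = j then 2
      else if (i = 1 \<and> j = 0) \<or> (i + 1 = n \<and> j = n) then - 2
      else if j = i + 1 \<or> i = j + 1 then - 1
      else 0)"

text \<open>The Kac-Moody algebra of \<open>cartan_C n\<close>, with its realisation: the Cartan subalgebra \<open>H\<close> has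
  basis \<open>h\<^sub>0, \<dots>, h\<^sub>n, d\<close>, where \<open>d\<close> is the scaling element. As in Kac's definition of
  \<open>\<gg>(A)\<close>, the algebra is generated by \<open>H\<close> and the Chevalley generators and has no nonzero
  ideal meeting \<open>H\<close> trivially; this determines it up to isomorphism.\<close>

locale affine_C = complex_lie_algebra scale bracket
  for scale :: "complex \<Rightarrow> 'g::ab_group_add \<Rightarrow> 'g" and bracket :: "'g \<Rightarrow> 'g \<Rightarrow> 'g" +
  fixes n :: nat
    and H :: "'g set"
    and h :: "nat \<Rightarrow> 'g"
    and d :: 'g
    and e f :: "nat \<Rightarrow> 'g"
    and \<alpha> \<Lambda> :: "nat \<Rightarrow> 'g \<Rightarrow> complex"
  assumes n_ge_2: "2 \<le> n"
    and cartan_span: "H = span (insert d (h ` {..n}))"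
    and cartan_independent: "independent (insert d (h ` {..n}))"
    and coroots_distinct: "inj_on h {..n}" "d \<notin> h ` {..n}"
    and root_dual: "i \<le> n \<Longrightarrow> \<alpha> i \<in> dual_of scale H"
    and root_coroot: "i \<le> n \<Longrightarrow> j \<le> n \<Longrightarrow> \<alpha> j (h i) = of_int (cartan_C n i j)"
    and root_d: "j \<le> n \<Longrightarrow> \<alpha> j d = (if j = 0 then 1 else 0)"
    and fund_dual: "i \<le> n \<Longrightarrow> \<Lambda> i \<in> dual_of scale H"
    and fund_coroot: "i \<le> n \<Longrightarrow> j \<le> n \<Longrightarrow> \<Lambda> j (h i) = (if i = j then 1 else 0)"
    and fund_d: "j \<le> n \<Longrightarrow> \<Lambda> j d = 0"
    and cartan_abelian: "x \<in> H \<Longrightarrow> y \<in> H \<Longrightarrow> bracket x y = 0"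
    and bracket_e_f: "i \<le> n \<Longrightarrow> j \<le> n \<Longrightarrow> bracket (e i) (f j) = (if i = j then h i else 0)"
    and bracket_H_e: "i \<le> n \<Longrightarrow> x \<in> H \<Longrightarrow> bracket x (e i) = scale (\<alpha> i x) (e i)"
    and bracket_H_f: "i \<le> n \<Longrightarrow> x \<in> H \<Longrightarrow> bracket x (f i) = scale (- \<alpha> i x) (f i)"
    and generated: "lie_subalgebra S \<Longrightarrow> H \<union> e ` {..n} \<union> f ` {..n} \<subseteq> S \<Longrightarrow> S = UNIV"
    and no_ideal: "lie_ideal J \<Longrightarrow> J \<inter> H = {0} \<Longrightarrow> J = {0}"

definition null_root :: "(nat \<Rightarrow> 'g \<Rightarrow> complex) \<Rightarrow> nat \<Rightarrow> 'g \<Rightarrow> complex" where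
  "null_root \<alpha> n = (\<lambda>x. \<alpha> 0 x + 2 * (\<Sum>j=1..n - 1. \<alpha> j x) + \<alpha> n x)"

section \<open>Irreducible highest weight modules and their characters\<close>

locale lie_module = complex_lie_algebra scale bracket + V: vector_space scaleV
  for scale :: "complex \<Rightarrow> 'g::ab_group_add \<Rightarrow> 'g" and bracket :: "'g \<Rightarrow> 'g \<Rightarrow> 'g"
    and scaleV :: "complex \<Rightarrow> 'v::ab_group_add \<Rightarrow> 'v" +
  fixes act :: "'g \<Rightarrow> 'v \<Rightarrow> 'v"
  assumes act_add_left: "act (x + y) v = act x v + act y v"
    and act_add_right: "act x (v + w) = act x v + act x w"
    and act_scale_left: "act (scale c x) v = scaleV c (act x v)"
    and act_scale_right: "act x (scaleV c v) = scaleV c (act x v)"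
    and act_bracket: "act (bracket x y) v = act x (act y v) - act y (act x v)"
begin

definition submodule :: "'v set \<Rightarrow> bool" where
  "submodule W \<longleftrightarrow> V.subspace W \<and> (\<forall>x. \<forall>w\<in>W. act x w \<in> W)"

end

locale irreducible_highest_weight_module = lie_module scale bracket scaleV act
  for scale :: "complex \<Rightarrow> 'g::ab_group_add \<Rightarrow> 'g" and bracket :: "'g \<Rightarrow> 'g \<Rightarrow> 'g"
    and scaleV :: "complex \<Rightarrow> 'v::ab_group_add \<Rightarrow> 'v" and act :: "'g \<Rightarrow> 'v \<Rightarrow> 'v" +
  fixes n :: nat and H :: "'g set" and e :: "nat \<Rightarrow> 'g" and \<kappa> :: "'g \<Rightarrow> complex"
  assumes irreducible: "submodule W \<Longrightarrow> W = {0} \<or> W = UNIV"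
    and highest_weight_vector:
      "\<exists>v. v \<noteq> 0 \<and> (\<forall>i\<le>n. act (e i) v = 0) \<and> (\<forall>x\<in>H. act x v = scaleV (\<kappa> x) v) \<and>
           (\<forall>W. submodule W \<longrightarrow> v \<in> W \<longrightarrow> W = UNIV)"

definition weight_space ::
    "'g set \<Rightarrow> (complex \<Rightarrow> 'v::ab_group_add \<Rightarrow> 'v) \<Rightarrow> ('g \<Rightarrow> 'v \<Rightarrow> 'v) \<Rightarrow> ('g \<Rightarrow> complex) \<Rightarrow> 'v set" where
  "weight_space H scaleV act \<mu> = {v. \<forall>x\<in>H. act x v = scaleV (\<mu> x) v}"

definition finite_dim :: "(complex \<Rightarrow> 'v::ab_group_add \<Rightarrow> 'v) \<Rightarrow> 'v set \<Rightarrow> bool" where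
  "finite_dim scaleV W \<longleftrightarrow> (\<exists>B. finite B \<and> W \<subseteq> module.span scaleV B)"

text \<open>A formal, possibly infinite, combination \<open>\<Sum>\<^sub>\<mu> F(\<mu>) e\<^sup>\<mu>\<close> of formal exponentials is
  represented by its coefficient function \<open>F\<close>.\<close>

definition formal_character ::
    "(complex \<Rightarrow> 'g::ab_group_add \<Rightarrow> 'g) \<Rightarrow> 'g set \<Rightarrow> (complex \<Rightarrow> 'v::ab_group_add \<Rightarrow> 'v) \<Rightarrow>
     ('g \<Rightarrow> 'v \<Rightarrow> 'v) \<Rightarrow> ('g \<Rightarrow> complex) \<Rightarrow> nat" where
  "formal_character scale H scaleV act =
     (\<lambda>\<mu>. if \<mu> \<in> dual_of scale H then vector_space.dim scaleV (weight_space H scaleV act \<mu>) else 0)"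

definition exp_times :: "('g \<Rightarrow> complex) \<Rightarrow> (('g \<Rightarrow> complex) \<Rightarrow> nat) \<Rightarrow> ('g \<Rightarrow> complex) \<Rightarrow> nat" where
  "exp_times \<kappa> F = (\<lambda>\<mu>. F (\<lambda>x. \<mu> x - \<kappa> x))"

text \<open>The formal sum \<open>\<Sum>\<^bsub>\<pi>\<in>P\<^esub> e\<^bsup>E \<pi>\<^esup>\<close>; it is defined when every exponent occurs only finitely often.\<close>

definition formal_summable :: "('p \<Rightarrow> 'g \<Rightarrow> complex) \<Rightarrow> 'p set \<Rightarrow> bool" where
  "formal_summable E P \<longleftrightarrow> (\<forall>\<mu>. finite {\<pi> \<in> P. E \<pi> = \<mu>})"

definition formal_sum :: "('p \<Rightarrow> 'g \<Rightarrow> complex) \<Rightarrow> 'p set \<Rightarrow> ('g \<Rightarrow> complex) \<Rightarrow> nat" where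
  "formal_sum E P = (\<lambda>\<mu>. card {\<pi> \<in> P. E \<pi> = \<mu>})"

section \<open>The crystal and its energy function\<close>

datatype letter = Plain nat | Barred nat

instantiation letter :: linorder
begin

fun less_eq_letter :: "letter \<Rightarrow> letter \<Rightarrow> bool" where
  "Plain i \<le> Plain j \<longleftrightarrow> i \<le> j"
| "Plain i \<le> Barred j \<longleftrightarrow> True"
| "Barred i \<le> Plain j \<longleftrightarrow> False"
| "Barred i \<le> Barred j \<longleftrightarrow> j \<le> i"

definition less_letter :: "letter \<Rightarrow> letter \<Rightarrow> bool" where
  "x < y \<longleftrightarrow> x \<le> y \<and> \<not> y \<le> (x::letter)"

instance
proof
  fix x y z :: letter
  show "x < y \<longleftrightarrow> x \<le> y \<and> \<not> y \<le> x" by (fact less_letter_def)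
  show "x \<le> x" by (cases x) auto
  show "x \<le> y \<Longrightarrow> y \<le> z \<Longrightarrow> x \<le> z" by (cases x; cases y; cases z) auto
  show "x \<le> y \<Longrightarrow> y \<le> x \<Longrightarrow> x = y" by (cases x; cases y) auto
  show "x \<le> y \<or> y \<le> x" by (cases x; cases y) auto
qed

end

fun bar :: "letter \<Rightarrow> letter" where
  "bar (Plain k) = Barred k"
| "bar (Barred k) = Plain k"

definition letters :: "nat \<Rightarrow> letter set" where
  "letters n = Plain ` {1..n} \<union> Barred ` {1..n}"

datatype crystal_elt = Empty | Pr letter letter

definition crystal :: "nat \<Rightarrow> crystal_elt set" where
  "crystal n = {Empty} \<union> {Pr x y | x y. x \<in> letters n \<and> y \<in> letters n \<and> x \<le> y}"

abbreviation chi :: "bool \<Rightarrow> int" where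
  "chi \<equiv> of_bool"

fun energy :: "crystal_elt \<Rightarrow> crystal_elt \<Rightarrow> int" where
  "energy Empty Empty = 0"
| "energy Empty (Pr x y) = 1"
| "energy (Pr x y) Empty = 1"
| "energy (Pr x y) (Pr x' y') =
     (if bar y' \<noteq> x
      then chi (x \<ge> x') + chi (y \<ge> y') - chi (y \<ge> y' \<and> y' > x \<and> x \<ge> x')
      else chi (x > x') + chi (y > y') - chi (y > y' \<and> y' > x \<and> x > x'))"

definition ground :: "nat \<Rightarrow> crystal_elt" where
  "ground k = (if k = 0 then Empty else Pr (Plain k) (Barred k))"

section \<open>Grounded partitions\<close>

datatype colour = Col crystal_elt | Col_inf

definition colours_S :: "nat \<Rightarrow> colour set" where
  "colours_S n = Col ` (crystal n - {Empty})"

text \<open>Only the values on \<open>\<S> \<times> (\<S> \<squnion> {c\<^sub>\<infinity>})\<close> matter; the last equation is a dummy.\<close>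

fun rho :: "nat \<Rightarrow> colour \<Rightarrow> colour \<Rightarrow> int" where
  "rho i (Col b) Col_inf = (if b = ground i then 1 else energy (ground i) b)"
| "rho i (Col (Pr x' y')) (Col (Pr x y)) =
     chi (x \<ge> x') + chi (y \<ge> y') - chi (y \<ge> y' \<and> y' > x \<and> x \<ge> x')"
| "rho i _ _ = 0"

type_synonym coloured_int = "int \<times> colour"

definition grounded_partitions :: "nat \<Rightarrow> nat \<Rightarrow> coloured_int list set" where
  "grounded_partitions n i =
     {\<pi>. \<exists>ps. \<pi> = ps @ [(0, Col (ground i))] \<and>
             (\<forall>p\<in>set ps. snd p \<in> colours_S n) \<and>
             (let \<pi>' = ps @ [(0, Col_inf)] in
               \<forall>j<length ps. fst (\<pi>' ! j) - fst (\<pi>' ! (j + 1)) \<ge> rho i (snd (\<pi>' ! j)) (snd (\<pi>' ! (j + 1))))}"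

definition part_size :: "coloured_int list \<Rightarrow> int" where
  "part_size \<pi> = sum_list (map fst \<pi>)"

text \<open>The specialisation sends each colour to a formal exponential; the following functions give
  its exponent. The colour \<open>c\<^sub>\<infinity>\<close> never occurs in a partition.\<close>

fun letter_exponent :: "(nat \<Rightarrow> 'g \<Rightarrow> complex) \<Rightarrow> nat \<Rightarrow> letter \<Rightarrow> 'g \<Rightarrow> complex" where
  "letter_exponent \<alpha> n (Plain j) = (\<lambda>x. \<alpha> n x / 2 + (\<Sum>u\<in>{j..<n}. \<alpha> u x))"
| "letter_exponent \<alpha> n (Barred j) = (\<lambda>x. - (\<alpha> n x / 2 + (\<Sum>u\<in>{j..<n}. \<alpha> u x)))"

fun colour_exponent :: "(nat \<Rightarrow> 'g \<Rightarrow> complex) \<Rightarrow> nat \<Rightarrow> colour \<Rightarrow> 'g \<Rightarrow> complex" where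
  "colour_exponent \<alpha> n (Col Empty) = (\<lambda>x. 0)"
| "colour_exponent \<alpha> n (Col (Pr y z)) = (\<lambda>x. letter_exponent \<alpha> n y x + letter_exponent \<alpha> n z x)"
| "colour_exponent \<alpha> n Col_inf = (\<lambda>x. 0)"

text \<open>The exponent of \<open>C(\<pi>) q\<^bsup>|\<pi>|\<^esup>\<close> for \<open>q = e\<^bsup>-\<delta>\<^esup>\<close>.\<close>

definition partition_exponent ::
    "(nat \<Rightarrow> 'g \<Rightarrow> complex) \<Rightarrow> nat \<Rightarrow> coloured_int list \<Rightarrow> 'g \<Rightarrow> complex" where
  "partition_exponent \<alpha> n \<pi> =
     (\<lambda>x. (\<Sum>p\<leftarrow>\<pi>. colour_exponent \<alpha> n (snd p) x) - of_int (part_size \<pi>) * null_root \<alpha> n x)"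

end

theory Submission
  imports Defs "HOL-Library.Countable" "HOL-Library.Product_Lexorder"
    "HOL-Library.Multiset" "HOL-Computational_Algebra.Polynomial"
begin

text \<open>
  The module \<open>L(\<Lambda>\<^sub>i)\<close> is realised in a fermionic Fock space. There are two families of fermion
  fields \<open>\<psi>\<^sub>a\<close>, \<open>\<chi>\<^sub>a\<close>, indexed by the letters \<open>a\<close>, and the currents \<open>\<psi>\<^sub>a(z) \<chi>\<^sub>b(z) + \<psi>\<^sub>b(z) \<chi>\<^sub>a(z)\<close>
  span the affine algebra at level one. The choice of vacuum depends on \<open>i\<close>; the contravariant form
  of the Fock space is positive definite, so the submodule generated by the vacuum is irreducible,
  hence isomorphic to \<open>L(\<Lambda>\<^sub>i)\<close>. A part of size \<open>m\<close> and colour \<open>c\<^bsub>x,y\<^esub>\<close> corresponds to the mode \<open>X x y m\<close>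
  of a current, and the grounded partitions index a basis of this submodule.

  \<^item> Spanning: for every vector \<open>u\<close> the current \<open>2 \<psi>\<^sub>u(z) \<chi>\<^sub>u(z)\<close> squares to zero because \<open>\<psi>\<^sub>u(z)\<^sup>2 = 0\<close>.
    Polarisation gives, for each multiset \<open>a \<le> b \<le> c \<le> d\<close> of letters and each total size, a quadratic
    relation with leading term \<open>X a d m \<cdot> X b c m\<close> or \<open>X a b (m + 1) \<cdot> X c d m\<close>. These are exactly the
    pairs of parts which the difference conditions forbid.
  \<^item> Independence: number the fermion modes by slots, \<open>\<psi>\<^sub>a(k)\<close> in slot \<open>2k\<close> and \<open>\<chi>\<^sub>a(k)\<close> in slot
    \<open>2k - 1\<close>. In a suitable order the leading term of \<open>X x y m\<close> is the product of the fermion \<open>x\<close> in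
    slot \<open>m\<close> and the fermion \<open>y\<close> in slot \<open>m - 1\<close>. By the difference conditions the fermions obtained
    from a grounded partition are distinct and determine it.
\<close>

section \<open>Fermions\<close>

text \<open>The form \<open>J\<close> on the letters is antisymmetric, whereas anticommutators are
  symmetric. This is why there are two families of fermions: duality of modes exchanges the
  families, told apart by the parity of the slot, and the extra sign compensates that of
  \<open>J\<close>. Commutators of currents are computed only up to a multiple of the vector they
  act on. Spanning absorbs such multiples into shorter words. Where the constant matters, for
  \<open>E j\<close> against \<open>F j\<close>, it is found on the vacuum from the norm of
  \<open>F i vac\<close>. The two leading-term arguments use different orders, \<open>Phi\<close> on
  words and \<open>W\<close> on sets of modes; they meet in the index set \<open>GP\<close>. The
  abstract algebra is given by generators, so the isomorphism is a relation: \<open>Kr\<close>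
  matches words in the \<open>f j\<close> on a highest weight vector with the same words in the
  \<open>F j\<close> on the vacuum. Irreducibility makes it injective, and the positive definite
  form makes it single-valued.\<close>

instance letter :: countable by countable_datatype

type_synonym mode = "int \<times> letter"
text \<open>Arbitrary coefficient functions on sets of modes, so that all operators are total. The
  finite combinations are cut out later by \<open>Fock\<close>.\<close>

datatype fvec = Vec (coef: "mode set \<Rightarrow> complex")

lemma fvec_eq_iff: "f = g \<longleftrightarrow> (\<forall>A. coef f A = coef g A)"
  by (metis ext fvec.expand)

instantiation fvec :: ab_group_add
begin

definition "0 = Vec (\<lambda>A. 0)"
definition "f + g = Vec (\<lambda>A. coef f A + coef g A)"
definition "f - g = Vec (\<lambda>A. coef f A - coef g A)"
definition "- f = Vec (\<lambda>A. - coef f A)"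

instance
  by standard (auto simp: fvec_eq_iff zero_fvec_def plus_fvec_def minus_fvec_def uminus_fvec_def)

end

lemma coef_simps [simp]:
  "coef 0 A = 0" "coef (f + g) A = coef f A + coef g A" "coef (f - g) A = coef f A - coef g A"
  "coef (- f) A = - coef f A"
  by (auto simp: zero_fvec_def plus_fvec_def minus_fvec_def uminus_fvec_def)

lemma coef_sum: "coef (\<Sum>x\<in>S. g x) A = (\<Sum>x\<in>S. coef (g x) A)"
  by (induction S rule: infinite_finite_induct) auto

definition scl :: "complex \<Rightarrow> fvec \<Rightarrow> fvec" where
  "scl c f = Vec (\<lambda>A. c * coef f A)"

lemma coef_scl [simp]: "coef (scl c f) A = c * coef f A"
  by (simp add: scl_def)

interpretation FV: vector_space scl
  by unfold_locales (auto simp: fvec_eq_iff algebra_simps)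

text \<open>The Jordan-Wigner sign. Ordering the modes by \<open>to_nat\<close> puts only finitely
  many of them before \<open>p\<close>, so the exponent is a genuine count even for infinite
  \<open>A\<close>.\<close>

definition sg :: "mode \<Rightarrow> mode set \<Rightarrow> complex" where
  "sg p A = (- 1) ^ card {q \<in> A. to_nat q < to_nat p}"

definition cre :: "mode \<Rightarrow> fvec \<Rightarrow> fvec" where
  "cre p f = Vec (\<lambda>A. if p \<in> A then sg p A * coef f (A - {p}) else 0)"

definition ann :: "mode \<Rightarrow> fvec \<Rightarrow> fvec" where
  "ann p f = Vec (\<lambda>A. if p \<notin> A then sg p A * coef f (insert p A) else 0)"

lemma sg_sq [simp]: "sg p A * sg p A = 1" "sg p A * (sg p A * x) = x"
  by (auto simp: sg_def simp flip: power_add mult.assoc)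

lemma sg_nonzero [simp]: "sg p A \<noteq> 0"
  by (simp add: sg_def)

lemma sg_self [simp]: "sg p (insert p A) = sg p A" "sg p (A - {p}) = sg p A"
proof -
  have "{q \<in> insert p A. to_nat q < to_nat p} = {q \<in> A. to_nat q < to_nat p}"
    "{q \<in> A - {p}. to_nat q < to_nat p} = {q \<in> A. to_nat q < to_nat p}" by auto
  then show "sg p (insert p A) = sg p A" "sg p (A - {p}) = sg p A" by (simp_all add: sg_def)
qed

lemma finite_below: "finite {q \<in> (A :: mode set). to_nat q < to_nat (p::mode)}"
proof -
  have "finite (to_nat -` {..<to_nat p} :: mode set)"
    by (intro finite_vimageI) auto
  then show ?thesis by (rule rev_finite_subset) auto
qed

lemma sg_insert:
  assumes "q \<notin> A" "p \<noteq> q"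
  shows "sg p (insert q A) = (if to_nat q < to_nat p then - sg p A else sg p A)"
proof (cases "to_nat q < to_nat p")
  case True
  then have "{r \<in> insert q A. to_nat r < to_nat p} = insert q {r \<in> A. to_nat r < to_nat p}" by auto
  then show ?thesis using True assms finite_below[of A p] by (simp add: sg_def)
next
  case False
  then have "{r \<in> insert q A. to_nat r < to_nat p} = {r \<in> A. to_nat r < to_nat p}" by auto
  then show ?thesis using False by (simp add: sg_def)
qed

lemma sg_remove:
  assumes "q \<in> A" "p \<noteq> q"
  shows "sg p (A - {q}) = (if to_nat q < to_nat p then - sg p A else sg p A)"
  using sg_insert[of q "A - {q}" p] assms by (auto simp: insert_absorb split: if_splits)

lemma to_nat_neq: "p \<noteq> q \<Longrightarrow> to_nat (p::mode) < to_nat q \<or> to_nat q < to_nat p"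
  by (metis inj_to_nat injD linorder_neqE_nat)

lemma cre_cre: "cre p (cre q f) + cre q (cre p f) = 0"
proof (cases "p = q")
  case True
  then show ?thesis by (auto simp: cre_def fvec_eq_iff)
next
  case False
  have [simp]: "A - {p} - {q} = A - {q} - {p}" for A :: "mode set" by auto
  show ?thesis
    using False to_nat_neq[OF False] by (auto simp: cre_def fvec_eq_iff sg_remove)
qed

lemma ann_ann: "ann p (ann q f) + ann q (ann p f) = 0"
proof (cases "p = q")
  case True
  then show ?thesis by (auto simp: ann_def fvec_eq_iff)
next
  case False
  show ?thesis
    using False to_nat_neq[OF False] by (auto simp: ann_def fvec_eq_iff sg_insert insert_commute)
qed

lemma ann_cre: "ann p (cre q f) + cre q (ann p f) = (if p = q then f else 0)"
proof (cases "p = q")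
  case True
  then show ?thesis by (auto simp: ann_def cre_def fvec_eq_iff insert_absorb)
next
  case False
  have [simp]: "insert p A - {q} = insert p (A - {q})" for A :: "mode set" using False by auto
  show ?thesis
    using False to_nat_neq[OF False] by (auto simp: ann_def cre_def fvec_eq_iff sg_insert sg_remove)
qed

lemma cre_add: "cre p (f + g) = cre p f + cre p g"
  by (auto simp: cre_def fvec_eq_iff algebra_simps)
lemma cre_scl: "cre p (scl c f) = scl c (cre p f)"
  by (auto simp: cre_def fvec_eq_iff)
lemma ann_add: "ann p (f + g) = ann p f + ann p g"
  by (auto simp: ann_def fvec_eq_iff algebra_simps)
lemma ann_scl: "ann p (scl c f) = scl c (ann p f)"
  by (auto simp: ann_def fvec_eq_iff)

section \<open>Letters, signs and the duality of modes\<close>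

lemma bar_bar [simp]: "bar (bar a) = a"
  by (cases a) auto

lemma bar_neq [simp]: "bar a \<noteq> a" "a \<noteq> bar a"
  by (cases a; simp)+

lemma bar_eq_iff [simp]: "bar a = bar b \<longleftrightarrow> a = b"
  by (metis bar_bar)

lemma bar_letters [simp]: "bar a \<in> letters n \<longleftrightarrow> a \<in> letters n"
  by (cases a) (auto simp: letters_def)

lemma finite_letters [simp]: "finite (letters n)"
  by (simp add: letters_def)

fun J :: "letter \<Rightarrow> complex" where
  "J (Plain k) = 1"
| "J (Barred k) = - 1"

lemma J_bar [simp]: "J (bar a) = - J a"
  by (cases a) auto

lemma J_sq [simp]: "J a * J a = 1" "J a * (J a * x) = x"
  by (cases a; simp)+

lemma J_nonzero [simp]: "J a \<noteq> 0"
  by (cases a) auto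

text \<open>The anticommutator of \<open>p\<close> with \<open>dual p\<close>. It is symmetric in
  the two modes, as it must be: \<open>dual\<close> changes the parity of the slot and the sign of
  \<open>J\<close> at the same time.\<close>

definition sgnG :: "mode \<Rightarrow> complex" where
  "sgnG p = (if even (fst p) then J (snd p) else - J (snd p))"

definition dual :: "mode \<Rightarrow> mode" where
  "dual p = (- 1 - fst p, bar (snd p))"

lemma dual_dual [simp]: "dual (dual p) = p"
  by (simp add: dual_def)

lemma sgnG_dual [simp]: "sgnG (dual p) = sgnG p"
  by (auto simp: sgnG_def dual_def)

lemma sgnG_sq [simp]: "sgnG p * sgnG p = 1" "sgnG p * (sgnG p * x) = x"
  by (auto simp: sgnG_def)

lemma sgnG_nonzero [simp]: "sgnG p \<noteq> 0"
  by (auto simp: sgnG_def)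

definition vac :: fvec where
  "vac = Vec (\<lambda>A. if A = {} then 1 else 0)"

locale fock =
  fixes n i :: nat
  assumes n_ge_2: "2 \<le> n" and i_le: "i \<le> n"
begin

text \<open>\<open>cr p\<close> says that the mode \<open>p\<close> creates, i.e. does not annihilate the vacuum of \<open>\<Lambda>\<^sub>i\<close>. Exactly one of
  \<open>p\<close> and \<open>dual p\<close> does.\<close>

definition cr :: "mode \<Rightarrow> bool" where
  "cr p \<longleftrightarrow> fst p \<ge> 1 \<or> fst p = 0 \<and> snd p > Plain i \<or> fst p = - 1 \<and> snd p \<ge> Barred i"

lemma cr_dual: "cr (dual p) \<longleftrightarrow> \<not> cr p"
  by (cases "snd p") (auto simp: cr_def dual_def less_letter_def)

definition z :: "mode \<Rightarrow> fvec \<Rightarrow> fvec" where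
  "z p f = (if cr p then cre p f else scl (sgnG p) (ann (dual p) f))"

lemma z_add: "z p (f + g) = z p f + z p g"
  by (simp add: z_def cre_add ann_add FV.scale_right_distrib)

lemma z_scl: "z p (scl c f) = scl c (z p f)"
  by (simp add: z_def cre_scl ann_scl mult.commute)

lemma z_zero [simp]: "z p 0 = 0"
  using z_scl[of p 0 0] by simp

lemma z_uminus: "z p (- f) = - z p f"
  using z_scl[of p "-1" f] by simp

lemma z_diff: "z p (f - g) = z p f - z p g"
  using z_add[of p f "- g"] z_uminus[of p g] by simp

lemma z_sum: "z p (\<Sum>x\<in>S. g x) = (\<Sum>x\<in>S. z p (g x))"
  by (induction S rule: infinite_finite_induct) (auto simp: z_add)

text \<open>The Clifford relation does not depend on the vacuum: \<open>cr\<close> only decides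
  which of \<open>p\<close> and \<open>dual p\<close> is represented by a creation operator. Two
  creating or two annihilating modes are never dual, by \<open>cr_dual\<close>.\<close>

lemma z_anticomm: "z p (z q f) + z q (z p f) = (if q = dual p then scl (sgnG p) f else 0)"
proof -
  have d: "dual p = q \<longleftrightarrow> q = dual p" "p = dual q \<longleftrightarrow> q = dual p" by auto
  consider "cr p" "cr q" | "cr p" "\<not> cr q" | "\<not> cr p" "cr q" | "\<not> cr p" "\<not> cr q" by blast
  then show ?thesis
  proof cases
    case 1
    then have "q \<noteq> dual p" using cr_dual by blast
    then show ?thesis using 1 cre_cre[of p q f] by (simp add: z_def)
  next
    case 2
    have "z p (z q f) + z q (z p f) = scl (sgnG q) (ann (dual q) (cre p f) + cre p (ann (dual q) f))"
      using 2 by (simp add: z_def cre_scl FV.scale_right_distrib add.commute)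
    then show ?thesis using d by (auto simp: ann_cre)
  next
    case 3
    have "z p (z q f) + z q (z p f) = scl (sgnG p) (ann (dual p) (cre q f) + cre q (ann (dual p) f))"
      using 3 by (simp add: z_def cre_scl FV.scale_right_distrib add.commute)
    then show ?thesis using d by (auto simp: ann_cre)
  next
    case 4
    then have "q \<noteq> dual p" using cr_dual by blast
    have "z p (z q f) + z q (z p f)
        = scl (sgnG p * sgnG q) (ann (dual p) (ann (dual q) f) + ann (dual q) (ann (dual p) f))"
      using 4 by (simp add: z_def ann_scl FV.scale_right_distrib mult.commute)
    then show ?thesis using \<open>q \<noteq> dual p\<close> by (simp add: ann_ann)
  qed
qed

lemma z_swap: "z p (z q f) = (if q = dual p then scl (sgnG p) f else 0) - z q (z p f)"
  using z_anticomm[of p q f] by (metis add_diff_cancel_right')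

lemma z_vac: "\<not> cr p \<Longrightarrow> z p vac = 0"
  by (auto simp: z_def ann_def vac_def fvec_eq_iff)

text \<open>The span of the monomials in creating modes. Its induction rule reduces an operator
  identity to the vacuum and to passing one fermion.\<close>

inductive_set Fock :: "fvec set" where
  vac: "vac \<in> Fock"
| add: "f \<in> Fock \<Longrightarrow> g \<in> Fock \<Longrightarrow> f + g \<in> Fock"
| scl: "f \<in> Fock \<Longrightarrow> scl c f \<in> Fock"
| cre: "f \<in> Fock \<Longrightarrow> cr p \<Longrightarrow> z p f \<in> Fock"

lemma Fock_subspace: "FV.subspace Fock"
  unfolding FV.subspace_def using Fock.scl[OF Fock.vac, of 0] Fock.add Fock.scl by simp

lemma Fock_0 [simp]: "0 \<in> Fock"
  using Fock_subspace FV.subspace_0 by blast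

lemma Fock_sum: "(\<And>x. x \<in> S \<Longrightarrow> g x \<in> Fock) \<Longrightarrow> (\<Sum>x\<in>S. g x) \<in> Fock"
  using Fock_subspace by (rule FV.subspace_sum)

lemma Fock_diff: "f \<in> Fock \<Longrightarrow> g \<in> Fock \<Longrightarrow> f - g \<in> Fock"
  using Fock_subspace by (rule FV.subspace_diff)

lemma Fock_z: "f \<in> Fock \<Longrightarrow> z p f \<in> Fock"
proof (induction rule: Fock.induct)
  case vac
  then show ?case using z_vac[of p] Fock.cre[OF Fock.vac, of p] Fock_0 by (cases "cr p") simp_all
next
  case (cre f q)
  then have "(if q = dual p then scl (sgnG p) f else 0) - z q (z p f) \<in> Fock"
    using Fock.cre[OF cre.IH cre.hyps(2)] Fock.scl[OF cre.hyps(1)] by (intro Fock_diff) auto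
  then show ?case by (simp only: z_swap[of p q])
qed (auto simp: z_add z_scl intro: Fock.intros)

text \<open>The source of all finiteness: slots far enough below zero kill a given vector, so the
  sums defining the currents are finite on it.\<close>

lemma Fock_bounded: "f \<in> Fock \<Longrightarrow> \<exists>K\<ge>0. \<forall>s a. s < - K \<longrightarrow> z (s, a) f = 0"
proof (induction rule: Fock.induct)
  case vac
  then show ?case by (intro exI[of _ 1]) (auto intro!: z_vac simp: cr_def)
next
  case (add f g)
  then obtain K L where "K \<ge> 0" "\<forall>s a. s < - K \<longrightarrow> z (s, a) f = 0" "\<forall>s a. s < - L \<longrightarrow> z (s, a) g = 0" by blast
  then show ?case by (intro exI[of _ "max K L"]) (auto simp: z_add)
next
  case (scl f c)
  then show ?case by (auto simp: z_scl)
next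
  case (cre f q)
  then obtain K where K: "K \<ge> 0" "\<forall>s a. s < - K \<longrightarrow> z (s, a) f = 0" by blast
  \<comment> \<open>Below this bound the dual slot \<open>- 1 - s\<close> exceeds the absolute value
    of \<open>fst q\<close>, so \<open>z (s, a)\<close> has no contraction with
    \<open>z q\<close>.\<close>
  show ?case
  proof (intro exI[of _ "max K (\<bar>fst q\<bar> + 1)"] conjI allI impI)
    fix s a assume s: "s < - max K (\<bar>fst q\<bar> + 1)"
    then have "q \<noteq> dual (s, a)" by (auto simp: dual_def)
    then show "z (s, a) (z q f) = 0" using K s by (subst z_swap) auto
  qed (use K in auto)
qed

lemma Fock_finite: "f \<in> Fock \<Longrightarrow> finite {A. coef f A \<noteq> 0} \<and> (\<forall>A. coef f A \<noteq> 0 \<longrightarrow> finite A)"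
proof (induction rule: Fock.induct)
  case vac
  then show ?case by (auto simp: vac_def)
next
  case (add f g)
  have "{A. coef (f + g) A \<noteq> 0} \<subseteq> {A. coef f A \<noteq> 0} \<union> {A. coef g A \<noteq> 0}" by auto
  with add show ?case by (auto intro: finite_subset)
next
  case (scl f c)
  have "{A. coef (scl c f) A \<noteq> 0} \<subseteq> {A. coef f A \<noteq> 0}" by auto
  with scl show ?case by (auto intro: finite_subset)
next
  case (cre f q)
  have "{A. coef (z q f) A \<noteq> 0} \<subseteq> insert q ` {A. coef f A \<noteq> 0}"
  proof
    fix A assume "A \<in> {A. coef (z q f) A \<noteq> 0}"
    then have "q \<in> A" "coef f (A - {q}) \<noteq> 0" using cre by (auto simp: z_def cre_def split: if_splits)
    then show "A \<in> insert q ` {A. coef f A \<noteq> 0}" by (intro image_eqI[of _ _ "A - {q}"]) auto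
  qed
  with cre show ?case by (auto intro: finite_subset)
qed

text \<open>If a nonempty \<open>A\<close> is in the support and \<open>p \<in> A\<close>, then
  \<open>p\<close> creates, and \<open>z (dual p)\<close> leaves \<open>A - {p}\<close> in the
  support. So only the empty set can occur.\<close>

lemma Fock_killed:
  assumes "f \<in> Fock" "\<And>p. \<not> cr p \<Longrightarrow> z p f = 0"
  shows "f = scl (coef f {}) vac"
proof -
  have supp: "g \<in> Fock \<Longrightarrow> coef g A \<noteq> 0 \<Longrightarrow> p \<in> A \<Longrightarrow> cr p" for g A p
  proof (induction arbitrary: A rule: Fock.induct)
    case vac
    then show ?case by (auto simp: vac_def split: if_splits)
  next
    case (cre f q)
    then have "q \<in> A" "coef f (A - {q}) \<noteq> 0" by (auto simp: z_def cre_def split: if_splits)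
    then show ?case using cre by (cases "p = q") auto
  next
    case (add f g)
    then show ?case by (metis add_cancel_right_left coef_simps(2))
  qed auto
  have "coef f A = 0" if "A \<noteq> {}" for A
  proof (rule ccontr)
    assume f: "coef f A \<noteq> 0"
    from that obtain p where p: "p \<in> A" by blast
    have "coef (z (dual p) f) (A - {p}) = 0" using assms(2)[of "dual p"] supp[OF assms(1) f p] cr_dual by simp
    then show False using f p supp[OF assms(1) f p] cr_dual[of p]
      by (simp add: z_def ann_def insert_absorb)
  qed
  then show ?thesis by (auto simp: fvec_eq_iff vac_def)
qed


section \<open>The current algebra\<close>

definition pr :: "mode \<Rightarrow> mode \<Rightarrow> complex" where
  "pr p q = (if q = dual p then sgnG p else 0)"

lemma z_swap_pr: "z p (z q f) = scl (pr p q) f - z q (z p f)"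
  using z_swap[of p q f] by (auto simp: pr_def)

lemma z_triple: "z p (z q (z r f)) = z r (z p (z q f)) + scl (pr q r) (z p f) - scl (pr p r) (z q f)"
  by (simp add: z_swap_pr[of q r] z_diff z_scl z_swap_pr[of p r "z q f"])

text \<open>The symplectic form on the letters, antisymmetric because
  \<open>J (bar c) = - J c\<close>.\<close>

definition jj :: "letter \<Rightarrow> letter \<Rightarrow> complex" where
  "jj c b = (if b = bar c then J c else 0)"

definition T :: "letter \<Rightarrow> letter \<Rightarrow> int \<Rightarrow> int \<Rightarrow> fvec \<Rightarrow> fvec" where
  "T a b m k f = z (2 * k, a) (z (2 * m - 1 - 2 * k, b) f) + z (2 * k, b) (z (2 * m - 1 - 2 * k, a) f)"

text \<open>The two terms of \<open>T\<close> have opposite vacuum expectation values, so their sum over all \<open>k\<close> is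
  locally finite without normal ordering.\<close>

definition X :: "letter \<Rightarrow> letter \<Rightarrow> int \<Rightarrow> fvec \<Rightarrow> fvec" where
  "X a b m f = (\<Sum>k | T a b m k f \<noteq> 0. T a b m k f)"

lemma T_commute: "T a b m k f = T b a m k f"
  by (simp add: T_def add.commute)

lemma X_commute: "X a b m f = X b a m f"
  by (simp add: X_def T_commute)

lemma T_add: "T a b m k (f + g) = T a b m k f + T a b m k g"
  by (simp add: T_def z_add)

lemma T_scl: "T a b m k (scl c f) = scl c (T a b m k f)"
  by (simp add: T_def z_scl FV.scale_right_distrib)

lemma T_Fock: "f \<in> Fock \<Longrightarrow> T a b m k f \<in> Fock"
  by (simp add: T_def Fock.add Fock_z)

lemma X_Fock: "f \<in> Fock \<Longrightarrow> X a b m f \<in> Fock"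
  by (simp add: X_def Fock_sum T_Fock)

lemma z_far:
  assumes "\<And>s a. s < - K \<Longrightarrow> z (s, a) f = 0" "s < - K"
  shows "z (s, a) (z q f) = scl (pr (s, a) q) f"
  using assms by (simp add: z_swap_pr[of "(s, a)"])

text \<open>For large \<open>k\<close> the odd slot kills \<open>f\<close>. For very negative
  \<open>k\<close> the even slot kills it after a contraction; contractions occur only for
  \<open>b = bar a\<close>, and then their values \<open>J a\<close> and \<open>J b\<close>
  cancel.\<close>

lemma T_far:
  assumes "\<And>s a. s < - K \<Longrightarrow> z (s, a) f = 0" "\<bar>k\<bar> > K + \<bar>m\<bar>" "K \<ge> 0"
  shows "T a b m k f = 0"
proof (cases "k > 0")
  case True
  then have "2 * m - 1 - 2 * k < - K" using assms(2,3) by linarith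
  then show ?thesis using assms(1) by (simp add: T_def)
next
  case False
  then have k: "2 * k < - K" using assms(2,3) by linarith
  have "pr (2 * k, a) (2 * m - 1 - 2 * k, b) + pr (2 * k, b) (2 * m - 1 - 2 * k, a) = 0"
    by (auto simp: pr_def dual_def sgnG_def)
  moreover have "T a b m k f
      = scl (pr (2 * k, a) (2 * m - 1 - 2 * k, b) + pr (2 * k, b) (2 * m - 1 - 2 * k, a)) f"
    unfolding T_def FV.scale_left_distrib by (simp only: z_far[OF assms(1) k])
  ultimately show ?thesis by simp
qed

text \<open>One window serves all pairs of letters, and every larger finite set serves as well, so
  the windows of several vectors can be united.\<close>

definition win :: "int \<Rightarrow> fvec \<Rightarrow> int \<Rightarrow> bool" where
  "win m f K \<longleftrightarrow> (\<forall>S a b. finite S \<longrightarrow> {- K..K} \<subseteq> S \<longrightarrow> X a b m f = (\<Sum>k\<in>S. T a b m k f))"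

lemma winD: "win m f K \<Longrightarrow> finite S \<Longrightarrow> {- K..K} \<subseteq> S \<Longrightarrow> X a b m f = (\<Sum>k\<in>S. T a b m k f)"
  by (simp add: win_def)

lemma win_exists:
  assumes "f \<in> Fock"
  shows "\<exists>K. win m f K"
proof -
  obtain K where K: "K \<ge> 0" "\<And>s a. s < - K \<Longrightarrow> z (s, a) f = 0"
    using Fock_bounded[OF assms] by blast
  show ?thesis
    unfolding win_def
  proof (intro exI[of _ "K + \<bar>m\<bar>"] allI impI)
    fix S a b assume S: "finite S" "{- (K + \<bar>m\<bar>)..K + \<bar>m\<bar>} \<subseteq> S"
    have "{k. T a b m k f \<noteq> 0} \<subseteq> S"
    proof
      fix k assume "k \<in> {k. T a b m k f \<noteq> 0}"
      then have "\<not> \<bar>k\<bar> > K + \<bar>m\<bar>" using T_far[OF K(2) _ K(1)] by blast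
      then have "k \<in> {- (K + \<bar>m\<bar>)..K + \<bar>m\<bar>}" by auto
      then show "k \<in> S" using S by blast
    qed
    then show "X a b m f = (\<Sum>k\<in>S. T a b m k f)"
      unfolding X_def using S by (intro sum.mono_neutral_left) auto
  qed
qed

lemma X_add:
  assumes "f \<in> Fock" "g \<in> Fock"
  shows "X a b m (f + g) = X a b m f + X a b m g"
proof -
  obtain K1 where "win m f K1" using win_exists[OF assms(1)] by blast
  note K1 = winD[OF this]
  obtain K2 where "win m g K2" using win_exists[OF assms(2)] by blast
  note K2 = winD[OF this]
  obtain K3 where "win m (f + g) K3" using win_exists[OF Fock.add[OF assms]] by blast
  note K3 = winD[OF this]
  define S where "S = {- K1..K1} \<union> {- K2..K2} \<union> {- K3..K3}"
  have "finite S" "{- K1..K1} \<subseteq> S" "{- K2..K2} \<subseteq> S" "{- K3..K3} \<subseteq> S" by (auto simp: S_def)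
  then show ?thesis by (simp add: K1[of S] K2[of S] K3[of S] T_add sum.distrib)
qed

lemma X_scl:
  assumes "f \<in> Fock"
  shows "X a b m (scl c f) = scl c (X a b m f)"
proof (cases "c = 0")
  case True
  have "T a b m k 0 = 0" for k by (simp add: T_def)
  then show ?thesis using True by (simp add: X_def)
next
  case False
  then show ?thesis by (simp add: X_def T_scl FV.scale_sum_right)
qed

lemma X_0 [simp]: "X a b m 0 = 0"
  using X_scl[OF Fock_0, of a b m 0] by simp

lemma X_diff: "f \<in> Fock \<Longrightarrow> g \<in> Fock \<Longrightarrow> X a b m (f - g) = X a b m f - X a b m g"
  using X_add[of f "scl (-1) g" a b m] X_scl[of g a b m "-1"] Fock.scl[of g "-1"] by simp

lemma X_sum:
  "(\<And>x. x \<in> S \<Longrightarrow> g x \<in> Fock) \<Longrightarrow> X a b m (\<Sum>x\<in>S. g x) = (\<Sum>x\<in>S. X a b m (g x))"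
  by (induction S rule: infinite_finite_induct) (auto simp: X_add Fock_sum)

text \<open>Only one summand contracts with \<open>z (s, c)\<close>. An even slot \<open>s\<close>
  meets the odd slot \<open>- 1 - s\<close>, which forces \<open>k = s div 2 + m\<close>; an odd
  slot meets the even slot \<open>- 1 - s\<close>, which forces
  \<open>k = - ((s + 1) div 2)\<close>. In both cases the fermion that is left sits in slot
  \<open>s + 2 * m\<close>.\<close>

lemma T_z: "T a b m k (z (s, c) f) = z (s, c) (T a b m k f)
    + (if k = (if even s then s div 2 + m else - ((s + 1) div 2))
       then scl (jj c b) (z (s + 2 * m, a) f) + scl (jj c a) (z (s + 2 * m, b) f) else 0)"
proof -
  define t where "t = 2 * m - 1 - 2 * k"
  have *: "T a b m k (z (s, c) f) = z (s, c) (T a b m k f)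
      + (scl (pr (t, b) (s, c)) (z (2 * k, a) f) - scl (pr (2 * k, a) (s, c)) (z (t, b) f)
      + (scl (pr (t, a) (s, c)) (z (2 * k, b) f) - scl (pr (2 * k, b) (s, c)) (z (t, a) f)))"
    unfolding T_def t_def[symmetric] z_triple[of _ _ "(s, c)"] z_add by (simp add: algebra_simps)
  have bj: "b = bar c \<longleftrightarrow> c = bar b" for b c by auto
  show ?thesis
  proof (cases "even s")
    case True
    then obtain j where j: "s = 2 * j" by auto
    have p0: "pr (2 * k, x) (s, c) = 0" for x by (auto simp: pr_def dual_def j) presburger
    have p1: "pr (t, x) (s, c) = (if k = j + m then jj c x else 0)" for x
      by (auto simp: pr_def dual_def j t_def sgnG_def jj_def)
    show ?thesis unfolding * p0 p1 using j by (auto simp: algebra_simps)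
  next
    case False
    then obtain j where j: "s = 2 * j + 1" by (auto elim: oddE)
    have p0: "pr (t, x) (s, c) = 0" for x by (auto simp: pr_def dual_def j t_def) presburger
    have p1: "pr (2 * k, x) (s, c) = (if k = - (j + 1) then - jj c x else 0)" for x
      by (auto simp: pr_def dual_def j t_def sgnG_def jj_def)
    have e: "(s + 1) div 2 = j + 1" "odd s" using j by auto
    have t: "k = - (j + 1) \<Longrightarrow> t = s + 2 * m" by (simp add: j t_def)
    show ?thesis
    proof (cases "k = - (j + 1)")
      case True
      show ?thesis unfolding * p0 p1 unfolding t[OF True] using e True by (simp add: add.commute)
    next
      case False
      then show ?thesis unfolding * p0 p1 using e by simp
    qed
  qed
qed

lemma X_z:
  assumes "f \<in> Fock"
  shows "X a b m (z (s, c) f) = z (s, c) (X a b m f)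
    + (scl (jj c b) (z (s + 2 * m, a) f) + scl (jj c a) (z (s + 2 * m, b) f))"
proof -
  define k0 where "k0 = (if even s then s div 2 + m else - ((s + 1) div 2))"
  obtain K1 where "win m f K1" using win_exists[OF assms(1)] by blast
  note K1 = winD[OF this]
  obtain K2 where "win m (z (s, c) f) K2" using win_exists[OF Fock_z[OF assms(1)]] by blast
  note K2 = winD[OF this]
  define S where "S = {- K1..K1} \<union> {- K2..K2} \<union> {k0}"
  have S: "finite S" "{- K1..K1} \<subseteq> S" "{- K2..K2} \<subseteq> S" "k0 \<in> S" by (auto simp: S_def)
  show ?thesis
    unfolding K2[OF S(1,3)] K1[OF S(1,2)] T_z k0_def[symmetric] sum.distrib z_sum sum.delta[OF S(1)]
    using S(4) by simp
qed

text \<open>Products of only one order of letters, as opposed to \<open>T\<close>, need not vanish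
  outside the window, but there they are multiples of \<open>f\<close>. Changing the window
  therefore costs a multiple of \<open>f\<close>, which is where the central term comes
  from.\<close>

lemma window_shift:
  assumes K: "\<And>s a. s < - K \<Longrightarrow> z (s, a) f = 0" and "K \<ge> 0"
    and S: "finite S" "finite S'" "{- (K + \<bar>m\<bar>)..K + \<bar>m\<bar>} \<subseteq> S" "{- (K + \<bar>m\<bar>)..K + \<bar>m\<bar>} \<subseteq> S'"
  shows "\<exists>c. (\<Sum>k\<in>S. z (2 * k, a) (z (2 * m - 1 - 2 * k, b) f))
      = (\<Sum>k\<in>S'. z (2 * k, a) (z (2 * m - 1 - 2 * k, b) f)) + scl c f"
proof -
  let ?g = "\<lambda>k. z (2 * k, a) (z (2 * m - 1 - 2 * k, b) f)"
  have far: "\<exists>c. ?g k = scl c f" if "k \<notin> {- (K + \<bar>m\<bar>)..K + \<bar>m\<bar>}" for k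
  proof (cases "k > 0")
    case True
    then have "2 * m - 1 - 2 * k < - K" using that \<open>K \<ge> 0\<close> by auto
    then show ?thesis using K by (intro exI[of _ 0]) auto
  next
    case False
    then have "2 * k < - K" using that \<open>K \<ge> 0\<close> by auto
    then show ?thesis using z_far[OF K] by blast
  qed
  have sub: "\<exists>c. sum ?g R = scl c f" if "finite R" "R \<inter> {- (K + \<bar>m\<bar>)..K + \<bar>m\<bar>} = {}" for R
    using that
  proof (induction R rule: finite_induct)
    case empty
    then show ?case by (auto intro: exI[of _ 0])
  next
    case (insert k R)
    have "R \<inter> {- (K + \<bar>m\<bar>)..K + \<bar>m\<bar>} = {}" "k \<notin> {- (K + \<bar>m\<bar>)..K + \<bar>m\<bar>}"
      using insert.prems by auto
    then obtain c c' where "sum ?g R = scl c f" "?g k = scl c' f"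
      using insert.IH far[of k] by metis
    then show ?case using insert by (intro exI[of _ "c' + c"]) (simp add: FV.scale_left_distrib)
  qed
  obtain c where c: "sum ?g (S - S') = scl c f" using sub[of "S - S'"] S by auto
  obtain c' where c': "sum ?g (S' - S) = scl c' f" using sub[of "S' - S"] S by auto
  have "sum ?g S = sum ?g (S \<inter> S') + scl c f"
    using sum.Int_Diff[OF S(1), of ?g S'] c by simp
  moreover have "sum ?g S' = sum ?g (S \<inter> S') + scl c' f"
    using sum.Int_Diff[OF S(2), of ?g S] c' by (simp add: Int_commute)
  ultimately show ?thesis
    by (intro exI[of _ "c - c'"]) (simp add: FV.scale_left_diff_distrib)
qed

text \<open>Commuting with the second current shifts the slots of some products by \<open>k\<close>,
  and hence their window; moving it back costs a multiple of \<open>f\<close>, the central term. Its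
  value stays open: the lemma is applied modulo shorter words or inside a subspace that contains
  \<open>f\<close>.\<close>

lemma X_comm:
  assumes "f \<in> Fock"
  shows "\<exists>e. X a b k (X c d l f) = X c d l (X a b k f)
    + (scl (jj c b) (X a d (k + l) f) + scl (jj c a) (X b d (k + l) f)
     + scl (jj d b) (X a c (k + l) f) + scl (jj d a) (X b c (k + l) f)) + scl e f"
proof -
  obtain K where K: "K \<ge> 0" "\<And>s a. s < - K \<Longrightarrow> z (s, a) f = 0"
    using Fock_bounded[OF assms] by blast
  obtain K1 where "win l f K1" using win_exists[OF assms(1)] by blast
  note K1 = winD[OF this]
  obtain K2 where "win l (X a b k f) K2" using win_exists[OF X_Fock[OF assms(1)]] by blast
  note K2 = winD[OF this]
  obtain K3 where "win (k + l) f K3" using win_exists[OF assms(1)] by blast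
  note K3 = winD[OF this]
  define L where "L = K + \<bar>k + l\<bar>"
  \<comment> \<open>The summand for \<open>k\<close> keeps the required windows inside
    \<open>S\<close> after a shift by \<open>k\<close> in either direction.\<close>
  define M where "M = Max {K1, K2, K3, L} + \<bar>k\<bar>"
  have "K1 \<le> Max {K1, K2, K3, L}" "K2 \<le> Max {K1, K2, K3, L}" "K3 \<le> Max {K1, K2, K3, L}"
    "L \<le> Max {K1, K2, K3, L}" by (rule Max_ge; simp)+
  then have M: "K1 \<le> M" "K2 \<le> M" "K3 \<le> M" "L \<le> M" "L \<le> M + k" "L \<le> M - k"
    unfolding M_def by linarith+
  define S where "S = {- M..M}"
  define S' where "S' = {- M + k..M + k}"
  have S: "finite S" "{- K1..K1} \<subseteq> S" "{- K2..K2} \<subseteq> S" "{- K3..K3} \<subseteq> S"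
    "{- L..L} \<subseteq> S" "{- L..L} \<subseteq> S'" "finite S'"
    using M by (auto simp: S_def S'_def)
  define g where "g x y j = z (2 * j, x) (z (2 * (k + l) - 1 - 2 * j, y) f)" for x y j
  have shift: "(\<Sum>j\<in>S. g x y (j + k)) = (\<Sum>j\<in>S'. g x y j)" for x y
    by (rule sum.reindex_bij_witness[of _ "\<lambda>j. j - k" "\<lambda>j. j + k"]) (auto simp: S_def S'_def)
  have ex: "\<exists>e. (\<Sum>j\<in>S'. g x y j) = (\<Sum>j\<in>S. g x y j) + scl e f" for x y
    unfolding g_def using window_shift[OF K(2) K(1) S(7,1) S(6,5)[unfolded L_def]] .
  then obtain e where e: "\<And>x y. (\<Sum>j\<in>S'. g x y j) = (\<Sum>j\<in>S. g x y j) + scl (e x y) f" by metis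
  have Xg: "X x y (k + l) f = (\<Sum>j\<in>S. g x y j) + (\<Sum>j\<in>S. g y x j)" for x y
    by (simp add: K3[OF S(1,4)] T_def g_def sum.distrib)
  have zz: "X a b k (z (2 * j, x) (z (2 * l - 1 - 2 * j, y) f))
     = z (2 * j, x) (z (2 * l - 1 - 2 * j, y) (X a b k f))
      + (scl (jj y b) (g x a j) + scl (jj y a) (g x b j)
      + (scl (jj x b) (g a y (j + k)) + scl (jj x a) (g b y (j + k))))" for x y j
  proof -
    have i: "2 * j + 2 * k = 2 * (j + k)" "2 * l - 1 - 2 * j + 2 * k = 2 * (k + l) - 1 - 2 * j"
      "2 * l - 1 - 2 * j = 2 * (k + l) - 1 - 2 * (j + k)" by auto
    show ?thesis
      unfolding X_z[OF Fock_z[OF assms]] X_z[OF assms] z_add z_scl g_def i(1,2) i(3)[symmetric]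
      by (simp only: add_ac)
  qed
  have "X a b k (X c d l f) = (\<Sum>j\<in>S. X a b k (T c d l j f))"
    unfolding K1[OF S(1,2)] by (rule X_sum) (rule T_Fock[OF assms])
  also have "\<dots> = (\<Sum>j\<in>S. T c d l j (X a b k f)
      + (scl (jj d b) (g c a j) + scl (jj d a) (g c b j)
      + (scl (jj c b) (g a d (j + k)) + scl (jj c a) (g b d (j + k)))
      + (scl (jj c b) (g d a j) + scl (jj c a) (g d b j)
      + (scl (jj d b) (g a c (j + k)) + scl (jj d a) (g b c (j + k))))))"
    by (intro sum.cong refl)
      (simp add: T_def X_add[OF Fock_z[OF Fock_z[OF assms]] Fock_z[OF Fock_z[OF assms]]] zz add_ac)
  also have "\<dots> = X c d l (X a b k f)
      + (scl (jj d b) (\<Sum>j\<in>S. g c a j) + scl (jj d a) (\<Sum>j\<in>S. g c b j)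
      + (scl (jj c b) (\<Sum>j\<in>S. g a d (j + k)) + scl (jj c a) (\<Sum>j\<in>S. g b d (j + k)))
      + (scl (jj c b) (\<Sum>j\<in>S. g d a j) + scl (jj c a) (\<Sum>j\<in>S. g d b j)
      + (scl (jj d b) (\<Sum>j\<in>S. g a c (j + k)) + scl (jj d a) (\<Sum>j\<in>S. g b c (j + k)))))"
    unfolding K2[OF S(1,3)] sum.distrib FV.scale_sum_right ..
  also have "\<dots> = X c d l (X a b k f)
    + (scl (jj c b) (X a d (k + l) f) + scl (jj c a) (X b d (k + l) f)
     + scl (jj d b) (X a c (k + l) f) + scl (jj d a) (X b c (k + l) f))
    + scl (jj c b * e a d + jj c a * e b d + jj d b * e a c + jj d a * e b c) f"
    unfolding shift e Xg by (simp add: FV.scale_right_distrib FV.scale_left_distrib algebra_simps)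
  finally show ?thesis by blast
qed

end

section \<open>The quadratic relations\<close>

lemma sum_pow5_bounds:
  fixes A :: "nat multiset"
  assumes "A \<noteq> {#}" "size A \<le> 4"
  shows "5 ^ Max (set_mset A) \<le> (\<Sum>x\<in>#A. (5::nat) ^ x)" "(\<Sum>x\<in>#A. (5::nat) ^ x) < 5 ^ Suc (Max (set_mset A))"
proof -
  have "Max (set_mset A) \<in># A" using assms by simp
  then obtain A' where "A = add_mset (Max (set_mset A)) A'" by (metis insert_DiffM)
  then show "5 ^ Max (set_mset A) \<le> (\<Sum>x\<in>#A. (5::nat) ^ x)"
    by (metis image_mset_add_mset le_add1 sum_mset.add_mset)
  have "(\<Sum>x\<in>#A. (5::nat) ^ x) \<le> (\<Sum>x\<in>#A. (5::nat) ^ Max (set_mset A))"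
    by (intro sum_mset_mono power_increasing) auto
  also have "\<dots> = size A * 5 ^ Max (set_mset A)" by simp
  also have "\<dots> \<le> 4 * 5 ^ Max (set_mset A)" using assms by simp
  also have "\<dots> < 5 ^ Suc (Max (set_mset A))" by simp
  finally show "(\<Sum>x\<in>#A. (5::nat) ^ x) < 5 ^ Suc (Max (set_mset A))" .
qed

text \<open>Base 5 digits: in a multiset of at most four elements all multiplicities are below 5.
  The induction removes the largest element, which the size of the sum determines.\<close>

lemma sum_pow5_inj:
  fixes A B :: "nat multiset"
  assumes "size A \<le> 4" "size B \<le> 4" "(\<Sum>x\<in>#A. (5::nat) ^ x) = (\<Sum>x\<in>#B. 5 ^ x)"
  shows "A = B"
  using assms
proof (induction "size A" arbitrary: A B)
  case 0
  then have "A = {#}" by simp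
  show ?case
  proof (rule ccontr)
    assume "A \<noteq> B"
    then have "B \<noteq> {#}" using \<open>A = {#}\<close> by simp
    then show False using sum_pow5_bounds(1)[of B] 0 \<open>A = {#}\<close> by simp
  qed
next
  case (Suc k)
  then have A: "A \<noteq> {#}" by auto
  have B: "B \<noteq> {#}"
  proof
    assume "B = {#}"
    then have "(\<Sum>x\<in>#A. (5::nat) ^ x) = 0" using Suc.prems(3) by simp
    moreover have "0 < (5::nat) ^ Max (set_mset A)" by simp
    ultimately show False using sum_pow5_bounds(1)[OF A Suc.prems(1)] by linarith
  qed
  define a where "a = Max (set_mset A)"
  define b where "b = Max (set_mset B)"
  note bd = sum_pow5_bounds[OF A Suc.prems(1), folded a_def] sum_pow5_bounds[OF B Suc.prems(2), folded b_def]
  have p: "(5::nat) ^ a < 5 ^ Suc b" "(5::nat) ^ b < 5 ^ Suc a" using bd Suc.prems(3) by linarith+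
  have "(1::nat) < 5" by simp
  from power_less_imp_less_exp[OF this p(1)] power_less_imp_less_exp[OF this p(2)]
  have ab: "a = b" by linarith
  have "a \<in># A" using A by (simp add: a_def)
  moreover have "a \<in># B" using B unfolding ab by (simp add: b_def)
  ultimately obtain A' B' where AB: "A = add_mset a A'" "B = add_mset a B'" by (metis insert_DiffM)
  have "k = size A'" "size A' \<le> 4" "size B' \<le> 4" "(\<Sum>x\<in>#A'. (5::nat) ^ x) = (\<Sum>x\<in>#B'. 5 ^ x)"
    using Suc.hyps(2) Suc.prems unfolding AB by simp_all
  then have "A' = B'" by (rule Suc.hyps(1))
  then show ?case using AB by simp
qed

text \<open>Each component of the sum is a complex polynomial in \<open>\<tau>\<close> that vanishes
  everywhere, hence the zero polynomial; its coefficient at \<open>E\<close> collects exactly these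
  terms.\<close>

lemma coefficient_extraction:
  assumes "finite S" "\<And>\<tau>. (\<Sum>t\<in>S. scl (\<tau> ^ e t) (y t)) = 0"
  shows "(\<Sum>t\<in>{t \<in> S. e t = E}. y t) = 0"
proof -
  have "(\<Sum>t\<in>{t \<in> S. e t = E}. coef (y t) A) = 0" for A
  proof -
    define p where "p = (\<Sum>t\<in>S. monom (coef (y t) A) (e t))"
    have "poly p \<tau> = coef (\<Sum>t\<in>S. scl (\<tau> ^ e t) (y t)) A" for \<tau>
      by (simp add: p_def poly_sum poly_monom coef_sum mult.commute)
    then have "p = 0" using assms(2) poly_all_0_iff_0[of p] by simp
    then have "0 = coeff p E" by simp
    also have "\<dots> = (\<Sum>t\<in>S. if e t = E then coef (y t) A else 0)"
      by (simp add: p_def coeff_sum coeff_monom)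
    finally show ?thesis using assms(1) by (simp add: sum.inter_filter)
  qed
  then show ?thesis by (simp add: fvec_eq_iff coef_sum)
qed

fun val :: "nat \<Rightarrow> letter \<Rightarrow> nat" where
  "val n (Plain j) = j"
| "val n (Barred j) = 2 * n + 1 - j"

lemma val_less_iff: "a \<in> letters n \<Longrightarrow> b \<in> letters n \<Longrightarrow> val n a < val n b \<longleftrightarrow> a < b"
  by (cases a; cases b) (auto simp: letters_def less_letter_def)

lemma val_le_iff: "a \<in> letters n \<Longrightarrow> b \<in> letters n \<Longrightarrow> val n a \<le> val n b \<longleftrightarrow> a \<le> b"
  using val_less_iff[of b n a] by auto

lemma val_eq_iff: "a \<in> letters n \<Longrightarrow> b \<in> letters n \<Longrightarrow> val n a = val n b \<longleftrightarrow> a = b"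
  by (metis val_le_iff order_antisym order_refl)

context fock
begin

section \<open>The fields attached to a vector \<open>u\<close> and their vanishing square\<close>

definition zu :: "(letter \<Rightarrow> complex) \<Rightarrow> int \<Rightarrow> fvec \<Rightarrow> fvec" where
  "zu u s f = (\<Sum>a\<in>letters n. scl (u a) (z (s, a) f))"

definition Xu :: "(letter \<Rightarrow> complex) \<Rightarrow> int \<Rightarrow> fvec \<Rightarrow> fvec" where
  "Xu u m f = (\<Sum>a\<in>letters n. \<Sum>b\<in>letters n. scl (u a * u b) (X a b m f))"

lemma zu_scl: "zu u s (scl c f) = scl c (zu u s f)"
  by (simp add: zu_def z_scl FV.scale_sum_right mult.commute)

lemma zu_uminus: "zu u s (- f) = - zu u s f"
  using zu_scl[of u s "-1" f] by simp

lemma zu_0 [simp]: "zu u s 0 = 0"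
  using zu_scl[of u s 0 0] by simp

lemma zu_sum: "zu u s (\<Sum>x\<in>S. g x) = (\<Sum>x\<in>S. zu u s (g x))"
  unfolding zu_def z_sum FV.scale_sum_right by (rule sum.swap)

lemma Xu_Fock: "f \<in> Fock \<Longrightarrow> Xu u s f \<in> Fock"
  by (simp add: Xu_def Fock_sum Fock.scl X_Fock)

lemma zu_zu: "zu u s (zu u t f) = (\<Sum>a\<in>letters n. \<Sum>b\<in>letters n. scl (u a * u b) (z (s, a) (z (t, b) f)))"
  by (simp add: zu_def z_sum z_scl FV.scale_sum_right)

text \<open>Every vector is isotropic for a symplectic form: exchanging \<open>a\<close> and
  \<open>bar a\<close> reverses the sign of the sum.\<close>

lemma sum_J_zero: "(\<Sum>a\<in>letters n. u a * u (bar a) * J a) = 0"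
proof -
  have "(\<Sum>a\<in>letters n. u a * u (bar a) * J a) = (\<Sum>a\<in>letters n. u (bar a) * u a * J (bar a))"
    by (rule sum.reindex_bij_witness[of _ bar bar]) auto
  also have "\<dots> = - (\<Sum>a\<in>letters n. u a * u (bar a) * J a)"
    by (simp add: sum_negf mult.commute)
  finally show ?thesis by simp
qed

text \<open>The contraction of two fields of the same \<open>u\<close> is, up to sign, the
  symplectic form of \<open>u\<close> with itself, which is zero by
  \<open>sum_J_zero\<close>.\<close>

lemma zu_anticomm: "zu u s (zu u t f) = - zu u t (zu u s f)"
proof -
  have "zu u t (zu u s f) = (\<Sum>a\<in>letters n. \<Sum>b\<in>letters n. scl (u a * u b) (z (t, b) (z (s, a) f)))"
    unfolding zu_zu by (subst sum.swap) (simp add: mult.commute)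
  then have "zu u s (zu u t f) + zu u t (zu u s f)
      = (\<Sum>a\<in>letters n. \<Sum>b\<in>letters n. scl (u a * u b * pr (s, a) (t, b)) f)"
    unfolding zu_zu by (simp add: z_swap_pr[of "(s, _)"] FV.scale_right_diff_distrib flip: sum.distrib)
  also have "\<dots> = scl (\<Sum>a\<in>letters n. \<Sum>b\<in>letters n. u a * u b * pr (s, a) (t, b)) f"
    by (simp add: FV.scale_sum_left)
  also have "(\<Sum>a\<in>letters n. \<Sum>b\<in>letters n. u a * u b * pr (s, a) (t, b)) = 0"
  proof -
    have "(\<Sum>b\<in>letters n. u a * u b * pr (s, a) (t, b))
        = (if t = - 1 - s then if even s then 1 else - 1 else 0) * (u a * u (bar a) * J a)"
      if "a \<in> letters n" for a
    proof -
      have "(\<Sum>b\<in>letters n. u a * u b * pr (s, a) (t, b))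
          = (\<Sum>b\<in>letters n. if b = bar a then (if t = - 1 - s then u a * u b * sgnG (s, a) else 0) else 0)"
        by (intro sum.cong) (auto simp: pr_def dual_def)
      then show ?thesis using that by (simp add: sgnG_def)
    qed
    then show ?thesis using sum_J_zero[of u] by (simp flip: sum_distrib_left)
  qed
  finally show ?thesis by (simp add: eq_neg_iff_add_eq_0)
qed

text \<open>The bound is fitted to the parities: the even slots that may act nontrivially start at
  \<open>- 2 * K\<close> and the odd ones at \<open>- 2 * K - 1\<close>. This gives the window
  \<open>{- K..m + K}\<close> for the mode \<open>m\<close>.\<close>

definition bd :: "(letter \<Rightarrow> complex) \<Rightarrow> int \<Rightarrow> fvec \<Rightarrow> bool" where
  "bd u K f \<longleftrightarrow> (\<forall>s < - 2 * K - 1. zu u s f = 0)"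

lemma bd_zu: "bd u K f \<Longrightarrow> bd u K (zu u s f)"
  unfolding bd_def by (metis zu_anticomm zu_0 neg_0_equal_iff_equal)

lemma Xu_window:
  assumes f: "f \<in> Fock" and K: "bd u K f"
  shows "Xu u m f = (\<Sum>k\<in>{- K..m + K}. scl 2 (zu u (2 * k) (zu u (2 * m - 1 - 2 * k) f)))"
proof -
  obtain L where "win m f L" using win_exists[OF f] by blast
  note L = winD[OF this]
  define S where "S = {- L..L} \<union> {- K..m + K}"
  have S: "finite S" "{- L..L} \<subseteq> S" "{- K..m + K} \<subseteq> S" by (auto simp: S_def)
  have "Xu u m f = (\<Sum>a\<in>letters n. \<Sum>b\<in>letters n. \<Sum>k\<in>S. scl (u a * u b) (T a b m k f))"
    by (simp add: Xu_def L[OF S(1,2)] FV.scale_sum_right)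
  also have "\<dots> = (\<Sum>k\<in>S. \<Sum>a\<in>letters n. \<Sum>b\<in>letters n. scl (u a * u b) (T a b m k f))"
    by (subst sum.swap[of _ S], subst sum.swap[of _ S]) (rule refl)
  also have "\<dots> = (\<Sum>k\<in>S. scl 2 (zu u (2 * k) (zu u (2 * m - 1 - 2 * k) f)))"
  proof (rule sum.cong[OF refl])
    fix k
    have "(\<Sum>a\<in>letters n. \<Sum>b\<in>letters n. scl (u a * u b) (T a b m k f))
        = zu u (2 * k) (zu u (2 * m - 1 - 2 * k) f)
         + (\<Sum>a\<in>letters n. \<Sum>b\<in>letters n. scl (u a * u b) (z (2 * k, b) (z (2 * m - 1 - 2 * k, a) f)))"
      by (simp add: T_def zu_zu FV.scale_right_distrib sum.distrib)
    also have "(\<Sum>a\<in>letters n. \<Sum>b\<in>letters n. scl (u a * u b) (z (2 * k, b) (z (2 * m - 1 - 2 * k, a) f)))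
        = zu u (2 * k) (zu u (2 * m - 1 - 2 * k) f)"
      unfolding zu_zu by (subst sum.swap) (simp add: mult.commute)
    finally show "(\<Sum>a\<in>letters n. \<Sum>b\<in>letters n. scl (u a * u b) (T a b m k f))
        = scl 2 (zu u (2 * k) (zu u (2 * m - 1 - 2 * k) f))"
      by (simp add: fvec_eq_iff)
  qed
  also have "\<dots> = (\<Sum>k\<in>{- K..m + K}. scl 2 (zu u (2 * k) (zu u (2 * m - 1 - 2 * k) f)))"
  proof (rule sum.mono_neutral_right[OF S(1,3)], rule ballI)
    fix k assume "k \<in> S - {- K..m + K}"
    then consider "k < - K" | "k > m + K" by force
    then show "scl 2 (zu u (2 * k) (zu u (2 * m - 1 - 2 * k) f)) = 0"
    proof cases
      case 1
      then have "zu u (2 * k) f = 0" using K by (auto simp: bd_def)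
      then show ?thesis by (simp add: zu_anticomm[of u "2 * k"])
    next
      case 2
      then have "zu u (2 * m - 1 - 2 * k) f = 0" using K by (auto simp: bd_def)
      then show ?thesis by simp
    qed
  qed
  finally show ?thesis .
qed

text \<open>All \<open>zu u s\<close> anticommute, so the coefficients of \<open>Xu u (z)\<^sup>2\<close> vanish: exchanging the two
  fermions in even slots changes the sign of each term.\<close>

lemma Xu_square:
  assumes f: "f \<in> Fock" and K: "bd u K f"
  shows "(\<Sum>m\<in>{- 2 * K..N + 2 * K}. Xu u m (Xu u (N - m) f)) = 0"
proof -
  define t where "t = (\<lambda>(m, k, l). zu u (2 * k) (zu u (2 * m - 1 - 2 * k)
      (zu u (2 * l) (zu u (2 * (N - m) - 1 - 2 * l) f))))"
  \<comment> \<open>For \<open>m\<close> outside \<open>{- 2 * K..N + 2 * K}\<close> one of the two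
    windows would be empty.\<close>
  define D where "D = (SIGMA m:{- 2 * K..N + 2 * K}. {- K..m + K} \<times> {- K..N - m + K})"
  have fin: "finite D" by (auto simp: D_def)
  have step: "Xu u m (Xu u (N - m) f) = (\<Sum>(k, l)\<in>{- K..m + K} \<times> {- K..N - m + K}. scl 4 (t (m, k, l)))" for m
  proof -
    have b: "bd u K (Xu u (N - m) f)"
      unfolding Xu_window[OF f K] bd_def zu_sum zu_scl
      using bd_zu[OF bd_zu[OF K]] by (auto simp: bd_def intro!: sum.neutral)
    have "Xu u m (Xu u (N - m) f) = (\<Sum>k\<in>{- K..m + K}. scl 2 (zu u (2 * k) (zu u (2 * m - 1 - 2 * k)
        (\<Sum>l\<in>{- K..N - m + K}. scl 2 (zu u (2 * l) (zu u (2 * (N - m) - 1 - 2 * l) f))))))"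
      unfolding Xu_window[OF Xu_Fock[OF f] b] by (simp only: Xu_window[OF f K])
    also have "\<dots> = (\<Sum>k\<in>{- K..m + K}. \<Sum>l\<in>{- K..N - m + K}. scl 4 (t (m, k, l)))"
      by (simp add: zu_sum zu_scl FV.scale_sum_right t_def)
    finally show ?thesis by (simp add: sum.cartesian_product)
  qed
  have "(\<Sum>m\<in>{- 2 * K..N + 2 * K}. Xu u m (Xu u (N - m) f)) = (\<Sum>d\<in>D. scl 4 (t d))"
    unfolding step D_def by (subst sum.Sigma) (auto intro!: sum.cong)
  moreover have "(\<Sum>d\<in>D. t d) = - (\<Sum>d\<in>D. t d)"
  proof -
    \<comment> \<open>To keep both odd slots in place while \<open>k\<close> and \<open>l\<close>
      change roles, \<open>m\<close> has to become \<open>m - k + l\<close>. This map is an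
      involution of \<open>D\<close>.\<close>
    have "(\<Sum>d\<in>D. t d) = (\<Sum>d\<in>D. - t d)"
    proof (rule sum.reindex_bij_witness[of _ "\<lambda>(m, k, l). (m - k + l, l, k)" "\<lambda>(m, k, l). (m - k + l, l, k)"], goal_cases)
      case (5 d)
      obtain m k l where d: "d = (m, k, l)" by (cases d)
      have e: "2 * (m - k + l) - 1 - 2 * l = 2 * m - 1 - 2 * k"
        "2 * (N - (m - k + l)) - 1 - 2 * k = 2 * (N - m) - 1 - 2 * l" by simp_all
      have "zu u (2 * l) (zu u (2 * m - 1 - 2 * k) (zu u (2 * k) g))
          = - zu u (2 * k) (zu u (2 * m - 1 - 2 * k) (zu u (2 * l) g))" for g
        by (simp add: zu_anticomm[of u "2 * m - 1 - 2 * k" "2 * k"] zu_uminus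
            zu_anticomm[of u "2 * l" "2 * k"] zu_anticomm[of u "2 * l" "2 * m - 1 - 2 * k"])
      then show ?case unfolding d t_def by (simp only: split e prod.case minus_minus)
    qed (auto simp: D_def)
    then show ?thesis by (simp add: sum_negf)
  qed
  then have "(\<Sum>d\<in>D. t d) = 0"
    by (auto simp: fvec_eq_iff)
  ultimately show ?thesis by (simp flip: FV.scale_sum_right)
qed

definition tuples :: "letter multiset \<Rightarrow> (letter \<times> letter \<times> letter \<times> letter) set" where
  "tuples M = {(a, b, c, d). {#a, b, c, d#} = M}"

text \<open>With \<open>u a = \<tau> ^ (5 ^ val n a)\<close> the vanishing square becomes a
  polynomial identity in \<open>\<tau>\<close>, and the exponent of a term determines the multiset
  of its four letters. The range \<open>R\<close> has to contain a prescribed \<open>M\<close>, at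
  which a leading term will be singled out.\<close>

lemma relation:
  assumes f: "f \<in> Fock" and l: "a \<in> letters n" "b \<in> letters n" "c \<in> letters n" "d \<in> letters n"
  shows "\<exists>R. finite R \<and> M \<in> R \<and>
    (\<Sum>(a', b', c', d')\<in>tuples {#a, b, c, d#}. \<Sum>m\<in>R. X a' b' m (X c' d' (N - m) f)) = 0"
proof -
  obtain K0 where K0: "\<forall>s a. s < - K0 \<longrightarrow> z (s, a) f = 0"
    using Fock_bounded[OF f] by blast
  \<comment> \<open>\<open>K0\<close> bounds the slots that act on \<open>f\<close>;
    \<open>- M\<close> and \<open>M - N\<close> widen the range of modes until it contains
    \<open>M\<close>.\<close>
  define K where "K = Max {0, K0, - M, M - N}"
  have "0 \<le> K" "K0 \<le> K" "- M \<le> K" "M - N \<le> K"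
    unfolding K_def by (rule Max_ge; simp)+
  then have Kb: "K0 \<le> K" "- K \<le> M" "M \<le> N + 2 * K" "0 \<le> K"
    by linarith+
  have K: "bd u K f" for u
    unfolding bd_def zu_def
  proof (intro allI impI sum.neutral ballI)
    fix s a assume "s < - 2 * K - 1"
    then have "s < - K0" using Kb by linarith
    then show "scl (u a) (z (s, a) f) = 0" using K0 by simp
  qed
  define R where "R = {- 2 * K..N + 2 * K}"
  have R: "finite R" "M \<in> R" using Kb by (auto simp: R_def)
  define Y where "Y = (\<lambda>(a, b, c, d). \<Sum>m\<in>R. X a b m (X c d (N - m) f))"
  define S where "S = letters n \<times> letters n \<times> letters n \<times> letters n"
  define e where "e = (\<lambda>(a, b, c, d). \<Sum>x\<in>#{#a, b, c, d#}. (5::nat) ^ val n x)"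
  have "(\<Sum>t\<in>S. scl (\<tau> ^ e t) (Y t)) = 0" for \<tau>
  proof -
    define u where "u a = \<tau> ^ (5 ^ val n a)" for a
    have "(\<Sum>m\<in>R. Xu u m (Xu u (N - m) f))
        = (\<Sum>m\<in>R. \<Sum>a\<in>letters n. \<Sum>b\<in>letters n. \<Sum>c\<in>letters n. \<Sum>d\<in>letters n.
            scl (u a * u b * u c * u d) (X a b m (X c d (N - m) f)))"
    proof (intro sum.cong refl)
      fix m
      have "X a b m (Xu u (N - m) f) = (\<Sum>c\<in>letters n. \<Sum>d\<in>letters n. scl (u c * u d) (X a b m (X c d (N - m) f)))" for a b
        by (simp add: Xu_def X_sum X_scl Fock_sum Fock.scl X_Fock f)
      then show "Xu u m (Xu u (N - m) f) = (\<Sum>a\<in>letters n. \<Sum>b\<in>letters n. \<Sum>c\<in>letters n. \<Sum>d\<in>letters n.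
            scl (u a * u b * u c * u d) (X a b m (X c d (N - m) f)))"
        by (subst Xu_def) (simp add: FV.scale_sum_right mult.assoc)
    qed
    also have "\<dots> = (\<Sum>a\<in>letters n. \<Sum>b\<in>letters n. \<Sum>c\<in>letters n. \<Sum>d\<in>letters n. \<Sum>m\<in>R.
            scl (u a * u b * u c * u d) (X a b m (X c d (N - m) f)))"
      by (simp only: sum.swap[of _ _ R])
    also have "\<dots> = (\<Sum>a\<in>letters n. \<Sum>b\<in>letters n. \<Sum>c\<in>letters n. \<Sum>d\<in>letters n.
            scl (\<tau> ^ e (a, b, c, d)) (Y (a, b, c, d)))"
    proof (intro sum.cong refl)
      fix a b c d
      have "\<tau> ^ e (a, b, c, d) = u a * u b * u c * u d"
        by (simp add: e_def u_def power_add mult.assoc)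
      then show "(\<Sum>m\<in>R. scl (u a * u b * u c * u d) (X a b m (X c d (N - m) f)))
          = scl (\<tau> ^ e (a, b, c, d)) (Y (a, b, c, d))"
        by (simp only: Y_def FV.scale_sum_right prod.case)
    qed
    also have "\<dots> = (\<Sum>t\<in>S. scl (\<tau> ^ e t) (Y t))"
      by (simp only: S_def sum.cartesian_product')
    finally show ?thesis using Xu_square[OF f K[of u], of N] by (simp add: R_def)
  qed
  then have z: "(\<Sum>t\<in>{t \<in> S. e t = e (a, b, c, d)}. Y t) = 0"
    by (intro coefficient_extraction) (auto simp: S_def)
  have "{t \<in> S. e t = e (a, b, c, d)} = tuples {#a, b, c, d#}"
  proof (intro equalityI subsetI)
    fix t assume "t \<in> {t \<in> S. e t = e (a, b, c, d)}"
    then obtain a' b' c' d' where t: "t = (a', b', c', d')" "a' \<in> letters n" "b' \<in> letters n" "c' \<in> letters n" "d' \<in> letters n"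
      "e (a', b', c', d') = e (a, b, c, d)" by (auto simp: S_def)
    have "image_mset (val n) {#a', b', c', d'#} = image_mset (val n) {#a, b, c, d#}"
      by (rule sum_pow5_inj) (use t(6) in \<open>auto simp: e_def\<close>)
    then have "{#a', b', c', d'#} = {#a, b, c, d#}"
      by (rule multiset.inj_map_strong[rotated]) (use t l in \<open>auto simp: val_eq_iff\<close>)
    then show "t \<in> tuples {#a, b, c, d#}" by (simp add: tuples_def t)
  next
    fix t assume "t \<in> tuples {#a, b, c, d#}"
    then obtain a' b' c' d' where t: "t = (a', b', c', d')" "{#a', b', c', d'#} = {#a, b, c, d#}"
      by (auto simp: tuples_def)
    have "set_mset {#a', b', c', d'#} \<subseteq> letters n" unfolding t(2) using l by auto
    then have "t \<in> S" by (simp add: S_def t(1))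
    moreover have "e t = e (a, b, c, d)" unfolding e_def t(1) prod.case t(2) ..
    ultimately show "t \<in> {t \<in> S. e t = e (a, b, c, d)}" by blast
  qed
  then show ?thesis using z R by (auto simp: Y_def)
qed

end

section \<open>Spanning\<close>

type_synonym part = "int \<times> letter \<times> letter"

text \<open>The order used for leading terms: first balance of the sizes, then low letters on the large
  sizes, then nestedness of the pairs of letters. Leading terms are minimal.\<close>

definition Phi :: "nat \<Rightarrow> part list \<Rightarrow> int \<times> int \<times> int" where
  "Phi n ps = (\<Sum>(m, x, y)\<leftarrow>ps. m * m, \<Sum>(m, x, y)\<leftarrow>ps. m * (int (val n x) + int (val n y)),
     \<Sum>(m, x, y)\<leftarrow>ps. - ((int (val n y) - int (val n x)) * (int (val n y) - int (val n x))))"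

lemma Phi_mset: "mset ps = mset qs \<Longrightarrow> Phi n ps = Phi n qs"
proof -
  assume "mset ps = mset qs"
  then have "sum_list (map g ps) = sum_list (map g qs)" for g :: "part \<Rightarrow> int"
    unfolding sum_mset_sum_list[symmetric] mset_map by simp
  then show ?thesis by (simp only: Phi_def)
qed

lemma Phi_less_append: "Phi n ps < Phi n qs \<Longrightarrow> Phi n (ps @ ws) < Phi n (qs @ ws)"
  by (auto simp: Phi_def)

section \<open>Pairings of four letters and the minimal one for \<open>Phi\<close>\<close>

lemma mset_3_cases:
  assumes "{#b', c', d'#} = {#x, y, w#}"
  shows "b' = x \<and> {#c', d'#} = {#y, w#} \<or> b' = y \<and> {#c', d'#} = {#x, w#} \<or> b' = w \<and> {#c', d'#} = {#x, y#}"
proof -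
  have "b' \<in># {#x, y, w#}" unfolding assms[symmetric] by simp
  then consider "b' = x" | "b' = y" | "b' = w" by auto
  then show ?thesis
  proof cases
    case 1
    then show ?thesis using assms by simp
  next
    case 2
    then have "add_mset y {#c', d'#} = add_mset y {#x, w#}" using assms by (simp only: add_mset_commute[of y x])
    then show ?thesis using 2 by simp
  next
    case 3
    then have "add_mset w {#c', d'#} = add_mset w {#x, y#}"
      using assms by (simp only: add_mset_commute[of w x] add_mset_commute[of w y])
    then show ?thesis using 3 by simp
  qed
qed

lemma mset_4_cases:
  assumes "{#a', b', c', d'#} = {#a, b, c, d#}"
  shows "a' = a \<and> {#b', c', d'#} = {#b, c, d#} \<or> a' = b \<and> {#b', c', d'#} = {#a, c, d#} \<or>
    a' = c \<and> {#b', c', d'#} = {#a, b, d#} \<or> a' = d \<and> {#b', c', d'#} = {#a, b, c#}"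
proof -
  have "a' \<in># {#a, b, c, d#}" unfolding assms[symmetric] by simp
  then consider "a' = a" | "a' = b" | "a' = c" | "a' = d" by auto
  then show ?thesis
  proof cases
    case 1
    then show ?thesis using assms by simp
  next
    case 2
    then have "add_mset b {#b', c', d'#} = add_mset b {#a, c, d#}"
      using assms by (simp only: add_mset_commute[of b a])
    then show ?thesis using 2 by simp
  next
    case 3
    then have "add_mset c {#b', c', d'#} = add_mset c {#a, b, d#}"
      using assms by (simp only: add_mset_commute[of c a] add_mset_commute[of c b])
    then show ?thesis using 3 by simp
  next
    case 4
    then have "add_mset d {#b', c', d'#} = add_mset d {#a, b, c#}"
      using assms by (simp only: add_mset_commute[of d a] add_mset_commute[of d b] add_mset_commute[of d c])
    then show ?thesis using 4 by simp
  qed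
qed

lemma pairings:
  assumes "{#a', b', c', d'#} = {#a, b, c, d#}"
  shows "({#a', b'#}, {#c', d'#}) \<in> {({#a, b#}, {#c, d#}), ({#c, d#}, {#a, b#}), ({#a, c#}, {#b, d#}),
    ({#b, d#}, {#a, c#}), ({#a, d#}, {#b, c#}), ({#b, c#}, {#a, d#})}"
proof -
  have c: "{#x, y#} = {#y, x#}" for x y :: 'a by (rule add_mset_commute)
  show ?thesis
    using mset_4_cases[OF assms]
  proof (elim disjE conjE)
    assume 1: "a' = a" "{#b', c', d'#} = {#b, c, d#}"
    from mset_3_cases[OF 1(2)] show ?thesis by (elim disjE conjE) (simp_all add: 1(1))
  next
    assume 1: "a' = b" "{#b', c', d'#} = {#a, c, d#}"
    from mset_3_cases[OF 1(2)] show ?thesis by (elim disjE conjE) (simp_all add: 1(1) c[of b a])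
  next
    assume 1: "a' = c" "{#b', c', d'#} = {#a, b, d#}"
    from mset_3_cases[OF 1(2)] show ?thesis by (elim disjE conjE) (simp_all add: 1(1) c[of c a] c[of c b])
  next
    assume 1: "a' = d" "{#b', c', d'#} = {#a, b, c#}"
    from mset_3_cases[OF 1(2)] show ?thesis
      by (elim disjE conjE) (simp_all add: 1(1) c[of d a] c[of d b] c[of d c])
  qed
qed

definition norm_part :: "part \<Rightarrow> part" where
  "norm_part p = (case p of (m, x, y) \<Rightarrow> (m, min x y, max x y))"

lemma norm_part_pair: "{#a', b'#} = {#x, y#} \<Longrightarrow> x \<le> y \<Longrightarrow> norm_part (k, a', b') = (k, x, y)"
  by (auto simp: norm_part_def add_eq_conv_ex add_mset_eq_single min_def max_def)

lemma even_balance: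
  fixes k l m :: int
  assumes "k + l = 2 * m" "k \<noteq> m"
  shows "m * m + m * m < k * k + l * l"
proof -
  have l: "l = 2 * m - k" using assms by simp
  have "0 < (k - m) * (k - m)" using assms by (auto simp: zero_less_mult_iff)
  then show ?thesis by (simp add: l algebra_simps)
qed

lemma odd_balance:
  fixes k l m :: int
  assumes "k + l = 2 * m + 1" "k \<noteq> m" "k \<noteq> m + 1"
  shows "(m + 1) * (m + 1) + m * m < k * k + l * l"
proof -
  have l: "l = 2 * m + 1 - k" using assms by simp
  have "0 < (k - m) * (k - m - 1)" using assms by (auto simp: zero_less_mult_iff)
  then show ?thesis by (simp add: l algebra_simps)
qed

text \<open>The right sides exceed the left sides by \<open>2 * (B - A) * (D - C)\<close> and
  \<open>2 * (C - A) * (D - B)\<close>. So among the three pairings of four points the nested one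
  has the greatest sum of squared lengths.\<close>

lemma nested_max:
  fixes A B C D :: int
  assumes "A \<le> B" "B \<le> C" "C \<le> D"
  shows "A < B \<Longrightarrow> C < D \<Longrightarrow> (C - A) * (C - A) + (D - B) * (D - B) < (D - A) * (D - A) + (C - B) * (C - B)"
    "A < C \<Longrightarrow> B < D \<Longrightarrow> (B - A) * (B - A) + (D - C) * (D - C) < (D - A) * (D - A) + (C - B) * (C - B)"
proof -
  assume "A < B" "C < D"
  then have "0 < (B - A) * (D - C)" by simp
  then show "(C - A) * (C - A) + (D - B) * (D - B) < (D - A) * (D - A) + (C - B) * (C - B)"
    by (simp add: algebra_simps)
next
  assume "A < C" "B < D"
  then have "0 < (C - A) * (D - B)" by simp
  then show "(B - A) * (B - A) + (D - C) * (D - C) < (D - A) * (D - A) + (C - B) * (C - B)"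
    by (simp add: algebra_simps)
qed

text \<open>For equal sizes the first two entries of \<open>Phi\<close> agree for all pairings, and
  the third favours the nested one. A tie forces letters to coincide, and then the two words are the
  same multiset.\<close>

lemma leading_even_aux:
  assumes l: "a \<in> letters n" "b \<in> letters n" "c \<in> letters n" "d \<in> letters n"
    and o: "a \<le> b" "b \<le> c" "c \<le> d"
    and xy: "(x, y, x', y') \<in> {(a, b, c, d), (c, d, a, b), (a, c, b, d), (b, d, a, c), (a, d, b, c), (b, c, a, d)}"
  shows "mset [(m, x, y), (m, x', y')] = mset [(m, a, d), (m, b, c)] \<or>
    Phi n [(m, a, d), (m, b, c)] < Phi n [(m, x, y), (m, x', y')]"
proof -
  define A B C D where v: "A = int (val n a)" "B = int (val n b)" "C = int (val n c)" "D = int (val n d)"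
  have O: "A \<le> B" "B \<le> C" "C \<le> D" using l o by (simp_all add: v val_le_iff)
  have eqs: "A = B \<longleftrightarrow> a = b" "B = C \<longleftrightarrow> b = c" "C = D \<longleftrightarrow> c = d" "A = C \<longleftrightarrow> a = c" "B = D \<longleftrightarrow> b = d"
    using l by (simp_all add: v val_eq_iff)
  have swap: "Phi n [p, q] = Phi n [q, p]" "mset [p, q] = mset [q, p]" for p q
    by (rule Phi_mset) simp_all
  have ab_cd: "mset [(m, a, b), (m, c, d)] = mset [(m, a, d), (m, b, c)] \<or>
    Phi n [(m, a, d), (m, b, c)] < Phi n [(m, a, b), (m, c, d)]"
  proof (cases "A < C \<and> B < D")
    case True
    then show ?thesis using nested_max(2)[OF O] by (auto simp: Phi_def v algebra_simps)
  next
    case False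
    then have "A = C \<or> B = D" using O by linarith
    then show ?thesis using eqs O o by auto
  qed
  have ac_bd: "mset [(m, a, c), (m, b, d)] = mset [(m, a, d), (m, b, c)] \<or>
    Phi n [(m, a, d), (m, b, c)] < Phi n [(m, a, c), (m, b, d)]"
  proof (cases "A < B \<and> C < D")
    case True
    then show ?thesis using nested_max(1)[OF O] by (auto simp: Phi_def v algebra_simps)
  next
    case False
    then have "A = B \<or> C = D" using O by linarith
    then show ?thesis using eqs by auto
  qed
  from xy show ?thesis
  proof (elim insertE emptyE, goal_cases)
    case 2
    then show ?case using ab_cd swap[of "(m, c, d)" "(m, a, b)"] by (simp only: prod.inject)
  next
    case 4
    then show ?case using ac_bd swap[of "(m, b, d)" "(m, a, c)"]
      by (simp only: prod.inject)
  next
    case 5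
    then show ?case by simp
  next
    case 6
    then show ?case by simp
  qed (use ab_cd ac_bd in \<open>simp_all only: prod.inject\<close>)
qed

lemma obtain_pairing:
  assumes o: "a \<le> b" "b \<le> c" "c \<le> d" and ms: "{#a', b', c', d'#} = {#a, b, c, d#}"
  obtains x y x' y' where
    "(x, y, x', y') \<in> {(a, b, c, d), (c, d, a, b), (a, c, b, d), (b, d, a, c), (a, d, b, c), (b, c, a, d)}"
    "\<And>k. norm_part (k, a', b') = (k, x, y)" "\<And>k. norm_part (k, c', d') = (k, x', y')"
proof -
  let ?Q = "{(a, b, c, d), (c, d, a, b), (a, c, b, d), (b, d, a, c), (a, d, b, c), (b, c, a, d)}"
  obtain x y x' y' where xy: "(x, y, x', y') \<in> ?Q" "{#a', b'#} = {#x, y#}" "{#c', d'#} = {#x', y'#}"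
    using pairings[OF ms] by (elim insertE emptyE Pair_inject) blast+
  have "x \<le> y" "x' \<le> y'" using xy(1) o by auto
  then show thesis using that[OF xy(1)] norm_part_pair xy(2,3) by auto
qed

lemma leading_even:
  assumes l: "a \<in> letters n" "b \<in> letters n" "c \<in> letters n" "d \<in> letters n"
    and o: "a \<le> b" "b \<le> c" "c \<le> d" and ms: "{#a', b', c', d'#} = {#a, b, c, d#}" and kl: "k + l = 2 * m"
  shows "mset [norm_part (k, a', b'), norm_part (l, c', d')] = mset [(m, a, d), (m, b, c)] \<or>
    Phi n [(m, a, d), (m, b, c)] < Phi n [norm_part (k, a', b'), norm_part (l, c', d')]"
proof (cases "k = m")
  case False
  then have "fst (Phi n [(m, a, d), (m, b, c)]) < fst (Phi n [norm_part (k, a', b'), norm_part (l, c', d')])"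
    using even_balance[OF kl] by (simp add: Phi_def norm_part_def)
  then show ?thesis by (auto simp: less_prod_def)
next
  case True
  then have lm: "l = m" using kl by simp
  obtain x y x' y' where
    xy: "(x, y, x', y') \<in> {(a, b, c, d), (c, d, a, b), (a, c, b, d), (b, d, a, c), (a, d, b, c), (b, c, a, d)}"
      "\<And>k. norm_part (k, a', b') = (k, x, y)" "\<And>k. norm_part (k, c', d') = (k, x', y')"
    using obtain_pairing[OF o ms] by metis
  show ?thesis unfolding True lm xy(2,3) by (rule leading_even_aux[OF l o xy(1)])
qed

text \<open>Up to \<open>m\<close> times the total rank, the second entry of \<open>Phi\<close> is
  the rank sum of the pair on size \<open>m + 1\<close>. The two lowest letters minimise it, and
  equality forces letters to coincide.\<close>

lemma leading_odd_aux:
  assumes l: "a \<in> letters n" "b \<in> letters n" "c \<in> letters n" "d \<in> letters n"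
    and o: "a \<le> b" "b \<le> c" "c \<le> d"
    and xy: "(x, y, x', y') \<in> {(a, b, c, d), (c, d, a, b), (a, c, b, d), (b, d, a, c), (a, d, b, c), (b, c, a, d)}"
  shows "(x, y, x', y') = (a, b, c, d) \<or>
    Phi n [(m + 1, a, b), (m, c, d)] < Phi n [(m + 1, x, y), (m, x', y')]"
proof -
  define A B C D where v: "A = int (val n a)" "B = int (val n b)" "C = int (val n c)" "D = int (val n d)"
  have O: "A \<le> B" "B \<le> C" "C \<le> D" using l o by (simp_all add: v val_le_iff)
  have eqs: "A = B \<longleftrightarrow> a = b" "B = C \<longleftrightarrow> b = c" "C = D \<longleftrightarrow> c = d" "A = C \<longleftrightarrow> a = c" "B = D \<longleftrightarrow> b = d" "A = D \<longleftrightarrow> a = d"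
    using l by (simp_all add: v val_eq_iff)
  have main: "Phi n [(m + 1, a, b), (m, c, d)] < Phi n [(m + 1, x, y), (m, x', y')]"
    if "A + B < int (val n x) + int (val n y)"
      "int (val n x) + int (val n y) + int (val n x') + int (val n y') = A + B + C + D"
  proof -
    have e: "int (val n x') + int (val n y') = A + B + C + D - (int (val n x) + int (val n y))"
      using that by simp
    have "(m + 1) * (A + B) + m * (C + D)
        < (m + 1) * (int (val n x) + int (val n y)) + m * (int (val n x') + int (val n y'))"
      unfolding e using that(1) by (simp add: algebra_simps)
    then show ?thesis by (simp add: Phi_def v less_prod_def)
  qed
  from xy show ?thesis
  proof (elim insertE emptyE, goal_cases)
    case 2
    then show ?thesis
    proof (cases "A + B < C + D")
      case False
      then have "A = B" "B = C" "C = D" using O by linarith+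
      then show ?thesis using 2 eqs by simp
    qed (use 2 main in \<open>simp add: v\<close>)
  next
    case 3
    then show ?thesis
    proof (cases "B < C")
      case False
      then have "B = C" using O by linarith+
      then show ?thesis using 3 eqs by simp
    qed (use 3 main in \<open>simp add: v\<close>)
  next
    case 4
    then show ?thesis
    proof (cases "A < D")
      case False
      then have "A = B" "B = C" "C = D" using O by linarith+
      then show ?thesis using 4 eqs by simp
    qed (use 4 main in \<open>simp add: v\<close>)
  next
    case 5
    then show ?thesis
    proof (cases "B < D")
      case False
      then have "B = C" "C = D" using O by linarith+
      then show ?thesis using 5 eqs by simp
    qed (use 5 main in \<open>simp add: v\<close>)
  next
    case 6
    then show ?thesis
    proof (cases "A < C")
      case False
      then have "A = B" "B = C" using O by linarith+
      then show ?thesis using 6 eqs by simp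
    qed (use 6 main in \<open>simp add: v\<close>)
  qed simp
qed

lemma leading_odd:
  assumes l: "a \<in> letters n" "b \<in> letters n" "c \<in> letters n" "d \<in> letters n"
    and o: "a \<le> b" "b \<le> c" "c \<le> d" and ms: "{#a', b', c', d'#} = {#a, b, c, d#}" and kl: "k + l = 2 * m + 1"
  shows "mset [norm_part (k, a', b'), norm_part (l, c', d')] = mset [(m + 1, a, b), (m, c, d)] \<or>
    Phi n [(m + 1, a, b), (m, c, d)] < Phi n [norm_part (k, a', b'), norm_part (l, c', d')]"
proof -
  let ?Q = "{(a, b, c, d), (c, d, a, b), (a, c, b, d), (b, d, a, c), (a, d, b, c), (b, c, a, d)}"
  obtain x y x' y' where xy: "(x, y, x', y') \<in> ?Q"
      "\<And>k. norm_part (k, a', b') = (k, x, y)" "\<And>k. norm_part (k, c', d') = (k, x', y')"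
    using obtain_pairing[OF o ms] by metis
  note n = xy(2)[of k] xy(3)[of l]
  consider "k = m" | "k = m + 1" | "k \<noteq> m" "k \<noteq> m + 1" by blast
  then show ?thesis
  proof cases
    case 1
    then have l': "l = m + 1" using kl by simp
    have "(x', y', x, y) \<in> ?Q" using xy(1) by auto
    from leading_odd_aux[OF l o this, of m]
    have "(x', y', x, y) = (a, b, c, d) \<or> Phi n [(m + 1, a, b), (m, c, d)] < Phi n [(m + 1, x', y'), (m, x, y)]" .
    moreover have "Phi n [(m + 1, x', y'), (m, x, y)] = Phi n [(m, x, y), (m + 1, x', y')]"
      by (rule Phi_mset) simp
    ultimately show ?thesis unfolding n unfolding 1 l' by (auto simp: add_mset_commute)
  next
    case 2
    then have l': "l = m" using kl by simp
    from leading_odd_aux[OF l o xy(1), of m] show ?thesis unfolding n unfolding 2 l' by auto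
  next
    case 3
    then have "fst (Phi n [(m + 1, a, b), (m, c, d)]) < fst (Phi n [norm_part (k, a', b'), norm_part (l, c', d')])"
      using odd_balance[OF kl] by (simp add: Phi_def norm_part_def)
    then show ?thesis by (auto simp: less_prod_def)
  qed
qed

context fock
begin

section \<open>Words in the current modes, filtered by length\<close>

fun pX :: "part \<Rightarrow> fvec \<Rightarrow> fvec" where
  "pX (m, x, y) f = X x y m f"

definition XW :: "part list \<Rightarrow> fvec \<Rightarrow> fvec" where
  "XW ps f = foldr pX ps f"

lemma XW_simps [simp]: "XW [] f = f" "XW (p # ps) f = pX p (XW ps f)" "XW (ps @ qs) f = XW ps (XW qs f)"
  by (simp_all add: XW_def)

lemma pX_Fock: "f \<in> Fock \<Longrightarrow> pX p f \<in> Fock"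
  by (cases p) (simp add: X_Fock)

lemma XW_Fock: "f \<in> Fock \<Longrightarrow> XW ps f \<in> Fock"
  by (induction ps) (auto simp: pX_Fock)

lemma pX_diff: "f \<in> Fock \<Longrightarrow> g \<in> Fock \<Longrightarrow> pX p (f - g) = pX p f - pX p g"
  by (cases p) (simp add: X_diff)

lemma pX_add: "f \<in> Fock \<Longrightarrow> g \<in> Fock \<Longrightarrow> pX p (f + g) = pX p f + pX p g"
  by (cases p) (simp add: X_add)

lemma pX_scl: "f \<in> Fock \<Longrightarrow> pX p (scl c f) = scl c (pX p f)"
  by (cases p) (simp add: X_scl)

lemma XW_scl: "f \<in> Fock \<Longrightarrow> XW ps (scl c f) = scl c (XW ps f)"
  by (induction ps) (auto simp: pX_scl XW_Fock)

lemma pX_norm: "pX (norm_part p) f = pX p f"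
  by (cases p) (auto simp: norm_part_def min_def max_def X_commute)

definition lpart :: "part \<Rightarrow> bool" where
  "lpart p \<longleftrightarrow> fst (snd p) \<in> letters n \<and> snd (snd p) \<in> letters n"

definition npart :: "part \<Rightarrow> bool" where
  "npart p \<longleftrightarrow> lpart p \<and> fst (snd p) \<le> snd (snd p)"

lemma npart_norm: "lpart p \<Longrightarrow> npart (norm_part p)"
  by (cases p) (auto simp: npart_def lpart_def norm_part_def min_def max_def)

text \<open>The error space for words of length \<open>r\<close>; hence the strict
  inequality.\<close>

definition G :: "nat \<Rightarrow> fvec set" where
  "G r = FV.span {XW ps vac |ps. length ps < r \<and> (\<forall>p\<in>set ps. lpart p)}"

lemma G_subspace: "FV.subspace (G r)"
  by (simp add: G_def)

lemma G_base: "length ps < r \<Longrightarrow> \<forall>p\<in>set ps. lpart p \<Longrightarrow> XW ps vac \<in> G r"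
  unfolding G_def by (rule FV.span_base) blast

lemma pX_G: "f \<in> G r \<Longrightarrow> lpart p \<Longrightarrow> pX p f \<in> G (Suc r)"
proof -
  assume f: "f \<in> G r" and p: "lpart p"
  have "G r \<subseteq> {f \<in> Fock. pX p f \<in> G (Suc r)}"
    unfolding G_def[of r]
  proof (rule FV.span_minimal)
    show "FV.subspace {f \<in> Fock. pX p f \<in> G (Suc r)}"
      unfolding FV.subspace_def
    proof (intro conjI ballI allI)
      have "pX p 0 = 0" by (cases p) simp
      then show "0 \<in> {f \<in> Fock. pX p f \<in> G (Suc r)}" using FV.subspace_0[OF G_subspace] by simp
    next
      fix x y assume "x \<in> {f \<in> Fock. pX p f \<in> G (Suc r)}" "y \<in> {f \<in> Fock. pX p f \<in> G (Suc r)}"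
      then show "x + y \<in> {f \<in> Fock. pX p f \<in> G (Suc r)}"
        by (simp add: pX_add Fock.add FV.subspace_add[OF G_subspace])
    next
      fix c x assume "x \<in> {f \<in> Fock. pX p f \<in> G (Suc r)}"
      then show "scl c x \<in> {f \<in> Fock. pX p f \<in> G (Suc r)}"
        by (simp add: pX_scl Fock.scl FV.subspace_scale[OF G_subspace])
    qed
  next
    show "{XW ps vac |ps. length ps < r \<and> (\<forall>p\<in>set ps. lpart p)} \<subseteq> {f \<in> Fock. pX p f \<in> G (Suc r)}"
    proof
      fix x assume "x \<in> {XW ps vac |ps. length ps < r \<and> (\<forall>p\<in>set ps. lpart p)}"
      then obtain ps where ps: "x = XW ps vac" "length ps < r" "\<forall>p\<in>set ps. lpart p" by blast
      then have "XW (p # ps) vac \<in> G (Suc r)" using p by (intro G_base) auto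
      then show "x \<in> {f \<in> Fock. pX p f \<in> G (Suc r)}" using ps XW_Fock[OF Fock.vac] by simp
    qed
  qed
  then show ?thesis using f by blast
qed

text \<open>By \<open>X_comm\<close> the commutator of two modes is a combination of single modes
  and a scalar, so at least one factor is lost.\<close>

lemma XW_swap:
  assumes "lpart p" "lpart q" "\<forall>p\<in>set ys. lpart p"
  shows "XW (p # q # ys) vac - XW (q # p # ys) vac \<in> G (length ys + 2)"
proof -
  obtain k a b where p: "p = (k, a, b)" by (cases p)
  obtain l c d where q: "q = (l, c, d)" by (cases q)
  define f where "f = XW ys vac"
  have f: "f \<in> Fock" by (simp add: f_def XW_Fock Fock.vac)
  from X_comm[OF f] obtain e where e: "X a b k (X c d l f) = X c d l (X a b k f)
    + (scl (jj c b) (X a d (k + l) f) + scl (jj c a) (X b d (k + l) f)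
     + scl (jj d b) (X a c (k + l) f) + scl (jj d a) (X b c (k + l) f)) + scl e f" by blast
  have X: "X x y (k + l) f \<in> G (length ys + 2)" if "x \<in> letters n" "y \<in> letters n" for x y
    using G_base[of "(k + l, x, y) # ys" "length ys + 2"] assms that by (simp add: f_def lpart_def)
  have "f \<in> G (length ys + 2)" using G_base[of ys "length ys + 2"] assms by (simp add: f_def)
  then have "(scl (jj c b) (X a d (k + l) f) + scl (jj c a) (X b d (k + l) f)
     + scl (jj d b) (X a c (k + l) f) + scl (jj d a) (X b c (k + l) f)) + scl e f \<in> G (length ys + 2)"
    using X assms p q
    by (intro FV.subspace_add[OF G_subspace] FV.subspace_scale[OF G_subspace]) (auto simp: lpart_def)
  then show ?thesis using e by (simp add: p q f_def algebra_simps)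
qed

lemma XW_move:
  assumes "lpart p" "\<forall>p\<in>set ys. lpart p" "\<forall>p\<in>set zs. lpart p"
  shows "XW (p # ys @ zs) vac - XW (ys @ p # zs) vac \<in> G (length ys + length zs + 1)"
  using assms(2)
proof (induction ys)
  case Nil
  then show ?case using FV.subspace_0[OF G_subspace] by simp
next
  case (Cons y ys)
  have "XW (p # y # ys @ zs) vac - XW (y # p # ys @ zs) vac \<in> G (length (ys @ zs) + 2)"
    using Cons assms by (intro XW_swap) auto
  moreover have "pX y (XW (p # ys @ zs) vac - XW (ys @ p # zs) vac) \<in> G (Suc (length ys + length zs + 1))"
    using Cons by (intro pX_G) auto
  then have "XW (y # p # ys @ zs) vac - XW (y # ys @ p # zs) vac \<in> G (length (ys @ zs) + 2)"
    by (simp add: pX_diff XW_Fock pX_Fock Fock.vac)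
  ultimately have "(XW (p # y # ys @ zs) vac - XW (y # p # ys @ zs) vac)
      + (XW (y # p # ys @ zs) vac - XW (y # ys @ p # zs) vac) \<in> G (length (ys @ zs) + 2)"
    by (rule FV.subspace_add[OF G_subspace])
  then show ?case by (simp add: add.commute)
qed

lemma XW_mset:
  assumes "mset ps = mset qs" "\<forall>p\<in>set ps. lpart p"
  shows "XW ps vac - XW qs vac \<in> G (length ps)"
  using assms
proof (induction ps arbitrary: qs)
  case Nil
  then show ?case using FV.subspace_0[OF G_subspace] by simp
next
  case (Cons p ps)
  have "p \<in> set qs" using Cons.prems(1) by (metis list.set_intros(1) set_mset_mset)
  then obtain ys zs where qs: "qs = ys @ p # zs" by (meson split_list)
  have ms: "mset ps = mset (ys @ zs)" using Cons.prems by (simp add: qs)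
  have set: "set ps = set ys \<union> set zs" using ms by (metis set_append set_mset_mset)
  have len: "length ps = length ys + length zs" using ms by (metis length_append size_mset)
  have "pX p (XW ps vac - XW (ys @ zs) vac) \<in> G (Suc (length ps))"
    using Cons ms by (intro pX_G Cons.IH) auto
  then have "XW (p # ps) vac - XW (p # ys @ zs) vac \<in> G (Suc (length ps))"
    by (simp add: pX_diff XW_Fock Fock.vac)
  moreover have "XW (p # ys @ zs) vac - XW (ys @ p # zs) vac \<in> G (length ys + length zs + 1)"
    using Cons.prems set by (intro XW_move) auto
  then have "XW (p # ys @ zs) vac - XW qs vac \<in> G (Suc (length ps))"
    by (simp add: qs len)
  ultimately have "(XW (p # ps) vac - XW (p # ys @ zs) vac) + (XW (p # ys @ zs) vac - XW qs vac) \<in> G (Suc (length ps))"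
    by (rule FV.subspace_add[OF G_subspace])
  then show ?case by simp
qed

text \<open>Both fermions in the leading term of the mode must create. This is the condition that
  the colour \<open>Col_inf\<close> imposes on the last part, see
  \<open>valid_iff_rho\<close>.\<close>

definition valid :: "part \<Rightarrow> bool" where
  "valid p \<longleftrightarrow> cr (fst p, fst (snd p)) \<and> cr (fst p - 1, snd (snd p))"

lemma valid_iff: "valid (m, x, y) \<longleftrightarrow> m \<ge> 2 \<or> m = 1 \<and> y > Plain i \<or> m = 0 \<and> x > Plain i \<and> y \<ge> Barred i"
  by (auto simp: valid_def cr_def)

lemma Barred_gt_Plain: "y \<ge> Barred k \<Longrightarrow> y > Plain j"
  by (cases y) (auto simp: less_letter_def)

text \<open>Creating slots are at least \<open>- 1\<close>, so \<open>m \<ge> 0\<close>, and for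
  \<open>m \<ge> 2\<close> validity is automatic. For \<open>m = 1\<close> one slot is at most 0, so
  its letter, and hence \<open>y\<close>, exceeds \<open>Plain i\<close>. For \<open>m = 0\<close>
  the slots are 0 and \<open>- 1\<close>.\<close>

lemma creation_pair_valid:
  assumes "cr (s, a)" "cr (t, b)" "s + t = 2 * m - 1" "x = min a b" "y = max a b"
  shows "valid (m, x, y)"
proof -
  have st: "s \<ge> - 1" "t \<ge> - 1" using assms by (auto simp: cr_def)
  then consider "m \<ge> 2" | "m = 1" | "m = 0" using assms(3) by linarith
  then show ?thesis
  proof cases
    case 2
    then have "s \<le> 0 \<or> t \<le> 0" using assms(3) by linarith
    then have "a > Plain i \<or> b > Plain i" using assms(1,2) Barred_gt_Plain by (auto simp: cr_def)
    then show ?thesis using 2 assms(5) by (auto simp: valid_iff less_max_iff_disj)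
  next
    case 3
    then have "s = 0 \<and> t = - 1 \<or> s = - 1 \<and> t = 0" using assms(3) st by linarith
    then have "a > Plain i \<and> b \<ge> Barred i \<or> b > Plain i \<and> a \<ge> Barred i"
      using assms(1,2) by (auto simp: cr_def)
    then show ?thesis using 3 assms(4,5) Barred_gt_Plain by (auto simp: valid_iff le_max_iff_disj)
  qed (simp add: valid_iff)
qed

lemma zz_vac: "\<not> (cr p \<and> cr q) \<Longrightarrow> \<exists>c. z p (z q vac) = scl c vac"
proof (cases "cr q")
  case False
  then show ?thesis using z_vac[of q] by (intro exI[of _ 0]) simp
next
  case True
  assume "\<not> (cr p \<and> cr q)"
  then have "z p vac = 0" using True z_vac by simp
  then show ?thesis by (intro exI[of _ "pr p q"]) (simp add: z_swap_pr[of p])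
qed

lemma scl_vac_subspace: "FV.subspace {scl c vac |c. True}"
proof -
  have "{scl c vac |c. True} = FV.span {vac}" by (auto simp: FV.span_singleton)
  then show ?thesis by simp
qed

lemma X_vac_invalid:
  assumes "npart p" "\<not> valid p"
  shows "\<exists>c. pX p vac = scl c vac"
proof -
  obtain m x y where p: "p = (m, x, y)" by (cases p)
  have xy: "x = min x y" "y = max x y" using assms(1) p by (auto simp: npart_def)
  have T: "T x y m k vac \<in> {scl c vac |c. True}" for k
  proof -
    have "\<not> (cr (2 * k, x) \<and> cr (2 * m - 1 - 2 * k, y))" "\<not> (cr (2 * k, y) \<and> cr (2 * m - 1 - 2 * k, x))"
      using creation_pair_valid[of "2 * k" x "2 * m - 1 - 2 * k" y m x y]
        creation_pair_valid[of "2 * k" y "2 * m - 1 - 2 * k" x m x y] xy assms(2) p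
      by (auto simp: min.commute max.commute)
    then have "z (2 * k, x) (z (2 * m - 1 - 2 * k, y) vac) \<in> {scl c vac |c. True}"
      "z (2 * k, y) (z (2 * m - 1 - 2 * k, x) vac) \<in> {scl c vac |c. True}"
      using zz_vac by blast+
    then show ?thesis unfolding T_def by (rule FV.subspace_add[OF scl_vac_subspace])
  qed
  have "X x y m vac \<in> {scl c vac |c. True}"
    unfolding X_def by (rule FV.subspace_sum[OF scl_vac_subspace]) (rule T)
  then show ?thesis by (auto simp: p)
qed

text \<open>Moved to the right end, the invalid factor acts on the vacuum by a scalar and drops out
  of the word.\<close>

lemma XW_invalid:
  assumes "\<forall>p\<in>set ps. npart p" "p \<in> set ps" "\<not> valid p"
  shows "XW ps vac \<in> G (length ps)"
proof -
  obtain ys zs where ps: "ps = ys @ p # zs" using assms(2) by (meson split_list)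
  have l: "\<forall>p\<in>set ps. lpart p" using assms(1) by (simp add: npart_def)
  obtain c where c: "pX p vac = scl c vac" using X_vac_invalid assms by blast
  have "mset ps = mset ((ys @ zs) @ [p])" by (simp add: ps)
  then have "XW ps vac - XW ((ys @ zs) @ [p]) vac \<in> G (length ps)" using l by (rule XW_mset)
  moreover have "XW ((ys @ zs) @ [p]) vac = scl c (XW (ys @ zs) vac)"
    by (simp add: c XW_scl XW_Fock Fock.vac)
  moreover have "scl c (XW (ys @ zs) vac) \<in> G (length ps)"
    using l by (intro FV.subspace_scale[OF G_subspace] G_base) (auto simp: ps)
  ultimately show ?thesis by (metis FV.subspace_add[OF G_subspace] diff_add_cancel)
qed

lemma finite_tuples: "finite (tuples M)"
proof -
  have "tuples M \<subseteq> set_mset M \<times> set_mset M \<times> set_mset M \<times> set_mset M"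
    by (auto simp: tuples_def)
  then show ?thesis by (rule finite_subset) simp
qed

text \<open>Applied to \<open>XW ws vac\<close>, the relation splits into rearrangements of the pair
  \<open>p\<close>, \<open>q\<close> and terms with larger \<open>Phi\<close>. Modulo shorter words
  the first group is an integer multiple of the given word; the tuple in \<open>t0\<close> shows
  that the integer is not zero, so it can be inverted.\<close>

lemma reduce_forbidden:
  assumes l: "a \<in> letters n" "b \<in> letters n" "c \<in> letters n" "d \<in> letters n"
    and ws: "\<forall>p\<in>set ws. npart p" and pq: "npart p" "npart q"
    and t0: "(a0, b0, c0, d0) \<in> tuples {#a, b, c, d#}" "norm_part (fst p, a0, b0) = p" "norm_part (fst q, c0, d0) = q"
    and lead: "\<And>a' b' c' d' k l. {#a', b', c', d'#} = {#a, b, c, d#} \<Longrightarrow> k + l = fst p + fst q \<Longrightarrow>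
      mset [norm_part (k, a', b'), norm_part (l, c', d')] = mset [p, q] \<or>
      Phi n [p, q] < Phi n [norm_part (k, a', b'), norm_part (l, c', d')]"
    and S: "FV.subspace S" "G (length ws + 2) \<subseteq> S"
    and IH: "\<And>qs. length qs = length ws + 2 \<Longrightarrow> \<forall>p\<in>set qs. npart p \<Longrightarrow>
      sum_list (map fst qs) = fst p + fst q + sum_list (map fst ws) \<Longrightarrow>
      Phi n (p # q # ws) < Phi n qs \<Longrightarrow> XW qs vac \<in> S"
  shows "XW (p # q # ws) vac \<in> S"
proof -
  define N where "N = fst p + fst q"
  define f where "f = XW ws vac"
  have f: "f \<in> Fock" by (simp add: f_def XW_Fock Fock.vac)
  obtain R where R: "finite R" "fst p \<in> R"
    "(\<Sum>(a', b', c', d')\<in>tuples {#a, b, c, d#}. \<Sum>m\<in>R. X a' b' m (X c' d' (N - m) f)) = 0"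
    using relation[OF f l] by blast
  define D where "D = tuples {#a, b, c, d#} \<times> R"
  define Q where "Q = (\<lambda>((a', b', c', d'), m). [norm_part (m, a', b'), norm_part (N - m, c', d')])"
  define v where "v = XW (p # q # ws) vac"
  have fin: "finite D" using R by (simp add: D_def finite_tuples)
  have Qn: "\<forall>x\<in>set (Q t). npart x" "length (Q t) = 2" "sum_list (map fst (Q t)) = N" if "t \<in> D" for t
  proof -
    obtain a' b' c' d' m where t: "t = ((a', b', c', d'), m)" by (metis prod.exhaust)
    have "{#a', b', c', d'#} = {#a, b, c, d#}" using that by (simp add: D_def t tuples_def)
    then have "set_mset {#a', b', c', d'#} \<subseteq> letters n" using l by auto
    then show "\<forall>x\<in>set (Q t). npart x" "length (Q t) = 2" "sum_list (map fst (Q t)) = N"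
      by (auto simp: Q_def t npart_norm lpart_def) (auto simp: norm_part_def)
  qed
  have "(\<Sum>t\<in>D. XW (Q t @ ws) vac) = (\<Sum>(a', b', c', d')\<in>tuples {#a, b, c, d#}. \<Sum>m\<in>R. X a' b' m (X c' d' (N - m) f))"
    unfolding D_def sum.cartesian_product'
    by (rule sum.cong[OF refl]) (auto simp: Q_def pX_norm f_def)
  then have sum0: "(\<Sum>t\<in>D. XW (Q t @ ws) vac) = 0" using R by simp
  \<comment> \<open>All terms of the relation have coefficient 1, so the copies of the leading pair
    add up and cannot cancel.\<close>
  define D1 where "D1 = {t \<in> D. mset (Q t) = mset [p, q]}"
  have D1: "v - XW (Q t @ ws) vac \<in> S" if "t \<in> D1" for t
  proof -
    have "v - XW (Q t @ ws) vac \<in> G (length (p # q # ws))"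
      unfolding v_def using that ws pq by (intro XW_mset) (auto simp: D1_def npart_def)
    then show ?thesis using S by auto
  qed
  have D2: "XW (Q t @ ws) vac \<in> S" if t: "t \<in> D - D1" for t
  proof (rule IH)
    obtain a' b' c' d' m where t': "t = ((a', b', c', d'), m)" by (metis prod.exhaust)
    have "{#a', b', c', d'#} = {#a, b, c, d#}" using t by (simp add: D_def t' tuples_def)
    from lead[OF this, of m "N - m"] have "Phi n [p, q] < Phi n (Q t)"
      using t by (auto simp: D1_def Q_def t' N_def)
    from Phi_less_append[OF this, of ws] show "Phi n (p # q # ws) < Phi n (Q t @ ws)" by simp
  qed (use Qn[of t] t ws in \<open>auto simp: N_def\<close>)
  have "scl (of_nat (card D1)) v = (\<Sum>t\<in>D1. v)" by (induction D1 rule: infinite_finite_induct) (auto simp: FV.scale_left_distrib)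
  also have "\<dots> = (\<Sum>t\<in>D1. v - XW (Q t @ ws) vac) + (\<Sum>t\<in>D1. XW (Q t @ ws) vac)"
    by (simp add: sum_subtractf)
  also have "(\<Sum>t\<in>D1. XW (Q t @ ws) vac) = - (\<Sum>t\<in>D - D1. XW (Q t @ ws) vac)"
    using sum.subset_diff[of D1 D "\<lambda>t. XW (Q t @ ws) vac"] fin sum0
    by (simp add: D1_def eq_neg_iff_add_eq_0 add.commute)
  finally have e: "scl (of_nat (card D1)) v
      = (\<Sum>t\<in>D1. v - XW (Q t @ ws) vac) + - (\<Sum>t\<in>D - D1. XW (Q t @ ws) vac)" .
  have "scl (of_nat (card D1)) v \<in> S"
    unfolding e by (intro FV.subspace_add[OF S(1)] FV.subspace_neg[OF S(1)] FV.subspace_sum[OF S(1)] D1 D2)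
  then have "scl (inverse (of_nat (card D1))) (scl (of_nat (card D1)) v) \<in> S"
    by (rule FV.subspace_scale[OF S(1)])
  moreover have "card D1 \<noteq> 0"
  proof -
    have "((a0, b0, c0, d0), fst p) \<in> D1" using t0 R by (simp add: D1_def D_def Q_def N_def)
    moreover have "finite D1" using fin by (simp add: D1_def)
    ultimately show ?thesis by (metis card_0_eq empty_iff)
  qed
  ultimately show ?thesis by (simp add: v_def)
qed

text \<open>The difference condition with the values of \<open>rho\<close> resolved into cases, see
  \<open>R_iff_rho\<close>. In this form it is visibly transitive, so that a condition on neighbours
  becomes one on all pairs.\<close>

definition R :: "part \<Rightarrow> part \<Rightarrow> bool" where
  "R p q = (case p of (m, x, y) \<Rightarrow> case q of (m', x', y') \<Rightarrow>
     m' \<le> m \<and> (m = m' \<longrightarrow> x' < x \<and> y' < y) \<and> (m = m' + 1 \<longrightarrow> x' < y))"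

definition GP :: "part list set" where
  "GP = {ps. sorted_wrt R ps \<and> (\<forall>p\<in>set ps. npart p \<and> valid p)}"

definition Sp :: "fvec set" where
  "Sp = FV.span {XW ps vac |ps. ps \<in> GP}"

lemma Sp_subspace: "FV.subspace Sp"
  by (simp add: Sp_def)

lemma valid_nonneg: "valid p \<Longrightarrow> 0 \<le> fst p"
  by (auto simp: valid_def cr_def)

text \<open>With \<open>q \<le> p\<close>, a violation of \<open>R\<close> means one of three
  configurations: equal sizes with \<open>x' \<le> x \<le> y \<le> y'\<close>, equal sizes with
  \<open>x = x' \<le> y' \<le> y\<close>, or sizes differing by one with
  \<open>x \<le> y \<le> x' \<le> y'\<close>. Each is the leading pair of a quadratic
  relation.\<close>

lemma not_R_reduce:
  assumes R: "\<not> R p q" "q \<le> p" and pq: "npart p" "npart q" and ws: "\<forall>p\<in>set ws. npart p"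
    and S: "FV.subspace S" "G (length ws + 2) \<subseteq> S"
    and IH: "\<And>qs. length qs = length ws + 2 \<Longrightarrow> \<forall>p\<in>set qs. npart p \<Longrightarrow>
      sum_list (map fst qs) = fst p + fst q + sum_list (map fst ws) \<Longrightarrow>
      Phi n (p # q # ws) < Phi n qs \<Longrightarrow> XW qs vac \<in> S"
  shows "XW (p # q # ws) vac \<in> S"
proof -
  obtain m x y where p: "p = (m, x, y)" by (cases p)
  obtain m' x' y' where q: "q = (m', x', y')" by (cases q)
  have L: "x \<in> letters n" "y \<in> letters n" "x' \<in> letters n" "y' \<in> letters n" "x \<le> y" "x' \<le> y'"
    using pq by (auto simp: npart_def lpart_def p q)
  have le: "m' \<le> m" "m = m' \<longrightarrow> x' \<le> x" "m = m' \<longrightarrow> x = x' \<longrightarrow> y' \<le> y" using R(2) by (auto simp: p q less_eq_prod_def)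
  then consider "m = m'" "y \<le> y'" "x' \<le> x" | "m = m'" "x = x'" "y' \<le> y" | "m = m' + 1" "y \<le> x'"
    using R(1) by (fastforce simp: R_def p q)
  then show ?thesis
  proof cases
    case 1
    have ph: "Phi n [q, p] = Phi n [p, q]" by (rule Phi_mset) simp
    show ?thesis
    proof (rule reduce_forbidden[of x' x y y' ws p q x y x' y'])
      show "(x, y, x', y') \<in> tuples {#x', x, y, y'#}" by (simp add: tuples_def add_mset_commute)
      show "mset [norm_part (k, a', b'), norm_part (l, c', d')] = mset [p, q] \<or>
          Phi n [p, q] < Phi n [norm_part (k, a', b'), norm_part (l, c', d')]"
        if "{#a', b', c', d'#} = {#x', x, y, y'#}" "k + l = fst p + fst q" for a' b' c' d' k l
        using leading_even[of x' n x y y' a' b' c' d' k l m] that L 1 ph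
        by (auto simp: p q add_mset_commute)
    qed (use L 1 S IH ws pq in \<open>auto simp: p q norm_part_def\<close>)
  next
    case 2
    show ?thesis
    proof (rule reduce_forbidden[of x x' y' y ws p q x y x' y'])
      show "(x, y, x', y') \<in> tuples {#x, x', y', y#}" by (simp add: tuples_def add_mset_commute)
      show "mset [norm_part (k, a', b'), norm_part (l, c', d')] = mset [p, q] \<or>
          Phi n [p, q] < Phi n [norm_part (k, a', b'), norm_part (l, c', d')]"
        if "{#a', b', c', d'#} = {#x, x', y', y#}" "k + l = fst p + fst q" for a' b' c' d' k l
        using leading_even[of x n x' y' y a' b' c' d' k l m] that L 2
        by (auto simp: p q add_mset_commute)
    qed (use L 2 S IH ws pq in \<open>auto simp: p q norm_part_def\<close>)
  next
    case 3
    show ?thesis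
    proof (rule reduce_forbidden[of x y x' y' ws p q x y x' y'])
      show "(x, y, x', y') \<in> tuples {#x, y, x', y'#}" by (simp add: tuples_def)
      show "mset [norm_part (k, a', b'), norm_part (l, c', d')] = mset [p, q] \<or>
          Phi n [p, q] < Phi n [norm_part (k, a', b'), norm_part (l, c', d')]"
        if "{#a', b', c', d'#} = {#x, y, x', y'#}" "k + l = fst p + fst q" for a' b' c' d' k l
        using leading_odd[of x n y x' y' a' b' c' d' k l m'] that L 3
        by (auto simp: p q)
    qed (use L 3 S IH ws pq in \<open>auto simp: p q norm_part_def\<close>)
  qed
qed

text \<open>Two nested inductions: on the length, so that \<open>G r\<close> is already covered, and
  on the number of words in \<open>\<Omega>\<close> with larger \<open>Phi\<close>. Rewriting
  increases \<open>Phi\<close> and keeps the total size \<open>N\<close>; valid parts have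
  nonnegative sizes, hence sizes at most \<open>N\<close>, which makes \<open>\<Omega>\<close>
  finite.\<close>

lemma spanning_npart: "\<forall>p\<in>set ps. npart p \<Longrightarrow> XW ps vac \<in> Sp"
proof (induction "length ps" arbitrary: ps rule: less_induct)
  case (less ps)
  define r where "r = length ps"
  have GS: "G r \<subseteq> Sp"
    unfolding G_def
  proof (rule FV.span_minimal[OF _ Sp_subspace], safe)
    fix qs :: "part list" assume qs: "length qs < r" "\<forall>p\<in>set qs. lpart p"
    have "XW (map norm_part qs) f = XW qs f" for f by (induction qs) (auto simp: pX_norm)
    then show "XW qs vac \<in> Sp" using less.hyps[of "map norm_part qs"] qs npart_norm by (simp add: r_def)
  qed
  define N where "N = sum_list (map fst ps)"
  define \<Omega> where "\<Omega> = {qs :: part list. set qs \<subseteq> {0..N} \<times> letters n \<times> letters n \<and> length qs = r}"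
  have fin: "finite \<Omega>" unfolding \<Omega>_def by (rule finite_lists_length_eq) simp
  have "XW qs vac \<in> Sp" if "length qs = r" "\<forall>p\<in>set qs. npart p" "sum_list (map fst qs) = N" for qs
    using that
  proof (induction "card {ws \<in> \<Omega>. Phi n qs < Phi n ws}" arbitrary: qs rule: less_induct)
    case (less qs)
    show ?case
    proof (cases "\<forall>p\<in>set qs. valid p")
      case False
      then show ?thesis using XW_invalid[of qs] less.prems GS by blast
    next
      case True
      \<comment> \<open>Descending order supplies the hypothesis \<open>q \<le> p\<close> of
        \<open>not_R_reduce\<close> for every pair of positions; \<open>Phi\<close> depends on the
        multiset only.\<close>
      define us where "us = rev (sort qs)"
      have us: "mset us = mset qs" "sorted_wrt (\<ge>) us"
        by (simp_all add: us_def sorted_wrt_rev)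
      have su: "set us = set qs" "length us = r" using us(1) less.prems(1) by (metis set_mset_mset, metis size_mset)
      have "XW us vac \<in> Sp"
      proof (cases "sorted_wrt R us")
        case True
        then have "us \<in> GP" using su \<open>\<forall>p\<in>set qs. valid p\<close> less.prems by (simp add: GP_def)
        then show ?thesis unfolding Sp_def by (intro FV.span_base) blast
      next
        case False
        then obtain i j where ij: "i < j" "j < length us" "\<not> R (us ! i) (us ! j)"
          by (auto simp: sorted_wrt_iff_nth_less)
        define p where "p = us ! i"
        define q where "q = us ! j"
        have pq: "q \<le> p" using us(2) ij by (auto simp: sorted_wrt_iff_nth_less p_def q_def)
        define ws where "ws = take i us @ drop (Suc i) (take j us) @ drop (Suc j) us"
        have "us = take i (take j us) @ take j us ! i # drop (Suc i) (take j us) @ q # drop (Suc j) us"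
          using ij by (subst id_take_nth_drop[of j us], simp, subst id_take_nth_drop[of i "take j us"]) (auto simp: q_def)
        then have "mset us = mset (take i (take j us) @ take j us ! i # drop (Suc i) (take j us) @ q # drop (Suc j) us)"
          by (rule arg_cong)
        then have ms: "mset (p # q # ws) = mset us"
          using ij by (simp add: ws_def p_def min_def)
        have sw: "set (p # q # ws) = set us" using ms by (metis set_mset_mset)
        have lw: "length ws + 2 = r" using ms su by (metis add_2_eq_Suc' length_Cons size_mset)
        have Nw: "fst p + fst q + sum_list (map fst ws) = N"
        proof -
          have "sum_mset (image_mset fst (mset (p # q # ws))) = sum_mset (image_mset fst (mset qs))" using ms us(1) by simp
          then show ?thesis using less.prems(3) by (simp add: sum_mset_sum_list flip: mset_map)
        qed
        have Ph: "Phi n (p # q # ws) = Phi n qs" using ms us(1) by (intro Phi_mset) simp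
        have "XW (p # q # ws) vac \<in> Sp"
        proof (rule not_R_reduce)
          show "\<not> R p q" using ij by (simp add: p_def q_def)
          show "npart p" "npart q" "\<forall>p\<in>set ws. npart p" using sw su less.prems(2) by auto
          show "G (length ws + 2) \<subseteq> Sp" using GS lw by simp
          fix vs assume vs: "length vs = length ws + 2" "\<forall>p\<in>set vs. npart p"
            "sum_list (map fst vs) = fst p + fst q + sum_list (map fst ws)" "Phi n (p # q # ws) < Phi n vs"
          show "XW vs vac \<in> Sp"
          proof (cases "\<forall>p\<in>set vs. valid p")
            case False
            then show ?thesis using XW_invalid[of vs] vs lw GS by auto
          next
            case True
            have "vs \<in> \<Omega>"
            proof -
              have "fst x \<le> N" if "x \<in> set vs" for x
              proof -
                have "fst x \<le> sum_list (map fst vs)"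
                  using that True valid_nonneg by (intro member_le_sum_list) auto
                then show ?thesis using vs(3) Nw by simp
              qed
              then show ?thesis using vs lw True valid_nonneg by (fastforce simp: \<Omega>_def npart_def lpart_def)
            qed
            have "{ws \<in> \<Omega>. Phi n vs < Phi n ws} \<subset> {ws \<in> \<Omega>. Phi n qs < Phi n ws}"
              using vs(4) \<open>vs \<in> \<Omega>\<close> unfolding Ph by auto
            then have "card {ws \<in> \<Omega>. Phi n vs < Phi n ws} < card {ws \<in> \<Omega>. Phi n qs < Phi n ws}"
              using fin by (intro psubset_card_mono) auto
            then show ?thesis using vs lw Nw by (intro less.hyps) auto
          qed
        qed (use pq Sp_subspace in auto)
        moreover have "XW us vac - XW (p # q # ws) vac \<in> G (length us)"
          using ms su less.prems(2) by (intro XW_mset) (auto simp: npart_def)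
        ultimately show ?thesis
          using GS su FV.subspace_add[OF Sp_subspace] by (metis diff_add_cancel subsetD)
      qed
      moreover have "XW qs vac - XW us vac \<in> G (length qs)"
        using us less.prems(2) by (intro XW_mset) (auto simp: npart_def)
      ultimately show ?thesis
        using GS less.prems(1) FV.subspace_add[OF Sp_subspace] by (metis diff_add_cancel subsetD)
    qed
  qed
  then show ?case using less.prems by (simp add: r_def N_def)
qed

lemma spanning: "\<forall>p\<in>set ps. lpart p \<Longrightarrow> XW ps vac \<in> Sp"
proof -
  assume "\<forall>p\<in>set ps. lpart p"
  then have "XW (map norm_part ps) vac \<in> Sp" using npart_norm by (intro spanning_npart) auto
  moreover have "XW (map norm_part ps) f = XW ps f" for f by (induction ps) (auto simp: pX_norm)
  ultimately show ?thesis by simp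
qed

end

section \<open>Linear independence\<close>

text \<open>Sums of these weights are compared lexicographically and leading sets are maximal: first
  many modes, then slots near zero, then high letters in low slots.\<close>

definition mode_weight :: "nat \<Rightarrow> mode \<Rightarrow> int \<times> int \<times> int" where
  "mode_weight n p = (1, - (fst p * fst p), - (int (val n (snd p)) * fst p))"

definition W :: "nat \<Rightarrow> mode set \<Rightarrow> int \<times> int \<times> int" where
  "W n A = (\<Sum>p\<in>A. 1, \<Sum>p\<in>A. - (fst p * fst p), \<Sum>p\<in>A. - (int (val n (snd p)) * fst p))"

definition lead :: "nat \<Rightarrow> mode set \<Rightarrow> fvec \<Rightarrow> bool" where
  "lead n A f \<longleftrightarrow> finite A \<and> coef f A \<noteq> 0 \<and> (\<forall>B. coef f B \<noteq> 0 \<longrightarrow> finite B \<and> (B = A \<or> W n B < W n A))"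

definition wadd :: "int \<times> int \<times> int \<Rightarrow> int \<times> int \<times> int \<Rightarrow> int \<times> int \<times> int" where
  "wadd u v = (fst u + fst v, fst (snd u) + fst (snd v), snd (snd u) + snd (snd v))"

lemma W_insert: "finite A \<Longrightarrow> p \<notin> A \<Longrightarrow> W n (insert p A) = wadd (mode_weight n p) (W n A)"
  by (simp add: W_def wadd_def mode_weight_def)

lemma W_insert2:
  "finite A \<Longrightarrow> p \<notin> A \<Longrightarrow> q \<notin> A \<Longrightarrow> p \<noteq> q \<Longrightarrow>
    W n (insert p (insert q A)) = wadd (wadd (mode_weight n p) (mode_weight n q)) (W n A)"
  by (simp add: W_insert) (simp add: wadd_def)

lemma wadd_mono: "u \<le> u' \<Longrightarrow> v \<le> v' \<Longrightarrow> wadd u v \<le> wadd u' v'"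
  by (auto simp: wadd_def less_eq_prod_def)

lemma wadd_strict_mono: "u < u' \<Longrightarrow> v \<le> v' \<Longrightarrow> wadd u v < wadd u' v'"
  by (auto simp: wadd_def less_eq_prod_def less_prod_def)

lemma wadd_strict_mono2: "u \<le> u' \<Longrightarrow> v < v' \<Longrightarrow> wadd u v < wadd u' v'"
  by (auto simp: wadd_def less_eq_prod_def less_prod_def)

lemma fst_W: "fst (W n A) = int (card A)"
  by (simp add: W_def)

definition modes :: "part list \<Rightarrow> mode set" where
  "modes ps = (\<Union>(m, x, y)\<in>set ps. {(m, x), (m - 1, y)})"

lemma modes_simps [simp]: "modes [] = {}" "modes ((m, x, y) # ps) = insert (m, x) (insert (m - 1, y) (modes ps))"
  by (auto simp: modes_def)

lemma slots_balance:
  fixes s t m :: int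
  assumes "s + t = 2 * m - 1" "s \<noteq> m" "s \<noteq> m - 1"
  shows "m * m + (m - 1) * (m - 1) < s * s + t * t"
  using odd_balance[of s t "m - 1"] assms by simp

context fock
begin

lemma coef_z_cr: "cr p \<Longrightarrow> coef (z p f) B \<noteq> 0 \<longleftrightarrow> p \<in> B \<and> coef f (B - {p}) \<noteq> 0"
  by (simp add: z_def cre_def)

lemma coef_z_ann: "\<not> cr p \<Longrightarrow> coef (z p f) B \<noteq> 0 \<longleftrightarrow> dual p \<notin> B \<and> coef f (insert (dual p) B) \<noteq> 0"
  by (simp add: z_def ann_def)

text \<open>Unless both fermions create, the number of modes does not grow by two, and the first
  entry of the weight is already too small. Two creating fermions just enlarge the sets in the
  support of \<open>f\<close>.\<close>

lemma zz_lead: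
  assumes f: "lead n A f" and B: "coef (z p (z q f)) B \<noteq> 0"
  shows "finite B \<and>
    (fst (W n B) < fst (W n A) + 2 \<or>
     cr p \<and> cr q \<and> p \<noteq> q \<and> (B = insert p (insert q A) \<and> p \<notin> A \<and> q \<notin> A \<or>
       W n B < wadd (wadd (mode_weight n p) (mode_weight n q)) (W n A)))"
proof -
  have le: "finite B'" "fst (W n B') \<le> fst (W n A)" if "coef f B' \<noteq> 0" for B'
    using f that by (auto simp: lead_def less_prod_def)
  consider "cr p" "cr q" | "cr p" "\<not> cr q" | "\<not> cr p" "cr q" | "\<not> cr p" "\<not> cr q" by blast
  then show ?thesis
  proof cases
    case 1
    then have m: "p \<in> B" "q \<in> B - {p}" "coef f (B - {p} - {q}) \<noteq> 0" using B by (auto simp: coef_z_cr)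
    define C where "C = B - {p} - {q}"
    have C: "B = insert p (insert q C)" "p \<notin> C" "q \<notin> C" "p \<noteq> q" using m by (auto simp: C_def)
    have fin: "finite C" using le(1)[OF m(3)] by (simp only: C_def)
    have WB: "W n B = wadd (wadd (mode_weight n p) (mode_weight n q)) (W n C)"
      unfolding C(1) using C fin by (intro W_insert2)
    have "C = A \<or> W n C < W n A" using f m by (auto simp: lead_def C_def)
    then show ?thesis
    proof
      assume "C = A"
      then show ?thesis using C fin 1 by auto
    next
      assume "W n C < W n A"
      then have "W n B < wadd (wadd (mode_weight n p) (mode_weight n q)) (W n A)"
        unfolding WB by (intro wadd_strict_mono2) auto
      then show ?thesis using C fin 1 by auto
    qed
  next
    case 2
    then have m: "p \<in> B" "coef f (insert (dual q) (B - {p})) \<noteq> 0" "dual q \<notin> B - {p}"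
      using B by (auto simp: coef_z_cr coef_z_ann)
    from le[OF m(2)] have fin: "finite B" by simp
    have "card (insert (dual q) (B - {p})) = Suc (card (B - {p}))" using m fin by simp
    also have "\<dots> = card B" using m fin by (simp only: card_Suc_Diff1)
    finally have "fst (W n (insert (dual q) (B - {p}))) = fst (W n B)" by (simp add: fst_W)
    then show ?thesis using le[OF m(2)] fin by linarith
  next
    case 3
    then have m: "q \<in> insert (dual p) B" "coef f (insert (dual p) B - {q}) \<noteq> 0" "dual p \<notin> B"
      using B by (auto simp: coef_z_cr coef_z_ann)
    from le(1)[OF m(2)] have fin: "finite B" by (auto simp: insert_Diff_if split: if_splits)
    have "card (insert (dual p) B) = Suc (card B)" using m fin by simp
    then have "card (insert (dual p) B - {q}) = card B" using m fin by simp
    then have "fst (W n (insert (dual p) B - {q})) = fst (W n B)" by (simp add: fst_W)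
    then show ?thesis using le[OF m(2)] fin by linarith
  next
    case 4
    then have m: "dual p \<notin> B" "coef f (insert (dual q) (insert (dual p) B)) \<noteq> 0"
      using B by (auto simp: coef_z_ann)
    from le[OF m(2)] have fin: "finite B" by simp
    have "card B \<le> card (insert (dual q) (insert (dual p) B))" using fin by (intro card_mono) auto
    then have "fst (W n B) \<le> fst (W n (insert (dual q) (insert (dual p) B)))" by (simp add: fst_W)
    then show ?thesis using le[OF m(2)] fin by linarith
  qed
qed

text \<open>Among slots with sum \<open>2 * m - 1\<close> the squares are smallest for
  \<open>m\<close> and \<open>m - 1\<close>, and of the two placements of \<open>x \<le> y\<close>
  the third entry favours \<open>y\<close> in the lower slot. Only the summand \<open>k0\<close>,
  whose even slot is \<open>m\<close> or \<open>m - 1\<close>, reaches this weight.\<close>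

lemma lead_X:
  assumes f: "lead n A f" "f \<in> Fock" and xy: "x \<in> letters n" "y \<in> letters n" "x \<le> y"
    and cr: "cr (m, x)" "cr (m - 1, y)" and A: "(m, x) \<notin> A" "(m - 1, y) \<notin> A"
  shows "lead n (insert (m, x) (insert (m - 1, y) A)) (X x y m f)"
proof -
  define A' where "A' = insert (m, x) (insert (m - 1, y) A)"
  have finA: "finite A" "finite A'" using f by (auto simp: lead_def A'_def)
  have WA: "W n A' = wadd (wadd (mode_weight n (m, x)) (mode_weight n (m - 1, y))) (W n A)"
    unfolding A'_def using finA A by (intro W_insert2) auto
  have fWA: "fst (W n A') = fst (W n A) + 2" by (simp add: WA wadd_def mode_weight_def)
  have v: "int (val n x) \<le> int (val n y)" using xy by (simp add: val_le_iff)
  have lead_term: "finite B \<and> (W n B < W n A' \<or> B = A' \<and> (s = m \<and> t = m - 1 \<and> a = x \<and> b = y \<or> s = m - 1 \<and> t = m \<and> a = y \<and> b = x))"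
    if B: "coef (z (s, a) (z (t, b) f)) B \<noteq> 0" and st: "s + t = 2 * m - 1" and ab: "a = x \<and> b = y \<or> a = y \<and> b = x"
    for s t a b B
  proof -
    let ?w = "wadd (mode_weight n (s, a)) (mode_weight n (t, b))"
    have sw: "?w < wadd (mode_weight n (m, x)) (mode_weight n (m - 1, y)) \<or>
        s = m \<and> t = m - 1 \<and> a = x \<and> b = y \<or> s = m - 1 \<and> t = m \<and> a = y \<and> b = x"
    proof (cases "s = m \<or> s = m - 1")
      case False
      then have "m * m + (m - 1) * (m - 1) < s * s + t * t" using slots_balance[OF st] by simp
      then have "fst (snd ?w) < fst (snd (wadd (mode_weight n (m, x)) (mode_weight n (m - 1, y))))"
        by (simp add: wadd_def mode_weight_def)
      moreover have "fst ?w = fst (wadd (mode_weight n (m, x)) (mode_weight n (m - 1, y)))"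
        by (simp add: wadd_def mode_weight_def)
      ultimately show ?thesis by (auto simp: less_prod_def)
    next
      case True
      have "x = y \<or> int (val n x) < int (val n y)" using v xy by (auto simp: val_eq_iff order_le_less)
      then show ?thesis using True st ab
        by (auto simp: less_prod_def wadd_def mode_weight_def algebra_simps)
    qed
    from zz_lead[OF f(1) B] show ?thesis
    proof (elim conjE disjE, goal_cases)
      case 1
      then show ?case using fWA by (auto simp: less_prod_def)
    next
      case 2
      have WB: "W n B = wadd ?w (W n A)"
        using 2 finA by (simp add: W_insert2)
      from sw show ?case
      proof
        assume "?w < wadd (mode_weight n (m, x)) (mode_weight n (m - 1, y))"
        then have "W n B < W n A'" unfolding WB WA by (rule wadd_strict_mono) simp
        then show ?case using 2 by blast
      next
        assume e: "s = m \<and> t = m - 1 \<and> a = x \<and> b = y \<or> s = m - 1 \<and> t = m \<and> a = y \<and> b = x"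
        then have "B = A'" using 2 by (auto simp: A'_def)
        then show ?case using e 2 by blast
      qed
    next
      case 3
      have "?w \<le> wadd (mode_weight n (m, x)) (mode_weight n (m - 1, y))"
        using sw
      proof (elim disjE conjE)
        assume "s = m - 1" "t = m" "a = y" "b = x"
        then show ?thesis by (simp add: wadd_def)
      qed simp_all
      then have "wadd ?w (W n A) \<le> W n A'" unfolding WA by (rule wadd_mono) simp
      then show ?case using 3 less_le_trans by blast
    qed
  qed
  obtain K where "win m f K" using win_exists[OF f(2)] by blast
  note K = winD[OF this]
  define k0 where "k0 = (if even m then m div 2 else (m - 1) div 2)"
  have k0: "2 * k0 = m \<and> 2 * m - 1 - 2 * k0 = m - 1 \<or> 2 * k0 = m - 1 \<and> 2 * m - 1 - 2 * k0 = m"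
    by (auto simp: k0_def)
  define S where "S = insert k0 {- K..K}"
  have S: "finite S" "{- K..K} \<subseteq> S" "k0 \<in> S" by (auto simp: S_def)
  have XB: "coef (X x y m f) B = (\<Sum>k\<in>S. coef (T x y m k f) B)" for B
    unfolding K[OF S(1,2)] coef_sum ..
  have k0_unique: "k = k0" if "2 * k = m \<or> 2 * k = m - 1" for k
    using that k0 by presburger
  have TB: "finite B \<and> (W n B < W n A' \<or> B = A' \<and> k = k0)" if "coef (T x y m k f) B \<noteq> 0" for k B
  proof -
    from that have "coef (z (2 * k, x) (z (2 * m - 1 - 2 * k, y) f)) B \<noteq> 0 \<or>
      coef (z (2 * k, y) (z (2 * m - 1 - 2 * k, x) f)) B \<noteq> 0" by (auto simp: T_def)
    then show ?thesis
    proof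
      assume a: "coef (z (2 * k, x) (z (2 * m - 1 - 2 * k, y) f)) B \<noteq> 0"
      have "finite B \<and> (W n B < W n A' \<or> B = A' \<and> (2 * k = m \<or> 2 * k = m - 1))"
        using lead_term[OF a] by auto
      then show ?thesis using k0_unique by blast
    next
      assume a: "coef (z (2 * k, y) (z (2 * m - 1 - 2 * k, x) f)) B \<noteq> 0"
      have "finite B \<and> (W n B < W n A' \<or> B = A' \<and> (2 * k = m \<or> 2 * k = m - 1))"
        using lead_term[OF a] by auto
      then show ?thesis using k0_unique by blast
    qed
  qed
  have "coef (X x y m f) A' = coef (T x y m k0 f) A'"
    unfolding XB using S TB by (subst sum.remove[OF S(1,3)]) (auto intro!: sum.neutral)
  moreover have "coef (T x y m k0 f) A' \<noteq> 0"
  proof -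
    have nz: "coef (z (m, x) (z (m - 1, y) f)) A' \<noteq> 0"
    proof -
      have "A' - {(m, x)} - {(m - 1, y)} = A" using A by (auto simp: A'_def)
      then show ?thesis using cr f(1) by (auto simp: coef_z_cr A'_def lead_def)
    qed
    have sw: "z (m - 1, y) (z (m, x) f) = - z (m, x) (z (m - 1, y) f)"
    proof -
      have "(m, x) \<noteq> dual (m - 1, y)" using cr cr_dual by metis
      then show ?thesis by (subst z_swap) auto
    qed
    \<comment> \<open>For \<open>x \<noteq> y\<close> the other half of \<open>T\<close> places the
      letters the wrong way round and misses \<open>A'\<close>. For \<open>x = y\<close> the halves
      are equal and add up.\<close>
    have zero: "coef (z (m, y) (z (m - 1, x) f)) A' = 0 \<and> coef (z (m - 1, x) (z (m, y) f)) A' = 0" if "x \<noteq> y"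
      using lead_term[of m y "m - 1" x A'] lead_term[of "m - 1" x m y A'] that by auto
    show ?thesis
      using k0
    proof
      assume k: "2 * k0 = m \<and> 2 * m - 1 - 2 * k0 = m - 1"
      show ?thesis unfolding T_def conjunct1[OF k] conjunct2[OF k] using nz zero
        by (cases "x = y") auto
    next
      assume k: "2 * k0 = m - 1 \<and> 2 * m - 1 - 2 * k0 = m"
      show ?thesis unfolding T_def conjunct1[OF k] conjunct2[OF k] using nz zero sw
        by (cases "x = y") auto
    qed
  qed
  moreover have "finite B \<and> (B = A' \<or> W n B < W n A')" if "coef (X x y m f) B \<noteq> 0" for B
  proof -
    have "\<exists>k\<in>S. coef (T x y m k f) B \<noteq> 0"
    proof (rule ccontr)
      assume "\<not> (\<exists>k\<in>S. coef (T x y m k f) B \<noteq> 0)"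
      then have "(\<Sum>k\<in>S. coef (T x y m k f) B) = 0" by (intro sum.neutral) auto
      then show False using that by (simp add: XB)
    qed
    then obtain k where "coef (T x y m k f) B \<noteq> 0" by blast
    then show ?thesis using TB by blast
  qed
  ultimately show ?thesis using finA by (auto simp: lead_def A'_def)
qed

lemma GP_Cons: "p # ps \<in> GP \<Longrightarrow> ps \<in> GP \<and> npart p \<and> valid p \<and> (\<forall>q\<in>set ps. R p q)"
  by (auto simp: GP_def)

lemma modes_bounds:
  assumes "(m, x, y) # ps \<in> GP" "(s, c) \<in> modes ps"
  shows "s \<le> m \<and> (s = m \<longrightarrow> c < x) \<and> (s = m - 1 \<longrightarrow> c < y)"
proof -
  obtain m' x' y' where q: "(m', x', y') \<in> set ps" "(s, c) = (m', x') \<or> (s, c) = (m' - 1, y')"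
    using assms(2) by (auto simp: modes_def)
  have "R (m, x, y) (m', x', y')" using GP_Cons[OF assms(1)] q(1) by blast
  then show ?thesis using q(2) by (auto simp: R_def)
qed

lemma modes_disjoint:
  assumes "(m, x, y) # ps \<in> GP"
  shows "(m, x) \<notin> modes ps" "(m - 1, y) \<notin> modes ps"
  using modes_bounds[OF assms] by auto

lemma lead_GP: "ps \<in> GP \<Longrightarrow> lead n (modes ps) (XW ps vac)"
proof (induction ps)
  case Nil
  then show ?case by (simp add: lead_def vac_def)
next
  case (Cons p ps)
  obtain m x y where p: "p = (m, x, y)" by (cases p)
  note c = GP_Cons[OF Cons.prems]
  have "lead n (insert (m, x) (insert (m - 1, y) (modes ps))) (X x y m (XW ps vac))"
    using Cons c modes_disjoint[of m x y ps]
    by (intro lead_X) (auto simp: p npart_def lpart_def valid_def XW_Fock Fock.vac)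
  then show ?case by (simp add: p)
qed

text \<open>The first part can be read off from the set of modes: by \<open>modes_bounds\<close>,
  \<open>m\<close> is the highest slot, \<open>x\<close> the greatest letter in it, and
  \<open>y\<close> the greatest letter in slot \<open>m - 1\<close>.\<close>

lemma modes_inj: "ps \<in> GP \<Longrightarrow> qs \<in> GP \<Longrightarrow> modes ps = modes qs \<Longrightarrow> ps = qs"
proof (induction ps arbitrary: qs)
  case Nil
  then show ?case by (cases qs) auto
next
  case (Cons p ps)
  obtain m x y where p: "p = (m, x, y)" by (cases p)
  obtain q qs' where qs: "qs = q # qs'" using Cons.prems p by (cases qs) auto
  obtain m' x' y' where q: "q = (m', x', y')" by (cases q)
  note P = Cons.prems(1)[unfolded p] and Q = Cons.prems(2)[unfolded qs q]
  have M: "insert (m, x) (insert (m - 1, y) (modes ps)) = insert (m', x') (insert (m' - 1, y') (modes qs'))"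
    using Cons.prems(3) by (simp add: p qs q)
  have b: "s \<le> m \<and> (s = m \<longrightarrow> c \<le> x) \<and> (s = m - 1 \<longrightarrow> c \<le> y)"
    if "(s, c) \<in> insert (m, x) (insert (m - 1, y) (modes ps))" for s c
    using modes_bounds[OF P, of s c] that by auto
  have b': "s \<le> m' \<and> (s = m' \<longrightarrow> c \<le> x') \<and> (s = m' - 1 \<longrightarrow> c \<le> y')"
    if "(s, c) \<in> insert (m', x') (insert (m' - 1, y') (modes qs'))" for s c
    using modes_bounds[OF Q, of s c] that by auto
  have "m' \<le> m \<and> (m' = m \<longrightarrow> x' \<le> x)" "m' = m \<longrightarrow> y' \<le> y"
    using b[of m' x'] b[of "m' - 1" y'] unfolding M by auto
  moreover have "m \<le> m' \<and> (m = m' \<longrightarrow> x \<le> x')" "m = m' \<longrightarrow> y \<le> y'"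
    using b'[of m x] b'[of "m - 1" y] unfolding M[symmetric] by auto
  ultimately have e: "m' = m" "x' = x" "y' = y" by auto
  have "modes ps = modes qs'"
    using M modes_disjoint[OF P] modes_disjoint[OF Q] unfolding e
    by (metis Diff_insert_absorb insertE insert_iff prod.inject diff_add_cancel zero_neq_one add_cancel_right_right)
  then have "ps = qs'" using Cons.IH GP_Cons[OF P] GP_Cons[OF Q] by blast
  then show ?case by (simp add: p qs q e)
qed

text \<open>Triangularity: at a leading set of maximal weight only its own word has a nonzero
  coefficient.\<close>

lemma GP_independent:
  assumes "finite P" "P \<subseteq> GP" "(\<Sum>ps\<in>P. scl (c ps) (XW ps vac)) = 0" "ps \<in> P"
  shows "c ps = 0"
proof (rule ccontr)
  assume "c ps \<noteq> 0"
  define P' where "P' = {ps \<in> P. c ps \<noteq> 0}"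
  have P': "finite P'" "P' \<noteq> {}" "P' \<subseteq> GP" using assms \<open>c ps \<noteq> 0\<close> by (auto simp: P'_def)
  define w where "w = Max ((\<lambda>ps. W n (modes ps)) ` P')"
  have "w \<in> (\<lambda>ps. W n (modes ps)) ` P'" unfolding w_def using P' by (intro Max_in) auto
  then obtain qs where qs: "qs \<in> P'" "W n (modes qs) = w" by auto
  have mx: "W n (modes rs) \<le> w" if "rs \<in> P'" for rs
    unfolding w_def using P' that by (intro Max_ge) auto
  have "coef (XW rs vac) (modes qs) = 0" if rs: "rs \<in> P'" "rs \<noteq> qs" for rs
  proof (rule ccontr)
    assume "coef (XW rs vac) (modes qs) \<noteq> 0"
    then have "modes qs = modes rs \<or> W n (modes qs) < W n (modes rs)"
      using lead_GP[of rs] rs P' by (auto simp: lead_def)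
    then show False using modes_inj[of qs rs] mx[OF rs(1)] qs rs P' by auto
  qed
  then have "(\<Sum>rs\<in>P'. c rs * coef (XW rs vac) (modes qs)) = c qs * coef (XW qs vac) (modes qs)"
    using P' qs by (subst sum.remove[of _ qs]) auto
  moreover have "(\<Sum>rs\<in>P'. c rs * coef (XW rs vac) (modes qs)) = coef (\<Sum>ps\<in>P. scl (c ps) (XW ps vac)) (modes qs)"
    unfolding coef_sum coef_scl P'_def using assms(1) by (intro sum.mono_neutral_left) auto
  ultimately have "c qs * coef (XW qs vac) (modes qs) = 0" using assms(3) by simp
  then show False using lead_GP[of qs] qs P' by (auto simp: lead_def P'_def)
qed

end

section \<open>The Hermitian form\<close>

definition ip :: "fvec \<Rightarrow> fvec \<Rightarrow> complex" where
  "ip f g = (\<Sum>A | coef f A \<noteq> 0. coef f A * cnj (coef g A))"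

definition fsupp :: "fvec \<Rightarrow> bool" where
  "fsupp f \<longleftrightarrow> finite {A. coef f A \<noteq> 0}"

lemma ip_superset: "finite S \<Longrightarrow> {A. coef f A \<noteq> 0} \<subseteq> S \<Longrightarrow> ip f g = (\<Sum>A\<in>S. coef f A * cnj (coef g A))"
  unfolding ip_def by (rule sum.mono_neutral_left) auto

lemma ip_superset_right:
  assumes "finite S" "{A. coef g A \<noteq> 0} \<subseteq> S" "fsupp f"
  shows "ip f g = (\<Sum>A\<in>S. coef f A * cnj (coef g A))"
proof -
  have "ip f g = (\<Sum>A\<in>S \<union> {A. coef f A \<noteq> 0}. coef f A * cnj (coef g A))"
    using assms by (intro ip_superset) (auto simp: fsupp_def)
  also have "\<dots> = (\<Sum>A\<in>S. coef f A * cnj (coef g A))"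
    using assms by (intro sum.mono_neutral_right) (auto simp: fsupp_def)
  finally show ?thesis .
qed

lemma ip_commute: "fsupp f \<Longrightarrow> fsupp g \<Longrightarrow> ip f g = cnj (ip g f)"
  by (subst ip_superset_right[of "{A. coef g A \<noteq> 0}"]) (auto simp: fsupp_def ip_def mult.commute)

lemma ip_add_right: "ip f (g + h) = ip f g + ip f h"
  by (simp add: ip_def distrib_left sum.distrib)

lemma ip_scl_right: "ip f (scl c g) = cnj c * ip f g"
  by (simp add: ip_def sum_distrib_left mult_ac)

lemma ip_0_right [simp]: "ip f 0 = 0"
  by (simp add: ip_def)

lemma ip_0_left [simp]: "ip 0 f = 0"
  by (simp add: ip_def)

lemma ip_sum_right: "ip f (\<Sum>x\<in>S. g x) = (\<Sum>x\<in>S. ip f (g x))"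
  by (induction S rule: infinite_finite_induct) (auto simp: ip_add_right)

lemma ip_scl_left: "ip (scl c f) g = c * ip f g"
  by (cases "c = 0") (auto simp: ip_def sum_distrib_left mult_ac)

lemma ip_add_left:
  assumes "fsupp f" "fsupp g"
  shows "ip (f + g) h = ip f h + ip g h"
proof -
  let ?S = "{A. coef f A \<noteq> 0} \<union> {A. coef g A \<noteq> 0}"
  have "finite ?S" using assms by (simp add: fsupp_def)
  then show ?thesis
    by (subst (1 2 3) ip_superset[of ?S]) (auto simp: distrib_right sum.distrib)
qed

lemma ip_self: "fsupp f \<Longrightarrow> ip f f = 0 \<Longrightarrow> f = 0"
proof -
  assume f: "fsupp f" "ip f f = 0"
  have "ip f f = of_real (\<Sum>A | coef f A \<noteq> 0. (cmod (coef f A))\<^sup>2)"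
    unfolding ip_def of_real_sum complex_norm_square ..
  then have "(\<Sum>A | coef f A \<noteq> 0. (cmod (coef f A))\<^sup>2) = 0" using f by (metis of_real_eq_0_iff)
  then have "\<forall>A\<in>{A. coef f A \<noteq> 0}. (cmod (coef f A))\<^sup>2 = 0"
    using f by (subst (asm) sum_nonneg_eq_0_iff) (auto simp: fsupp_def)
  then show "f = 0" by (auto simp: fvec_eq_iff)
qed

lemma ip_vac: "fsupp f \<Longrightarrow> ip f vac = coef f {}"
  by (subst ip_superset_right[of "{{}}"]) (auto simp: vac_def)

lemma cnj_sg [simp]: "cnj (sg p A) = sg p A"
  by (simp add: sg_def)

lemma ip_cre:
  assumes "fsupp f"
  shows "ip (cre p f) g = ip f (ann p g)"
proof -
  have "ip (cre p f) g = (\<Sum>B | p \<in> B \<and> coef f (B - {p}) \<noteq> 0. sg p B * coef f (B - {p}) * cnj (coef g B))"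
    unfolding ip_def by (intro sum.cong) (auto simp: cre_def)
  also have "\<dots> = (\<Sum>A | coef f A \<noteq> 0 \<and> p \<notin> A. coef f A * cnj (sg p A * coef g (insert p A)))"
    by (rule sum.reindex_bij_witness[of _ "insert p" "\<lambda>B. B - {p}"])
      (auto simp: insert_absorb mult_ac insert_Diff_if)
  also have "\<dots> = ip f (ann p g)"
    unfolding ip_def using assms by (intro sum.mono_neutral_cong_left) (auto simp: ann_def fsupp_def)
  finally show ?thesis .
qed

context fock
begin

lemma fsupp_Fock: "f \<in> Fock \<Longrightarrow> fsupp f"
  using Fock_finite by (simp add: fsupp_def)

lemma cnj_sgnG [simp]: "cnj (sgnG p) = sgnG p"
  by (cases p; cases "snd p") (auto simp: sgnG_def)

lemma cnj_J [simp]: "cnj (J a) = J a"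
  by (cases a) auto

text \<open>Creation and annihilation of the same mode are adjoint by \<open>ip_cre\<close>; the
  sign is the one built into \<open>z\<close> for annihilating modes.\<close>

lemma ip_z:
  assumes "f \<in> Fock" "g \<in> Fock"
  shows "ip (z p f) g = sgnG p * ip f (z (dual p) g)"
proof (cases "cr p")
  case True
  then have "z (dual p) g = scl (sgnG p) (ann p g)" using cr_dual by (simp add: z_def)
  then show ?thesis using True ip_cre[OF fsupp_Fock[OF assms(1)], of p g] by (simp add: ip_scl_right z_def)
next
  case False
  then have c: "cr (dual p)" using cr_dual by simp
  have "z p f = scl (sgnG p) (ann (dual p) f)" using False by (simp add: z_def)
  moreover have "ann (dual p) f = scl (sgnG p) (z p f)" using False by (simp add: z_def)
  ultimately have fs: "fsupp (ann (dual p) f)" using fsupp_Fock[OF Fock.scl[OF Fock_z[OF assms(1)]]] by metis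
  have "ip (ann (dual p) f) g = cnj (ip g (ann (dual p) f))"
    using fs fsupp_Fock[OF assms(2)] by (rule ip_commute)
  also have "\<dots> = cnj (ip (cre (dual p) g) f)" by (simp add: ip_cre[OF fsupp_Fock[OF assms(2)]])
  also have "\<dots> = ip f (cre (dual p) g)"
  proof -
    have "fsupp (cre (dual p) g)" using fsupp_Fock[OF Fock_z[OF assms(2), of "dual p"]] c by (simp add: z_def)
    then show ?thesis using ip_commute[OF fsupp_Fock[OF assms(1)]] by simp
  qed
  finally show ?thesis using False c by (simp add: z_def ip_scl_left)
qed

text \<open>Taking adjoints reverses the two fermions, so the dual of the odd slot
  \<open>2 * m - 1 - 2 * k\<close> becomes the even slot \<open>2 * (k - m)\<close> in front. This
  is the summand \<open>k - m\<close> of the mode \<open>- m\<close>.\<close>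

lemma ip_T:
  assumes "f \<in> Fock" "g \<in> Fock"
  shows "ip (T a b m k f) g = - J a * J b * ip f (T (bar a) (bar b) (- m) (k - m) g)"
proof -
  have d: "dual (2 * k, c) = (- 1 - 2 * k, bar c)" "dual (2 * m - 1 - 2 * k, c) = (2 * (k - m), bar c)"
    "2 * - m - 1 - 2 * (k - m) = - 1 - 2 * k" for c
    by (auto simp: dual_def)
  have s: "sgnG (2 * k, c) = J c" "sgnG (2 * m - 1 - 2 * k, c) = - J c" for c
    by (auto simp: sgnG_def)
  have "ip (z (2 * k, c) (z (2 * m - 1 - 2 * k, c') f)) g
      = - J c * J c' * ip f (z (2 * (k - m), bar c') (z (- 1 - 2 * k, bar c) g))" for c c'
    by (simp add: ip_z assms Fock_z d s)
  then show ?thesis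
    unfolding T_def by (simp add: ip_add_left fsupp_Fock Fock_z assms ip_add_right d algebra_simps)
qed

lemma ip_sum_left: "(\<And>x. x \<in> S \<Longrightarrow> h x \<in> Fock) \<Longrightarrow> ip (\<Sum>x\<in>S. h x) g = (\<Sum>x\<in>S. ip (h x) g)"
  by (induction S rule: infinite_finite_induct) (auto simp: ip_add_left fsupp_Fock Fock_sum)

lemma ip_X:
  assumes "f \<in> Fock" "g \<in> Fock"
  shows "ip (X a b m f) g = - J a * J b * ip f (X (bar a) (bar b) (- m) g)"
proof -
  obtain K1 where "win m f K1" using win_exists[OF assms(1)] by blast
  note K1 = winD[OF this]
  obtain K2 where "win (- m) g K2" using win_exists[OF assms(2)] by blast
  note K2 = winD[OF this]
  define S where "S = {- K1..K1} \<union> {- K2 + m..K2 + m}"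
  define S' where "S' = (\<lambda>k. k - m) ` S"
  have "{- K2..K2} \<subseteq> S'"
  proof
    fix k assume "k \<in> {- K2..K2}"
    then show "k \<in> S'" unfolding S'_def by (intro image_eqI[of _ _ "k + m"]) (auto simp: S_def)
  qed
  then have S: "finite S" "{- K1..K1} \<subseteq> S" "finite S'" "{- K2..K2} \<subseteq> S'" by (auto simp: S_def S'_def)
  have "ip (X a b m f) g = (\<Sum>k\<in>S. ip (T a b m k f) g)"
    unfolding K1[OF S(1,2)] using assms by (intro ip_sum_left T_Fock)
  also have "\<dots> = (\<Sum>k\<in>S. - J a * J b * ip f (T (bar a) (bar b) (- m) (k - m) g))"
    by (simp add: ip_T assms)
  also have "\<dots> = (\<Sum>k\<in>S'. - J a * J b * ip f (T (bar a) (bar b) (- m) k g))"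
    unfolding S'_def by (subst sum.reindex) (auto simp: inj_on_def)
  also have "\<dots> = - J a * J b * ip f (X (bar a) (bar b) (- m) g)"
    unfolding K2[OF S(3,4)] by (simp add: ip_sum_right sum_distrib_left)
  finally show ?thesis .
qed

section \<open>Chevalley generators\<close>

text \<open>The root vector for \<open>\<alpha>\<^sub>j\<close> is a multiple of \<open>X (chA j) (chB j) (chM j)\<close>.\<close>

definition chA :: "nat \<Rightarrow> letter" where
  "chA j = (if j = 0 then Barred 1 else Plain j)"
definition chB :: "nat \<Rightarrow> letter" where
  "chB j = (if j = 0 then Barred 1 else if j = n then Plain n else Barred (j + 1))"
definition chM :: "nat \<Rightarrow> int" where
  "chM j = (if j = 0 then - 1 else 0)"
text \<open>For the long roots both letters coincide, and \<open>T a a\<close> contains the same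
  product twice.\<close>

definition chC :: "nat \<Rightarrow> complex" where
  "chC j = (if j = 0 \<or> j = n then 1 / 2 else 1)"

text \<open>Chosen to make \<open>F j\<close> adjoint to \<open>E j\<close>, see
  \<open>ip_E\<close>.\<close>

definition chD :: "nat \<Rightarrow> complex" where
  "chD j = - J (chA j) * J (chB j) * chC j"

definition E :: "nat \<Rightarrow> fvec \<Rightarrow> fvec" where
  "E j f = scl (chC j) (X (chA j) (chB j) (chM j) f)"
definition F :: "nat \<Rightarrow> fvec \<Rightarrow> fvec" where
  "F j f = scl (chD j) (X (bar (chA j)) (bar (chB j)) (- chM j) f)"

lemma ch_letters: "j \<le> n \<Longrightarrow> chA j \<in> letters n" "j \<le> n \<Longrightarrow> chB j \<in> letters n"
  using n_ge_2 by (auto simp: chA_def chB_def letters_def)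

lemma ch_neq: "chB j \<noteq> bar (chA j)"
  by (auto simp: chA_def chB_def)

lemma E_Fock: "f \<in> Fock \<Longrightarrow> E j f \<in> Fock"
  by (simp add: E_def Fock.scl X_Fock)
lemma F_Fock: "f \<in> Fock \<Longrightarrow> F j f \<in> Fock"
  by (simp add: F_def Fock.scl X_Fock)
lemma E_add: "f \<in> Fock \<Longrightarrow> g \<in> Fock \<Longrightarrow> E j (f + g) = E j f + E j g"
  by (simp add: E_def X_add FV.scale_right_distrib)
lemma F_add: "f \<in> Fock \<Longrightarrow> g \<in> Fock \<Longrightarrow> F j (f + g) = F j f + F j g"
  by (simp add: F_def X_add FV.scale_right_distrib)
lemma E_scl: "f \<in> Fock \<Longrightarrow> E j (scl c f) = scl c (E j f)"
  by (simp add: E_def X_scl mult.commute)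
lemma F_scl: "f \<in> Fock \<Longrightarrow> F j (scl c f) = scl c (F j f)"
  by (simp add: F_def X_scl mult.commute)

lemma E_uminus: "f \<in> Fock \<Longrightarrow> E j (- f) = - E j f"
  using E_scl[of f j "-1"] by simp
lemma F_uminus: "f \<in> Fock \<Longrightarrow> F j (- f) = - F j f"
  using F_scl[of f j "-1"] by simp
lemma E_diff: "f \<in> Fock \<Longrightarrow> g \<in> Fock \<Longrightarrow> E j (f - g) = E j f - E j g"
  by (simp add: E_def X_diff FV.scale_right_diff_distrib)
lemma F_diff: "f \<in> Fock \<Longrightarrow> g \<in> Fock \<Longrightarrow> F j (f - g) = F j f - F j g"
  by (simp add: F_def X_diff FV.scale_right_diff_distrib)

lemma ip_E: "f \<in> Fock \<Longrightarrow> g \<in> Fock \<Longrightarrow> ip (E j f) g = ip f (F j g)"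
proof -
  assume "f \<in> Fock" "g \<in> Fock"
  moreover have "cnj (chD j) = - J (chA j) * J (chB j) * chC j" by (simp add: chD_def chC_def)
  ultimately show ?thesis by (simp add: E_def F_def ip_scl_left ip_scl_right ip_X)
qed

lemma E_z: "f \<in> Fock \<Longrightarrow> E j (z (s, c) f) = z (s, c) (E j f) +
    (scl (chC j * jj c (chB j)) (z (s + 2 * chM j, chA j) f) + scl (chC j * jj c (chA j)) (z (s + 2 * chM j, chB j) f))"
  by (simp add: E_def X_z z_scl FV.scale_right_distrib)

lemma F_z: "f \<in> Fock \<Longrightarrow> F j (z (s, c) f) = z (s, c) (F j f) +
    (scl (chD j * jj c (bar (chB j))) (z (s - 2 * chM j, bar (chA j)) f)
    + scl (chD j * jj c (bar (chA j))) (z (s - 2 * chM j, bar (chB j)) f))"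
  by (simp add: F_def X_z z_scl FV.scale_right_distrib)

text \<open>The pairing of the coroot \<open>h\<^sub>j\<close> with the weight of the letter \<open>c\<close>.\<close>

definition hw :: "nat \<Rightarrow> letter \<Rightarrow> complex" where
  "hw j c = (if chA j = chB j then of_bool (c = chA j) - of_bool (c = bar (chA j))
     else of_bool (c = chA j) + of_bool (c = chB j) - of_bool (c = bar (chA j)) - of_bool (c = bar (chB j)))"

text \<open>The commutator of \<open>E j\<close> and \<open>F j\<close> scales each fermion by
  \<open>hw j c\<close>, like the coroot. An additive constant is invisible here; it is found on the
  vacuum in \<open>EF_vac\<close>.\<close>

lemma EF_z_same:
  assumes f: "f \<in> Fock"
  shows "E j (F j (z (s, c) f)) - F j (E j (z (s, c) f))
    = z (s, c) (E j (F j f) - F j (E j f)) + scl (hw j c) (z (s, c) f)"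
proof (cases "chA j = chB j")
  case True
  define a where "a = chA j"
  have ab: "chA j = a" "chB j = a" using True by (simp_all add: a_def)
  have C: "chC j = 1 / 2" "chD j = - 1 / 2"
    using True by (auto simp: chA_def chB_def chC_def chD_def split: if_splits)
  have Ez: "E j (z (s, c) g) = z (s, c) (E j g) + scl (if c = bar a then - J a else 0) (z (s + 2 * chM j, a) g)"
    if "g \<in> Fock" for g s c
    using that by (auto simp: E_z ab C jj_def fvec_eq_iff)
  have Fz: "F j (z (s, c) g) = z (s, c) (F j g) + scl (if c = a then - J a else 0) (z (s - 2 * chM j, bar a) g)"
    if "g \<in> Fock" for g s c
    using that by (auto simp: F_z ab C jj_def fvec_eq_iff)
  note simps = Ez Fz E_add F_add E_scl F_scl E_uminus F_uminus E_diff F_diff Fock_z Fock.scl Fock.add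
    E_Fock F_Fock f z_add z_scl z_diff z_uminus hw_def ab
    FV.scale_right_distrib FV.scale_right_diff_distrib
  consider "c = a" | "c = bar a" | "c \<noteq> a" "c \<noteq> bar a" by blast
  then show ?thesis by cases (simp_all add: simps)
next
  case False
  define a b where "a = chA j" and "b = chB j"
  have ab: "chA j = a" "chB j = b" "a \<noteq> b" "b \<noteq> bar a" "a \<noteq> bar b" using False ch_neq[of j] by (auto simp: a_def b_def)
  have JJ: "J b = - J a" using False by (auto simp: a_def b_def chA_def chB_def split: if_splits)
  have C: "chC j = 1" "chD j = 1"
    using False by (auto simp: chA_def chB_def chC_def chD_def split: if_splits)
  have Ez: "E j (z (s, c) g) = z (s, c) (E j g) + scl (if c = bar b then J a else 0) (z (s + 2 * chM j, a) g)
      + scl (if c = bar a then - J a else 0) (z (s + 2 * chM j, b) g)"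
    if "g \<in> Fock" for g s c
    using that JJ by (auto simp: E_z ab C jj_def fvec_eq_iff)
  have Fz: "F j (z (s, c) g) = z (s, c) (F j g) + scl (if c = b then - J a else 0) (z (s - 2 * chM j, bar a) g)
      + scl (if c = a then J a else 0) (z (s - 2 * chM j, bar b) g)"
    if "g \<in> Fock" for g s c
    using that JJ by (auto simp: F_z ab C jj_def fvec_eq_iff)
  note simps = Ez Fz E_add F_add E_scl F_scl E_uminus F_uminus E_diff F_diff Fock_z Fock.scl Fock.add
    E_Fock F_Fock f z_add z_scl z_diff z_uminus hw_def ab
    FV.scale_right_distrib FV.scale_right_diff_distrib
  have nb: "bar a \<noteq> b" "bar b \<noteq> a" using ab by auto
  consider "c = a" | "c = b" | "c = bar a" | "c = bar b" | "c \<noteq> a" "c \<noteq> b" "c \<noteq> bar a" "c \<noteq> bar b" by blast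
  then show ?thesis by cases (simp_all add: simps nb ab(3,4,5)[symmetric])
qed

lemma ch_disjoint: "j \<noteq> k \<Longrightarrow> j \<le> n \<Longrightarrow> k \<le> n \<Longrightarrow> {chA j, chB j} \<inter> {chA k, chB k} = {}"
  by (auto simp: chA_def chB_def)

text \<open>Different simple roots use disjoint letters by \<open>ch_disjoint\<close>, so all
  contractions between the letters of \<open>E j\<close> and those of \<open>F k\<close>
  vanish.\<close>

lemma EF_z_diff:
  assumes f: "f \<in> Fock" and jk: "j \<noteq> k" "j \<le> n" "k \<le> n"
  shows "E j (F k (z (s, c) f)) - F k (E j (z (s, c) f)) = z (s, c) (E j (F k f) - F k (E j f))"
proof -
  define a b a' b' where d: "a = chA j" "b = chB j" "a' = chA k" "b' = chB k"
  have ne: "a \<noteq> a'" "a \<noteq> b'" "b \<noteq> a'" "b \<noteq> b'" using ch_disjoint[OF jk] by (auto simp: d)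
  have jz: "jj (bar a') a = 0" "jj (bar a') b = 0" "jj (bar b') a = 0" "jj (bar b') b = 0"
    "jj a (bar a') = 0" "jj a (bar b') = 0" "jj b (bar a') = 0" "jj b (bar b') = 0"
    using ne by (auto simp: jj_def)
  note simps = E_z F_z E_add F_add E_scl F_scl Fock_z Fock.scl Fock.add E_Fock F_Fock f z_add z_scl z_diff
  show ?thesis by (simp add: simps jz flip: d)
qed


section \<open>Diagonal operators, representing the Cartan subalgebra\<close>

definition dual_odd :: "(mode \<Rightarrow> complex) \<Rightarrow> bool" where
  "dual_odd \<omega> \<longleftrightarrow> (\<forall>p. \<omega> (dual p) = - \<omega> p)"

definition Dg :: "complex \<Rightarrow> (mode \<Rightarrow> complex) \<Rightarrow> fvec \<Rightarrow> fvec" where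
  "Dg \<nu> \<omega> f = Vec (\<lambda>A. (\<nu> + (\<Sum>p\<in>A. \<omega> p)) * coef f A)"

lemma coef_Dg [simp]: "coef (Dg \<nu> \<omega> f) A = (\<nu> + (\<Sum>p\<in>A. \<omega> p)) * coef f A"
  by (simp add: Dg_def)

lemma Dg_add: "Dg \<nu> \<omega> (f + g) = Dg \<nu> \<omega> f + Dg \<nu> \<omega> g"
  by (simp add: fvec_eq_iff distrib_left)
lemma Dg_scl: "Dg \<nu> \<omega> (scl c f) = scl c (Dg \<nu> \<omega> f)"
  by (simp add: fvec_eq_iff)
lemma Dg_0 [simp]: "Dg \<nu> \<omega> 0 = 0"
  by (simp add: fvec_eq_iff)
lemma Dg_sum: "Dg \<nu> \<omega> (\<Sum>x\<in>S. g x) = (\<Sum>x\<in>S. Dg \<nu> \<omega> (g x))"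
  by (induction S rule: infinite_finite_induct) (auto simp: Dg_add)
lemma Dg_vac: "Dg \<nu> \<omega> vac = scl \<nu> vac"
  by (auto simp: fvec_eq_iff vac_def)

text \<open>Removing \<open>dual p\<close> changes the eigenvalue by
  \<open>- \<omega> (dual p) = \<omega> p\<close>, so oddness gives creating and annihilating modes
  the same rule.\<close>

lemma Dg_z:
  assumes "f \<in> Fock" and d: "dual_odd \<omega>"
  shows "Dg \<nu> \<omega> (z p f) = z p (Dg \<nu> \<omega> f) + scl (\<omega> p) (z p f)"
proof -
  have fin: "coef f A \<noteq> 0 \<Longrightarrow> finite A" for A using Fock_finite[OF assms(1)] by blast
  show ?thesis
  proof (cases "cr p")
    case True
    have "coef (Dg \<nu> \<omega> (z p f)) A = coef (z p (Dg \<nu> \<omega> f) + scl (\<omega> p) (z p f)) A" for A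
    proof (cases "p \<in> A \<and> coef f (A - {p}) \<noteq> 0")
      case True
      then have "finite A" using fin by (metis finite_Diff2 finite.emptyI finite.insertI)
      then have "(\<Sum>q\<in>A. \<omega> q) = \<omega> p + (\<Sum>q\<in>A - {p}. \<omega> q)" using True by (simp add: sum.remove)
      then show ?thesis using True \<open>cr p\<close> by (simp add: z_def cre_def algebra_simps)
    next
      case False
      then show ?thesis using \<open>cr p\<close> by (auto simp: z_def cre_def)
    qed
    then show ?thesis by (simp add: fvec_eq_iff)
  next
    case False
    have "coef (Dg \<nu> \<omega> (z p f)) A = coef (z p (Dg \<nu> \<omega> f) + scl (\<omega> p) (z p f)) A" for A
    proof (cases "dual p \<notin> A \<and> coef f (insert (dual p) A) \<noteq> 0")
      case True
      then have "finite A" using fin by (metis finite_insert)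
      then have e: "(\<Sum>q\<in>A. \<omega> q) = \<omega> p + (\<Sum>q\<in>insert (dual p) A. \<omega> q)"
        using True d[unfolded dual_odd_def, THEN spec, of p] by simp
      show ?thesis using True \<open>\<not> cr p\<close> by (simp add: z_def ann_def e algebra_simps)
    next
      case False
      then show ?thesis using \<open>\<not> cr p\<close> by (auto simp: z_def ann_def)
    qed
    then show ?thesis by (simp add: fvec_eq_iff)
  qed
qed

lemma Dg_Fock:
  assumes "f \<in> Fock" and d: "dual_odd \<omega>"
  shows "Dg \<nu> \<omega> f \<in> Fock"
  using assms(1)
  by (induction rule: Fock.induct)
    (auto simp: Dg_vac Dg_add Dg_scl Dg_z[OF _ d] intro!: Fock.add Fock.scl Fock.vac Fock_z)

lemma X_Dg:
  assumes f: "f \<in> Fock" and d: "dual_odd \<omega>"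
    and \<kappa>: "\<And>k. \<omega> (2 * k, a) + \<omega> (2 * m - 1 - 2 * k, b) = \<kappa>" "\<And>k. \<omega> (2 * k, b) + \<omega> (2 * m - 1 - 2 * k, a) = \<kappa>"
  shows "Dg \<nu> \<omega> (X a b m f) = X a b m (Dg \<nu> \<omega> f) + scl \<kappa> (X a b m f)"
proof -
  obtain K1 where "win m f K1" using win_exists[OF f] by blast
  note K1 = winD[OF this]
  obtain K2 where "win m (Dg \<nu> \<omega> f) K2" using win_exists[OF Dg_Fock[OF f d]] by blast
  note K2 = winD[OF this]
  define S where "S = {- K1..K1} \<union> {- K2..K2}"
  have S: "finite S" "{- K1..K1} \<subseteq> S" "{- K2..K2} \<subseteq> S" by (auto simp: S_def)
  have zz: "Dg \<nu> \<omega> (z p (z q f)) = z p (z q (Dg \<nu> \<omega> f)) + scl (\<omega> p + \<omega> q) (z p (z q f))" for p q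
    by (simp add: Dg_z[OF _ d] Fock_z f z_add z_scl FV.scale_left_distrib)
  have "Dg \<nu> \<omega> (T a b m k f) = T a b m k (Dg \<nu> \<omega> f) + scl \<kappa> (T a b m k f)" for k
    unfolding T_def Dg_add zz \<kappa> by (simp add: FV.scale_right_distrib)
  then show ?thesis
    unfolding K1[OF S(1,2)] K2[OF S(1,3)] Dg_sum by (simp add: sum.distrib FV.scale_sum_right)
qed

section \<open>The Chevalley generators on the vacuum and their commutators\<close>

lemma T_vac_neq:
  assumes "y \<noteq> bar x" "\<not> (cr (2 * k, x) \<and> cr (2 * m - 1 - 2 * k, y))" "\<not> (cr (2 * k, y) \<and> cr (2 * m - 1 - 2 * k, x))"
  shows "T x y m k vac = 0"
proof -
  have zz: "z p (z q vac) = 0" if "\<not> (cr p \<and> cr q)" "q \<noteq> dual p" for p q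
    using that z_vac[of p] z_vac[of q] by (cases "cr q") (auto simp: z_swap[of p q])
  have "x \<noteq> bar y" using assms(1) by auto
  then show ?thesis using assms by (simp add: T_def zz dual_def)
qed

lemma X_vac_zero:
  assumes "y \<noteq> bar x" "\<not> valid (m, min x y, max x y)"
  shows "X x y m vac = 0"
proof -
  have "T x y m k vac = 0" for k
    using creation_pair_valid[of "2 * k" x "2 * m - 1 - 2 * k" y m "min x y" "max x y"]
      creation_pair_valid[of "2 * k" y "2 * m - 1 - 2 * k" x m "min x y" "max x y"] assms
    by (intro T_vac_neq) (auto simp: min.commute max.commute)
  then show ?thesis by (simp add: X_def)
qed

lemma E_vac: "j \<le> n \<Longrightarrow> E j vac = 0"
  using ch_neq[of j] by (simp add: E_def X_vac_zero valid_iff chA_def chB_def chM_def less_letter_def min_def max_def)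

lemma F_vac:
  assumes "j \<le> n" "j \<noteq> i"
  shows "F j vac = 0"
proof -
  have "X (bar (chA j)) (bar (chB j)) (- chM j) vac = 0"
  proof (rule X_vac_zero)
    show "bar (chB j) \<noteq> bar (bar (chA j))" using ch_neq[of j] by (metis bar_bar)
    consider "j = 0" | "j = n" "j \<noteq> 0" | "j \<noteq> 0" "j \<noteq> n" by blast
    then show "\<not> valid (- chM j, min (bar (chA j)) (bar (chB j)), max (bar (chA j)) (bar (chB j)))"
    proof cases
      case 1
      then show ?thesis using assms by (simp add: valid_iff chA_def chB_def chM_def less_letter_def)
    next
      case 2
      then show ?thesis using assms i_le by (simp add: valid_iff chA_def chB_def chM_def less_letter_def)
    next
      case 3
      then have "chA j = Plain j" "chB j = Barred (j + 1)" "chM j = 0" by (simp_all add: chA_def chB_def chM_def)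
      then show ?thesis using assms by (auto simp: valid_iff less_letter_def min_def max_def)
    qed
  qed
  then show ?thesis by (simp add: F_def)
qed

lemma X_single: "(\<And>k. k \<noteq> k0 \<Longrightarrow> T a b m k f = 0) \<Longrightarrow> X a b m f = T a b m k0 f"
proof -
  assume "\<And>k. k \<noteq> k0 \<Longrightarrow> T a b m k f = 0"
  then have "{k. T a b m k f \<noteq> 0} \<subseteq> {k0}" by auto
  then have "X a b m f = (\<Sum>k\<in>{k0}. T a b m k f)" unfolding X_def by (intro sum.mono_neutral_left) auto
  then show ?thesis by simp
qed

lemma ip_z_cr: "cr p \<Longrightarrow> g \<in> Fock \<Longrightarrow> z (dual p) g = 0 \<Longrightarrow> ip (z p g) (z p g) = ip g g"
  by (simp add: ip_z Fock_z z_swap[of "dual p" p] ip_scl_right)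

lemma ip_zz_vac:
  assumes "cr p" "cr q" "p \<noteq> q"
  shows "ip (z p (z q vac)) (z p (z q vac)) = 1"
proof -
  have d: "z (dual p) vac = 0" "z (dual q) vac = 0" using assms cr_dual z_vac by auto
  have "z (dual p) (z q vac) = 0" using assms(3) d by (simp add: z_swap[of "dual p" q])
  then have "ip (z p (z q vac)) (z p (z q vac)) = ip (z q vac) (z q vac)"
    using assms by (intro ip_z_cr Fock_z Fock.vac)
  also have "\<dots> = ip vac vac" using assms d by (intro ip_z_cr Fock.vac)
  also have "\<dots> = 1" using ip_vac[OF fsupp_Fock[OF Fock.vac]] by (simp add: vac_def)
  finally show ?thesis .
qed

text \<open>In the root vector exactly one product of two creating modes survives on the vacuum. The
  result is a unit vector up to a phase, and its norm becomes the value 1 of the weight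
  \<open>\<Lambda>\<^sub>i\<close> on the coroot \<open>h\<^sub>i\<close>.\<close>

lemma F_i_vac: "\<exists>p q c. cr p \<and> cr q \<and> p \<noteq> q \<and> c * cnj c = 1 \<and> F i vac = scl c (z p (z q vac))"
proof -
  consider "i = 0" | "i = n" "i \<noteq> 0" | "0 < i" "i < n" using i_le by linarith
  then show ?thesis
  proof cases
    case 1
    have nc: "\<not> (cr (2 * k, Plain 1) \<and> cr (2 * 1 - 1 - 2 * k, Plain 1))" if "k \<noteq> 0" for k
      unfolding cr_def using that by auto
    have "X (Plain 1) (Plain 1) 1 vac = T (Plain 1) (Plain 1) 1 0 vac"
      by (intro X_single T_vac_neq nc) simp
    moreover have "chA i = Barred 1" "chB i = Barred 1" "chM i = - 1" "chD i = - 1 / 2"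
      unfolding chD_def chC_def chA_def chB_def chM_def using 1 by simp_all
    ultimately have "F i vac = scl (- 1) (z (0, Plain 1) (z (1, Plain 1) vac))"
      by (simp add: F_def T_def fvec_eq_iff)
    moreover have "cr (0, Plain 1)" "cr (1, Plain 1)" unfolding cr_def using 1 by (auto simp: less_letter_def)
    ultimately show ?thesis
      by (intro exI[of _ "(0, Plain 1)"] exI[of _ "(1, Plain 1)"] exI[of _ "- 1"] conjI) simp_all
  next
    case 2
    have nc: "\<not> (cr (2 * k, Barred n) \<and> cr (2 * 0 - 1 - 2 * k, Barred n))" if "k \<noteq> 0" for k
      unfolding cr_def using that by auto
    have "X (Barred n) (Barred n) 0 vac = T (Barred n) (Barred n) 0 0 vac"
      by (intro X_single T_vac_neq nc) simp
    moreover have "chA i = Plain n" "chB i = Plain n" "chM i = 0" "chD i = - 1 / 2"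
      unfolding chD_def chC_def chA_def chB_def chM_def using 2 by simp_all
    ultimately have "F i vac = scl (- 1) (z (0, Barred n) (z (- 1, Barred n) vac))"
      by (simp add: F_def T_def fvec_eq_iff)
    moreover have "cr (0, Barred n)" "cr (- 1, Barred n)" unfolding cr_def using 2 by (auto simp: less_letter_def)
    ultimately show ?thesis
      by (intro exI[of _ "(0, Barred n)"] exI[of _ "(- 1, Barred n)"] exI[of _ "- 1"] conjI) simp_all
  next
    case 3
    have nc: "\<not> (cr (2 * k, a) \<and> cr (2 * 0 - 1 - 2 * k, b))" if "k \<noteq> 0" for k a b
      unfolding cr_def using that by auto
    have "X (Barred i) (Plain (i + 1)) 0 vac = T (Barred i) (Plain (i + 1)) 0 0 vac"
      by (intro X_single T_vac_neq nc) simp_all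
    moreover have "z (- 1, Plain (i + 1)) vac = 0" by (rule z_vac) (simp add: cr_def)
    ultimately have "F i vac = scl 1 (z (0, Plain (i + 1)) (z (- 1, Barred i) vac))"
      using 3 by (simp add: F_def chA_def chB_def chM_def chD_def chC_def T_def)
    moreover have "cr (0, Plain (i + 1))" "cr (- 1, Barred i)" unfolding cr_def using 3 by (auto simp: less_letter_def)
    ultimately show ?thesis
      by (intro exI[of _ "(0, Plain (i + 1))"] exI[of _ "(- 1, Barred i)"] exI[of _ 1] conjI) simp_all
  qed
qed

lemma ip_F_i_vac: "ip (F i vac) (F i vac) = 1"
proof -
  obtain p q c where *: "cr p" "cr q" "p \<noteq> q" "c * cnj c = 1" "F i vac = scl c (z p (z q vac))"
    using F_i_vac by blast
  then show ?thesis unfolding *(5) ip_scl_left ip_scl_right by (simp add: ip_zz_vac mult.commute)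
qed

text \<open>Every annihilating mode passes \<open>E j\<close> and \<open>F k\<close> and kills the
  vacuum, so the vector is a multiple of the vacuum by \<open>Fock_killed\<close>. The factor is
  \<open>ip (F k vac) (F j vac)\<close>: the highest weight is read off from inner products instead
  of from the central term of \<open>X_comm\<close>.\<close>

lemma EF_vac:
  assumes "j \<le> n" "k \<le> n"
  shows "E j (F k vac) = scl (of_bool (j = k \<and> k = i)) vac"
proof -
  have Ek: "E j vac = 0" "E k vac = 0" using E_vac assms by simp_all
  have F0: "F k 0 = 0" for k by (simp add: F_def)
  have E0: "E j 0 = 0" for j by (simp add: E_def)
  have "z p (E j (F k vac)) = 0" if "\<not> cr p" for p
  proof -
    obtain s c where p: "p = (s, c)" by (cases p)
    have zv: "z (s, c) vac = 0" using z_vac[OF that] p by simp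
    show ?thesis
    proof (cases "j = k")
      case True
      show ?thesis using EF_z_same[OF Fock.vac, of j s c] True by (simp add: p zv Ek F0 E0)
    next
      case False
      show ?thesis using EF_z_diff[OF Fock.vac False assms, of s c] by (simp add: p zv Ek F0 E0)
    qed
  qed
  then have "E j (F k vac) = scl (coef (E j (F k vac)) {}) vac"
    by (intro Fock_killed E_Fock F_Fock Fock.vac)
  moreover have "coef (E j (F k vac)) {} = ip (E j (F k vac)) vac"
    by (simp add: ip_vac fsupp_Fock E_Fock F_Fock Fock.vac)
  moreover have "\<dots> = ip (F k vac) (F j vac)" by (simp add: ip_E F_Fock Fock.vac)
  moreover have "\<dots> = of_bool (j = k \<and> k = i)"
    using F_vac[of j] F_vac[of k] assms ip_F_i_vac by (cases "j = i"; cases "k = i") auto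
  ultimately show ?thesis by simp
qed

text \<open>Both operators agree on the vacuum and have the same commutator with every
  \<open>z p\<close>, so induction over \<open>Fock\<close> applies.\<close>

lemma EF_comm_same:
  assumes "f \<in> Fock" "j \<le> n"
  shows "E j (F j f) = F j (E j f) + Dg (of_bool (j = i)) (\<lambda>p. hw j (snd p)) f"
proof -
  have fl: "bar a = b \<longleftrightarrow> a = bar b" for a b by auto
  have d: "dual_odd (\<lambda>p. hw j (snd p))"
    by (simp add: dual_odd_def hw_def dual_def fl)
  have F0: "F j 0 = 0" by (simp add: F_def)
  have "E j (F j f) - F j (E j f) = Dg (of_bool (j = i)) (\<lambda>p. hw j (snd p)) f"
    using assms(1)
  proof (induction rule: Fock.induct)
    case vac
    then show ?case using assms EF_vac[of j j] E_vac[of j] F0 by (simp add: Dg_vac)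
  next
    case (add f g)
    then show ?case by (simp add: E_add F_add E_Fock F_Fock Dg_add algebra_simps)
  next
    case (scl f c)
    then show ?case by (simp add: E_scl F_scl E_Fock F_Fock Dg_scl flip: FV.scale_right_diff_distrib)
  next
    case (cre f p)
    obtain s c where p: "p = (s, c)" by (cases p)
    show ?case using cre EF_z_same[of f j s c] Dg_z[OF _ d, of f _ p] by (simp add: p)
  qed
  then show ?thesis by (simp add: algebra_simps)
qed

lemma EF_comm_diff:
  assumes "f \<in> Fock" "j \<le> n" "k \<le> n" "j \<noteq> k"
  shows "E j (F k f) = F k (E j f)"
proof -
  have F0: "F k 0 = 0" by (simp add: F_def)
  have "E j (F k f) - F k (E j f) = 0"
    using assms(1)
  proof (induction rule: Fock.induct)
    case vac
    then show ?case using assms EF_vac[of j k] E_vac[of j] F0 by simp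
  next
    case (add f g)
    then show ?case by (simp add: E_add F_add E_Fock F_Fock algebra_simps)
  next
    case (scl f c)
    then show ?case by (simp add: E_scl F_scl E_Fock F_Fock flip: FV.scale_right_diff_distrib)
  next
    case (cre f p)
    obtain s c where p: "p = (s, c)" by (cases p)
    show ?case using cre EF_z_diff[of f j k s c] assms by (simp add: p)
  qed
  then show ?thesis by simp
qed

end

lemma scl_double: "scl (2 * c) g = scl c g + scl c g" "scl (4 * c) g = scl c g + scl c g + scl c g + scl c g"
  by (auto simp: fvec_eq_iff)

context fock
begin

text \<open>Here \<open>u\<close> gives the weights of the letters and \<open>v\<close> the value of
  \<open>\<delta>\<close>. Slots \<open>2 * k\<close> and \<open>2 * k - 1\<close> both have degree
  \<open>k\<close>, so every summand of \<open>X a b m\<close> has degree \<open>m\<close>.\<close>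

definition Om :: "(letter \<Rightarrow> complex) \<Rightarrow> complex \<Rightarrow> mode \<Rightarrow> complex" where
  "Om u v p = u (snd p) - v * of_int ((fst p + 1) div 2)"

definition odd_wt :: "(letter \<Rightarrow> complex) \<Rightarrow> bool" where
  "odd_wt u \<longleftrightarrow> (\<forall>c. u (bar c) = - u c)"

lemma Om_dual: "odd_wt u \<Longrightarrow> dual_odd (Om u v)"
proof -
  assume u: "odd_wt u"
  have "(- 1 - s + 1) div 2 = - ((s + 1) div 2)" for s :: int by presburger
  then show ?thesis using u by (auto simp: dual_odd_def Om_def dual_def odd_wt_def)
qed

lemma X_Om:
  assumes "f \<in> Fock" "odd_wt u"
  shows "Dg \<nu> (Om u v) (X a b m f) = X a b m (Dg \<nu> (Om u v) f) + scl (u a + u b - v * of_int m) (X a b m f)"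
proof (rule X_Dg[OF assms(1) Om_dual[OF assms(2)]])
  fix k
  have e: "(2 * m - 1 - 2 * k + 1) div 2 = m - k" "(2 * k + 1) div 2 = k" by presburger+
  show "Om u v (2 * k, a) + Om u v (2 * m - 1 - 2 * k, b) = u a + u b - v * of_int m"
    "Om u v (2 * k, b) + Om u v (2 * m - 1 - 2 * k, a) = u a + u b - v * of_int m"
    by (simp_all add: Om_def e algebra_simps)
qed

definition rt :: "(letter \<Rightarrow> complex) \<Rightarrow> complex \<Rightarrow> nat \<Rightarrow> complex" where
  "rt u v k = u (chA k) + u (chB k) - v * of_int (chM k)"

lemma F_Om:
  assumes "f \<in> Fock" "odd_wt u"
  shows "Dg \<nu> (Om u v) (F k f) = F k (Dg \<nu> (Om u v) f) + scl (- rt u v k) (F k f)"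
proof -
  have e: "u (bar (chA k)) + u (bar (chB k)) - v * of_int (- chM k) = - rt u v k"
    using assms(2) by (simp add: odd_wt_def rt_def)
  show ?thesis
    unfolding F_def Dg_scl X_Om[OF assms] e FV.scale_right_distrib by (simp add: mult.commute)
qed

section \<open>Words in the lowering operators and their weights\<close>

definition wF :: "nat list \<Rightarrow> fvec" where
  "wF I = foldr F I vac"

lemma wF_simps [simp]: "wF [] = vac" "wF (k # I) = F k (wF I)"
  by (simp_all add: wF_def)

lemma wF_Fock: "wF I \<in> Fock"
  by (induction I) (auto simp: F_Fock Fock.vac)

lemma wF_Om: "odd_wt u \<Longrightarrow> Dg \<nu> (Om u v) (wF I) = scl (\<nu> - (\<Sum>k\<leftarrow>I. rt u v k)) (wF I)"
proof (induction I)
  case Nil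
  then show ?case by (simp add: Dg_vac)
next
  case (Cons k I)
  have "Dg \<nu> (Om u v) (wF (k # I)) = F k (scl (\<nu> - (\<Sum>k\<leftarrow>I. rt u v k)) (wF I)) + scl (- rt u v k) (F k (wF I))"
    using Cons by (simp add: F_Om wF_Fock)
  also have "\<dots> = scl ((\<nu> - (\<Sum>k\<leftarrow>I. rt u v k)) + (- rt u v k)) (F k (wF I))"
    by (simp only: F_scl[OF wF_Fock] FV.scale_left_distrib)
  finally show ?case by (simp add: algebra_simps)
qed

lemma XW_Om:
  "odd_wt u \<Longrightarrow> Dg \<nu> (Om u v) (XW ps vac) = scl (\<nu> + (\<Sum>(m, x, y)\<leftarrow>ps. u x + u y - v * of_int m)) (XW ps vac)"
proof (induction ps)
  case Nil
  then show ?case by (simp add: Dg_vac)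
next
  case (Cons p ps)
  obtain m x y where p: "p = (m, x, y)" by (cases p)
  define e where "e = \<nu> + (\<Sum>(m, x, y)\<leftarrow>ps. u x + u y - v * of_int m)"
  have "Dg \<nu> (Om u v) (XW (p # ps) vac) = X x y m (scl e (XW ps vac)) + scl (u x + u y - v * of_int m) (X x y m (XW ps vac))"
    unfolding p XW_simps pX.simps X_Om[OF XW_Fock[OF Fock.vac] Cons.prems] Cons.IH[OF Cons.prems] e_def ..
  also have "\<dots> = scl (e + (u x + u y - v * of_int m)) (X x y m (XW ps vac))"
    by (simp only: X_scl[OF XW_Fock[OF Fock.vac]] FV.scale_left_distrib)
  finally show ?case by (simp add: p e_def algebra_simps)
qed

lemma hw_Om: "(\<lambda>p. hw j (snd p)) = Om (hw j) 0"
  by (auto simp: Om_def)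

lemma hw_odd: "odd_wt (hw j)"
proof -
  have fl: "bar a = b \<longleftrightarrow> a = bar b" for a b by auto
  show ?thesis by (simp add: odd_wt_def hw_def fl)
qed

text \<open>The copy of the irreducible module in the Fock space. Lowering words suffice: stability
  under \<open>E j\<close> follows by commuting it to the vacuum.\<close>

definition Vs :: "fvec set" where
  "Vs = FV.span {wF I |I. set I \<subseteq> {..n}}"

lemma Vs_subspace: "FV.subspace Vs"
  by (simp add: Vs_def)

lemma Vs_Fock: "Vs \<subseteq> Fock"
  unfolding Vs_def by (rule FV.span_minimal[OF _ Fock_subspace]) (auto simp: wF_Fock)

lemma wF_Vs: "set I \<subseteq> {..n} \<Longrightarrow> wF I \<in> Vs"
  unfolding Vs_def by (rule FV.span_base) blast

lemma Vs_closed: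
  assumes add: "\<And>f g. f \<in> Fock \<Longrightarrow> g \<in> Fock \<Longrightarrow> L (f + g) = L f + L g"
    and scl: "\<And>c f. f \<in> Fock \<Longrightarrow> L (scl c f) = scl c (L f)"
    and base: "\<And>I. set I \<subseteq> {..n} \<Longrightarrow> L (wF I) \<in> Vs" and f: "f \<in> Vs"
  shows "L f \<in> Vs"
proof -
  have L0: "L 0 = 0" using scl[OF Fock_0, of 0] by simp
  have "Vs \<subseteq> {f \<in> Fock. L f \<in> Vs}"
    unfolding Vs_def[of]
  proof (rule FV.span_minimal)
    show "{wF I |I. set I \<subseteq> {..n}} \<subseteq> {f \<in> Fock. L f \<in> FV.span {wF I |I. set I \<subseteq> {..n}}}"
      using base wF_Fock unfolding Vs_def by blast
    show "FV.subspace {f \<in> Fock. L f \<in> FV.span {wF I |I. set I \<subseteq> {..n}}}"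
      unfolding FV.subspace_def by (auto simp: L0 add scl Fock.add Fock.scl FV.span_zero FV.span_add FV.span_scale)
  qed
  then show ?thesis using f by blast
qed

lemma F_Vs:
  assumes "k \<le> n" "f \<in> Vs"
  shows "F k f \<in> Vs"
proof (rule Vs_closed[OF _ _ _ assms(2)])
  show "F k (wF I) \<in> Vs" if "set I \<subseteq> {..n}" for I using wF_Vs[of "k # I"] that assms by simp
qed (auto simp: F_add F_scl)

lemma E_wF: "j \<le> n \<Longrightarrow> set I \<subseteq> {..n} \<Longrightarrow> E j (wF I) \<in> Vs"
proof (induction I)
  case Nil
  then show ?case using E_vac FV.subspace_0[OF Vs_subspace] by simp
next
  case (Cons k I)
  have "F k (E j (wF I)) \<in> Vs" using Cons by (intro F_Vs) auto
  moreover have "scl c (wF I) \<in> Vs" for c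
    using Cons by (intro FV.subspace_scale[OF Vs_subspace] wF_Vs) auto
  ultimately show ?case
    using Cons.prems FV.subspace_add[OF Vs_subspace]
    by (cases "j = k") (auto simp: EF_comm_same EF_comm_diff wF_Fock hw_Om wF_Om[OF hw_odd])
qed

lemma E_Vs: "j \<le> n \<Longrightarrow> f \<in> Vs \<Longrightarrow> E j f \<in> Vs"
  by (rule Vs_closed) (auto simp: E_add E_scl E_wF)

text \<open>The goal is \<open>Good_all\<close>: the Chevalley generators produce every current
  mode. By \<open>Good_comm\<close>, commutators of good modes are again good, since the unknown
  central term is a multiple of the vector itself.\<close>

definition Good :: "letter \<Rightarrow> letter \<Rightarrow> int \<Rightarrow> bool" where
  "Good a b m \<longleftrightarrow> (\<forall>f\<in>Vs. X a b m f \<in> Vs)"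

lemma Good_sym: "Good a b m \<Longrightarrow> Good b a m"
  by (simp add: Good_def X_commute)

lemma Vs_cancel: "scl c g + h \<in> Vs \<Longrightarrow> h \<in> Vs \<Longrightarrow> c \<noteq> 0 \<Longrightarrow> g \<in> Vs"
proof -
  assume "scl c g + h \<in> Vs" "h \<in> Vs" "c \<noteq> 0"
  then have "scl c g \<in> Vs" using FV.subspace_diff[OF Vs_subspace] by (metis add_diff_cancel_right')
  then have "scl (inverse c) (scl c g) \<in> Vs" by (rule FV.subspace_scale[OF Vs_subspace])
  then show "g \<in> Vs" using \<open>c \<noteq> 0\<close> by simp
qed

lemma Vs_scl: "f \<in> Vs \<Longrightarrow> scl c f \<in> Vs"
  by (rule FV.subspace_scale[OF Vs_subspace])
lemma Vs_add: "f \<in> Vs \<Longrightarrow> g \<in> Vs \<Longrightarrow> f + g \<in> Vs"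
  by (rule FV.subspace_add[OF Vs_subspace])

lemma Good_comm:
  assumes "Good a b k" "Good c d l" "f \<in> Vs"
  shows "scl (jj c b) (X a d (k + l) f) + scl (jj c a) (X b d (k + l) f)
     + scl (jj d b) (X a c (k + l) f) + scl (jj d a) (X b c (k + l) f) \<in> Vs" (is "?c \<in> Vs")
proof -
  have f: "f \<in> Fock" using assms Vs_Fock by blast
  obtain e where e: "X a b k (X c d l f) = X c d l (X a b k f) + ?c + scl e f"
    using X_comm[OF f] by blast
  have "?c = X a b k (X c d l f) - X c d l (X a b k f) - scl e f" unfolding e by simp
  moreover have "\<dots> \<in> Vs"
    using assms by (intro FV.subspace_diff[OF Vs_subspace] Vs_scl) (auto simp: Good_def)
  ultimately show ?thesis by simp
qed

text \<open>The inequalities leave only the contraction of \<open>q\<close> with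
  \<open>bar q\<close> in the commutator. The next three lemmas treat coinciding letters, where the
  same mode arises two or four times.\<close>

lemma Good_trans:
  assumes "Good p q k" "Good (bar q) r l" "p \<noteq> q" "r \<noteq> bar q" "r \<noteq> bar p"
  shows "Good p r (k + l)"
  unfolding Good_def
proof
  fix f assume "f \<in> Vs"
  moreover have "q \<noteq> bar r" "p \<noteq> bar r" using assms by auto
  ultimately have "scl (- J q) (X p r (k + l) f) + 0 \<in> Vs"
    using Good_comm[OF assms(1,2)] assms(3) by (simp add: jj_def)
  then show "X p r (k + l) f \<in> Vs"
    by (rule Vs_cancel) (auto simp: FV.subspace_0[OF Vs_subspace])
qed

lemma Good_double:
  assumes "Good p q k" "Good (bar q) (bar q) l" "p \<noteq> q"
  shows "Good p (bar q) (k + l)"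
  unfolding Good_def
proof
  fix f assume "f \<in> Vs"
  then have "scl (- J q) (X p (bar q) (k + l) f) + scl (- J q) (X p (bar q) (k + l) f) \<in> Vs"
    using Good_comm[OF assms(1,2)] assms(3) by (simp add: jj_def)
  then have "scl (- 2 * J q) (X p (bar q) (k + l) f) + 0 \<in> Vs"
    by (simp add: scl_double)
  then show "X p (bar q) (k + l) f \<in> Vs"
    by (rule Vs_cancel) (auto simp: FV.subspace_0[OF Vs_subspace])
qed

lemma Good_square:
  assumes "Good q q k" "Good (bar q) (bar q) l"
  shows "Good q (bar q) (k + l)"
  unfolding Good_def
proof
  fix f assume "f \<in> Vs"
  then have "scl (- J q) (X q (bar q) (k + l) f) + scl (- J q) (X q (bar q) (k + l) f)
    + scl (- J q) (X q (bar q) (k + l) f) + scl (- J q) (X q (bar q) (k + l) f) \<in> Vs"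
    using Good_comm[OF assms(1,2)] by (simp add: jj_def)
  then have "scl (- 4 * J q) (X q (bar q) (k + l) f) + 0 \<in> Vs"
    by (simp add: scl_double)
  then show "X q (bar q) (k + l) f \<in> Vs"
    by (rule Vs_cancel) (auto simp: FV.subspace_0[OF Vs_subspace])
qed

lemma Good_half:
  assumes "Good q q k" "Good (bar q) q l"
  shows "Good q q (k + l)"
  unfolding Good_def
proof
  fix f assume "f \<in> Vs"
  then have "scl (- J q) (X q q (k + l) f) + scl (- J q) (X q q (k + l) f) \<in> Vs"
    using Good_comm[OF assms(1,2)] by (simp add: jj_def)
  then have "scl (- 2 * J q) (X q q (k + l) f) + 0 \<in> Vs"
    by (simp add: scl_double)
  then show "X q q (k + l) f \<in> Vs"
    by (rule Vs_cancel) (auto simp: FV.subspace_0[OF Vs_subspace])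
qed

lemma Good_E: "j \<le> n \<Longrightarrow> Good (chA j) (chB j) (chM j)"
  unfolding Good_def
proof
  fix f assume "j \<le> n" "f \<in> Vs"
  then have "scl (chC j) (X (chA j) (chB j) (chM j) f) + 0 \<in> Vs" using E_Vs by (simp add: E_def)
  then show "X (chA j) (chB j) (chM j) f \<in> Vs"
    by (rule Vs_cancel) (auto simp: FV.subspace_0[OF Vs_subspace] chC_def)
qed

lemma Good_F: "j \<le> n \<Longrightarrow> Good (bar (chA j)) (bar (chB j)) (- chM j)"
  unfolding Good_def
proof
  fix f assume "j \<le> n" "f \<in> Vs"
  then have "scl (chD j) (X (bar (chA j)) (bar (chB j)) (- chM j) f) + 0 \<in> Vs" using F_Vs by (simp add: F_def)
  then show "X (bar (chA j)) (bar (chB j)) (- chM j) f \<in> Vs"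
    by (rule Vs_cancel) (auto simp: FV.subspace_0[OF Vs_subspace] chC_def chD_def)
qed

lemma Good_up: "1 \<le> a \<Longrightarrow> a < b \<Longrightarrow> b \<le> n \<Longrightarrow> Good (Plain a) (Barred b) 0 \<and> Good (Plain b) (Barred a) 0"
proof (induction b)
  case 0
  then show ?case by simp
next
  case (Suc b)
  have base: "Good (Plain b) (Barred (Suc b)) 0 \<and> Good (Plain (Suc b)) (Barred b) 0" if "1 \<le> b"
    using Good_E[of b] Good_F[of b] Suc.prems that Good_sym by (auto simp: chA_def chB_def chM_def)
  show ?case
  proof (cases "a = b")
    case True
    then show ?thesis using base Suc.prems by simp
  next
    case False
    then have ab: "a < b" using Suc.prems by simp
    then have IH: "Good (Plain a) (Barred b) 0" "Good (Plain b) (Barred a) 0" using Suc by auto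
    have b: "Good (Plain b) (Barred (Suc b)) 0" "Good (Plain (Suc b)) (Barred b) 0" using base ab by auto
    have "Good (Plain a) (Barred (Suc b)) (0 + 0)"
      by (rule Good_trans[OF IH(1)]) (use b ab in auto)
    moreover have "Good (Plain (Suc b)) (Barred a) (0 + 0)"
      by (rule Good_trans[OF b(2)]) (use IH ab in auto)
    ultimately show ?thesis by simp
  qed
qed

lemma Good_plain_barred: "a \<in> {1..n} \<Longrightarrow> b \<in> {1..n} \<Longrightarrow> a \<noteq> b \<Longrightarrow> Good (Plain a) (Barred b) 0"
  using Good_up[of a b] Good_up[of b a] by (cases "a < b") auto

lemma Good_nn: "Good (Plain n) (Plain n) 0" "Good (Barred n) (Barred n) 0"
  using Good_E[of n] Good_F[of n] n_ge_2 by (auto simp: chA_def chB_def chM_def)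

lemma Good_n: "a \<in> {1..n} \<Longrightarrow> Good (Plain a) (Plain n) 0" "a \<in> {1..n} \<Longrightarrow> Good (Barred a) (Barred n) 0"
proof -
  assume a: "a \<in> {1..n}"
  show "Good (Plain a) (Plain n) 0"
  proof (cases "a = n")
    case False
    then have "Good (Plain a) (bar (Barred n)) (0 + 0)"
      using a by (intro Good_double) (auto simp: Good_nn Good_plain_barred)
    then show ?thesis by simp
  qed (simp add: Good_nn)
  show "Good (Barred a) (Barred n) 0"
  proof (cases "a = n")
    case False
    then have "Good (Barred a) (bar (Plain n)) (0 + 0)"
      using a by (intro Good_double) (auto simp: Good_nn intro!: Good_sym[OF Good_plain_barred])
    then show ?thesis by simp
  qed (simp add: Good_nn)
qed

lemma Good_same: "a \<in> {1..n} \<Longrightarrow> b \<in> {1..n} \<Longrightarrow> Good (Plain a) (Plain b) 0 \<and> Good (Barred a) (Barred b) 0"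
proof -
  assume ab: "a \<in> {1..n}" "b \<in> {1..n}"
  consider "b = n" | "a = n" | "a \<noteq> n" "b \<noteq> n" by blast
  then show ?thesis
  proof cases
    case 1
    then show ?thesis using Good_n ab by auto
  next
    case 2
    then show ?thesis using Good_n ab Good_sym by auto
  next
    case 3
    have "Good (Plain a) (Plain b) (0 + 0)"
      by (rule Good_trans[of _ "Barred n"]) (use 3 ab in \<open>auto intro!: Good_plain_barred Good_sym[OF Good_n(1)]\<close>)
    moreover have "Good (Barred a) (Barred b) (0 + 0)"
      by (rule Good_trans[of _ "Plain n"]) (use 3 ab in \<open>auto intro!: Good_sym[OF Good_plain_barred] Good_sym[OF Good_n(2)]\<close>)
    ultimately show ?thesis by simp
  qed
qed

text \<open>The case \<open>a = n\<close> comes from the two long root vectors. For other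
  \<open>a\<close>, the commutator of opposite short root vectors yields the difference to the case
  \<open>n\<close>.\<close>

lemma Good_bar: "a \<in> {1..n} \<Longrightarrow> Good (Plain a) (Barred a) 0"
proof -
  assume a: "a \<in> {1..n}"
  have n: "Good (Plain n) (Barred n) 0" using Good_square[of "Plain n" 0 0] Good_nn by simp
  show ?thesis
  proof (cases "a = n")
    case False
    have g: "Good (Plain a) (Barred n) 0" "Good (Plain n) (Barred a) 0" using a False n_ge_2 by (auto intro!: Good_plain_barred)
    show ?thesis
      unfolding Good_def
    proof
      fix f assume f: "f \<in> Vs"
      have "scl 1 (X (Plain a) (Barred a) 0 f) + scl (- 1) (X (Barred n) (Plain n) 0 f) \<in> Vs"
        using Good_comm[OF g f] False by (simp add: jj_def)
      moreover have "scl (- 1) (X (Barred n) (Plain n) 0 f) \<in> Vs"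
        using n f Good_sym by (intro Vs_scl) (auto simp: Good_def)
      ultimately show "X (Plain a) (Barred a) 0 f \<in> Vs" by (rule Vs_cancel) simp
    qed
  qed (simp add: n)
qed

lemma Good_0: "a \<in> letters n \<Longrightarrow> b \<in> letters n \<Longrightarrow> Good a b 0"
proof -
  have pb: "Good (Plain a) (Barred b) 0" if "a \<in> {1..n}" "b \<in> {1..n}" for a b
    using that Good_bar Good_plain_barred by (cases "a = b") auto
  assume "a \<in> letters n" "b \<in> letters n"
  then show ?thesis
    by (auto simp: letters_def Good_same pb Good_sym[OF pb])
qed

text \<open>The modes of degree 0 act on those of degree \<open>k\<close> as in the adjoint
  representation. Starting from one long root mode \<open>X c c k\<close>, the letters are exchanged
  one at a time; the case \<open>a = bar c\<close> only doubles the coefficient of the wanted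
  mode.\<close>

lemma Good_lift:
  assumes c: "c \<in> letters n" "Good c c k" and ab: "a \<in> letters n" "b \<in> letters n"
  shows "Good a b k"
proof -
  have s1: "Good p c k" if p: "p \<in> letters n" for p
  proof (cases "p = bar c")
    case True
    have "Good (bar c) (bar (bar c)) (0 + k)"
      by (rule Good_square) (use c p in \<open>auto simp: Good_0\<close>)
    then show ?thesis by (simp add: True)
  next
    case False
    have "Good p (bar (bar c)) (0 + k)"
      by (rule Good_double) (use c p False in \<open>auto simp: Good_0\<close>)
    then show ?thesis by simp
  qed
  show ?thesis
    unfolding Good_def
  proof
    fix f assume f: "f \<in> Vs"
    have h: "scl e (X a c k f) + scl e' (X (bar c) c k f) \<in> Vs" for e e'
      using s1[OF ab(1)] s1[of "bar c"] c f by (intro Vs_add Vs_scl) (auto simp: Good_def)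
    have "Good a (bar c) 0" "Good c b k" using ab c s1 Good_sym by (auto intro: Good_0)
    from Good_comm[OF this f]
    have "scl (J c + (if a = bar c then J c else 0)) (X a b k f)
        + (scl (jj b (bar c)) (X a c k f) + scl (jj b a) (X (bar c) c k f)) \<in> Vs"
      by (cases "a = bar c") (simp_all add: jj_def[of c] scl_double add_ac)
    then show "X a b k f \<in> Vs" using h by (rule Vs_cancel) (auto simp flip: mult_2)
  qed
qed

text \<open>The mode of \<open>F 0\<close> has degree 1 and that of \<open>E 0\<close> has degree
  \<open>- 1\<close>. Through \<open>Good_half\<close> they move one long root mode up or down by
  one degree, and \<open>Good_lift\<close> spreads it to all letters.\<close>

lemma Good_all: "a \<in> letters n \<Longrightarrow> b \<in> letters n \<Longrightarrow> Good a b k"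
proof -
  have l: "Plain 1 \<in> letters n" "Barred 1 \<in> letters n" using n_ge_2 by (auto simp: letters_def)
  have p: "Good (Plain 1) (Plain 1) 1" "Good (Barred 1) (Barred 1) (- 1)"
    using Good_E[of 0] Good_F[of 0] by (auto simp: chA_def chB_def chM_def)
  have "\<forall>a\<in>letters n. \<forall>b\<in>letters n. Good a b k"
  proof (induction k rule: int_induct[of _ 0])
    case base
    then show ?case using Good_0 by blast
  next
    case (step1 k)
    have "Good (Plain 1) (Plain 1) (1 + k)"
      by (rule Good_half[OF p(1)]) (use step1 l in auto)
    then show ?case using Good_lift[OF l(1), of "k + 1"] by (simp add: add.commute)
  next
    case (step2 k)
    have "Good (Barred 1) (Barred 1) (- 1 + k)"
      by (rule Good_half[OF p(2)]) (use step2 l in auto)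
    then show ?case using Good_lift[OF l(2), of "k - 1"] by simp
  qed
  then show "a \<in> letters n \<Longrightarrow> b \<in> letters n \<Longrightarrow> Good a b k" by blast
qed

lemma XW_Vs: "\<forall>p\<in>set ps. lpart p \<Longrightarrow> XW ps vac \<in> Vs"
proof (induction ps)
  case Nil
  then show ?case using wF_Vs[of "[]"] by simp
next
  case (Cons p ps)
  then show ?case using Good_all by (cases p) (auto simp: Good_def lpart_def)
qed

lemma wF_words: "set I \<subseteq> {..n} \<Longrightarrow> wF I \<in> Sp"
proof -
  assume I: "set I \<subseteq> {..n}"
  have "\<exists>c ps. (\<forall>p\<in>set ps. lpart p) \<and> wF I = scl c (XW ps vac)"
    using I
  proof (induction I)
    case Nil
    then show ?case by (intro exI[of _ 1] exI[of _ "[]"]) simp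
  next
    case (Cons k I)
    then obtain c ps where ps: "\<forall>p\<in>set ps. lpart p" "wF I = scl c (XW ps vac)" by auto
    have "wF (k # I) = scl (c * chD k) (XW ((- chM k, bar (chA k), bar (chB k)) # ps) vac)"
      using ps by (simp add: X_scl XW_Fock Fock.vac F_def mult.commute)
    moreover have "\<forall>p\<in>set ((- chM k, bar (chA k), bar (chB k)) # ps). lpart p"
      using ps Cons.prems ch_letters by (auto simp: lpart_def)
    ultimately show ?case by blast
  qed
  then show ?thesis using spanning FV.subspace_scale[OF Sp_subspace] by auto
qed

lemma Vs_eq_Sp: "Vs = Sp"
proof
  show "Vs \<subseteq> Sp" unfolding Vs_def by (rule FV.span_minimal[OF _ Sp_subspace]) (auto simp: wF_words)
  show "Sp \<subseteq> Vs" unfolding Sp_def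
    by (rule FV.span_minimal[OF _ Vs_subspace]) (auto simp: GP_def npart_def intro!: XW_Vs)
qed

text \<open>The contravariant form is positive definite, so nothing in \<open>Vs\<close> is killed by the projection to
  the vacuum of all monomials in the \<open>E j\<close>.\<close>

lemma Vs_nondegenerate:
  assumes N: "N \<subseteq> Vs" "\<And>j f. j \<le> n \<Longrightarrow> f \<in> N \<Longrightarrow> E j f \<in> N" "\<And>f. f \<in> N \<Longrightarrow> coef f {} = 0" and f: "f \<in> N"
  shows "f = 0"
proof -
  have ortho: "set I \<subseteq> {..n} \<Longrightarrow> g \<in> N \<Longrightarrow> ip g (wF I) = 0" for I g
  proof (induction I arbitrary: g)
    case Nil
    then have "g \<in> Fock" using N Vs_Fock by auto
    then show ?case using Nil N by (simp add: ip_vac fsupp_Fock)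
  next
    case (Cons k I)
    then have "g \<in> Fock" using N Vs_Fock by auto
    then show ?case using Cons N by (simp add: ip_E[symmetric] wF_Fock)
  qed
  have "Vs \<subseteq> {g. ip f g = 0}"
    unfolding Vs_def
  proof (rule FV.span_minimal)
    show "{wF I |I. set I \<subseteq> {..n}} \<subseteq> {g. ip f g = 0}" using ortho f by auto
    show "FV.subspace {g. ip f g = 0}" by (auto simp: FV.subspace_def ip_add_right ip_scl_right)
  qed
  then have "ip f f = 0" using f N by auto
  then show ?thesis using f N Vs_Fock by (intro ip_self fsupp_Fock) auto
qed

end

section \<open>Grounded partitions\<close>

definition emb_part :: "part \<Rightarrow> coloured_int" where
  "emb_part p = (case p of (m, x, y) \<Rightarrow> (m, Col (Pr x y)))"

context fock
begin

definition gp :: "part list \<Rightarrow> coloured_int list" where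
  "gp ps = map emb_part ps @ [(0, Col (ground i))]"

lemma gp_inj: "inj gp"
proof (rule injI)
  fix ps qs assume "gp ps = gp qs"
  then have "map emb_part ps = map emb_part qs" by (simp add: gp_def)
  moreover have "inj emb_part" by (auto simp: inj_def emb_part_def)
  ultimately show "ps = qs" by (metis inj_map_eq_map)
qed

text \<open>For ordered pairs of letters \<open>rho\<close> is 0 if both letters drop strictly, 2 if
  \<open>y \<le> x'\<close>, and 1 otherwise.\<close>

lemma R_iff_rho:
  assumes "npart (m, x, y)" "npart (m', x', y')"
  shows "rho i (Col (Pr x y)) (Col (Pr x' y')) \<le> m - m' \<longleftrightarrow> R (m, x, y) (m', x', y')"
proof -
  have le: "x \<le> y" "x' \<le> y'" using assms by (simp_all add: npart_def)
  consider "x' < x" "y' < y" | "y \<le> x'" | "\<not> (x' < x \<and> y' < y)" "x' < y" by fastforce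
  then show ?thesis
  proof cases
    case 1
    then have "\<not> x \<le> x'" "\<not> y \<le> y'" by auto
    then have "rho i (Col (Pr x y)) (Col (Pr x' y')) = 0" by simp
    then show ?thesis using 1 le by (auto simp: R_def)
  next
    case 2
    then have "x \<le> x'" "y \<le> y'" "\<not> x' < y" using le by auto
    then have "rho i (Col (Pr x y)) (Col (Pr x' y')) = 2" by simp
    then show ?thesis using 2 le by (auto simp: R_def)
  next
    case 3
    then have "rho i (Col (Pr x y)) (Col (Pr x' y')) = 1" by (cases "x \<le> x'"; cases "y \<le> y'") auto
    then show ?thesis using 3 by (auto simp: R_def)
  qed
qed

text \<open>For \<open>i = 0\<close> all energies against the ground element are 1. Otherwise they
  give the threshold \<open>r\<close> of the vacuum; the exceptional value at
  \<open>ground i\<close> and the strict inequalities of \<open>energy\<close> at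
  \<open>y = Barred i\<close> are what makes the boundary cases fit.\<close>

lemma valid_iff_rho:
  assumes "npart (m, x, y)"
  shows "rho i (Col (Pr x y)) Col_inf \<le> m \<longleftrightarrow> valid (m, x, y)"
proof (cases "i = 0")
  case True
  have "valid (m, x, y) \<longleftrightarrow> 1 \<le> m"
    unfolding valid_iff using assms True
    by (cases x; cases y) (auto simp: npart_def lpart_def letters_def less_letter_def)
  then show ?thesis using True by (simp add: ground_def)
next
  case False
  define r where "r = (if x > Plain i \<and> y \<ge> Barred i then 0 else if y > Plain i then 1 else 2 :: int)"
  have xy: "x \<le> y" using assms by (simp add: npart_def)
  have "valid (m, x, y) \<longleftrightarrow> r \<le> m"
    unfolding valid_iff r_def using Barred_gt_Plain[of i y i] by auto
  moreover have "rho i (Col (Pr x y)) Col_inf = r"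
    using False xy unfolding r_def
    by (cases x; cases y) (auto simp: ground_def less_letter_def)
  ultimately show ?thesis by simp
qed

lemma R_trans: "R p q \<Longrightarrow> R q r \<Longrightarrow> R p r"
  by (auto simp: R_def split: prod.splits)

lemma R_valid: "R p q \<Longrightarrow> valid q \<Longrightarrow> valid p"
proof -
  obtain m x y where p: "p = (m, x, y)" by (cases p)
  obtain m' x' y' where q: "q = (m', x', y')" by (cases q)
  assume "R p q" "valid q"
  then show "valid p" by (auto simp: R_def valid_iff p q)
qed

definition ground_cond :: "coloured_int list \<Rightarrow> bool" where
  "ground_cond cs \<longleftrightarrow> (let \<pi>' = cs @ [(0, Col_inf)] in
     \<forall>j<length cs. fst (\<pi>' ! j) - fst (\<pi>' ! (j + 1)) \<ge> rho i (snd (\<pi>' ! j)) (snd (\<pi>' ! (j + 1))))"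

lemma ground_cond_simps:
  "ground_cond []"
  "ground_cond [c] \<longleftrightarrow> rho i (snd c) Col_inf \<le> fst c"
  "ground_cond (c # c' # cs) \<longleftrightarrow> rho i (snd c) (snd c') \<le> fst c - fst c' \<and> ground_cond (c' # cs)"
  by (auto simp: ground_cond_def All_less_Suc2)

text \<open>The grounded condition concerns neighbours and the last part only;
  \<open>R_trans\<close> extends it to all pairs and \<open>R_valid\<close> to all parts.\<close>

lemma ground_cond_iff:
  "\<forall>p\<in>set ps. npart p \<Longrightarrow> ground_cond (map emb_part ps) \<longleftrightarrow> sorted_wrt R ps \<and> (\<forall>p\<in>set ps. valid p)"
proof (induction ps rule: induct_list012)
  case 1
  then show ?case by (simp add: ground_cond_simps)
next
  case (2 p)
  then show ?case using valid_iff_rho by (cases p) (simp add: ground_cond_simps emb_part_def)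
next
  case (3 p q ps)
  obtain m x y where p: "p = (m, x, y)" by (cases p)
  obtain m' x' y' where q: "q = (m', x', y')" by (cases q)
  have "ground_cond (map emb_part (p # q # ps)) \<longleftrightarrow>
      rho i (snd (emb_part p)) (snd (emb_part q)) \<le> fst (emb_part p) - fst (emb_part q) \<and> ground_cond (map emb_part (q # ps))"
    by (simp only: list.map ground_cond_simps)
  also have "rho i (snd (emb_part p)) (snd (emb_part q)) \<le> fst (emb_part p) - fst (emb_part q) \<longleftrightarrow> R p q"
    using "3.prems" R_iff_rho[of m x y m' x' y'] by (simp del: rho.simps add: p q emb_part_def)
  also have "ground_cond (map emb_part (q # ps)) \<longleftrightarrow> sorted_wrt R (q # ps) \<and> (\<forall>p\<in>set (q # ps). valid p)"
    using "3.prems" by (intro "3.IH"(2)) simp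
  also have "R p q \<and> sorted_wrt R (q # ps) \<and> (\<forall>p\<in>set (q # ps). valid p) \<longleftrightarrow> sorted_wrt R (p # q # ps) \<and> (\<forall>p\<in>set (p # q # ps). valid p)"
    using R_trans[of p q] R_valid[of p q] by auto
  finally show ?case .
qed

lemma grounded_partitions_eq: "grounded_partitions n i = gp ` GP"
proof (intro equalityI subsetI)
  fix \<pi> assume "\<pi> \<in> grounded_partitions n i"
  then obtain cs where cs: "\<pi> = cs @ [(0, Col (ground i))]" "\<forall>p\<in>set cs. snd p \<in> colours_S n" "ground_cond cs"
    unfolding grounded_partitions_def ground_cond_def by blast
  have "\<exists>ps. cs = map emb_part ps \<and> (\<forall>p\<in>set ps. npart p)"
    using cs(2)
  proof (induction cs)
    case (Cons c cs)
    then obtain ps where ps: "cs = map emb_part ps" "\<forall>p\<in>set ps. npart p" by auto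
    obtain x y where xy: "snd c = Col (Pr x y)" "x \<in> letters n" "y \<in> letters n" "x \<le> y"
      using Cons.prems by (auto simp: colours_S_def crystal_def)
    have "c = emb_part (fst c, x, y)" using xy by (cases c) (simp add: emb_part_def)
    moreover have "npart (fst c, x, y)" using xy by (simp add: npart_def lpart_def)
    ultimately have "c # cs = map emb_part ((fst c, x, y) # ps) \<and> (\<forall>p\<in>set ((fst c, x, y) # ps). npart p)"
      using ps by simp
    then show ?case by (rule exI)
  qed simp
  then obtain ps where ps: "cs = map emb_part ps" "\<forall>p\<in>set ps. npart p" by blast
  then have "ps \<in> GP" using ground_cond_iff[of ps] cs(3) by (simp add: GP_def)
  then show "\<pi> \<in> gp ` GP" using cs(1) ps(1) by (auto simp: gp_def)
next
  fix \<pi> assume "\<pi> \<in> gp ` GP"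
  then obtain ps where ps: "\<pi> = gp ps" "ps \<in> GP" by blast
  then have "ground_cond (map emb_part ps)" using ground_cond_iff[of ps] by (simp add: GP_def)
  moreover have "\<forall>p\<in>set (map emb_part ps). snd p \<in> colours_S n"
    using ps by (fastforce simp: GP_def npart_def lpart_def emb_part_def colours_S_def crystal_def)
  ultimately show "\<pi> \<in> grounded_partitions n i"
    unfolding grounded_partitions_def ground_cond_def ps(1) gp_def by blast
qed

text \<open>Parts of size 0 may occur, so the total size does not bound the length at once. But
  \<open>R\<close> is irreflexive, so the parts are distinct elements of a finite set.\<close>

lemma finite_GP_size: "finite {ps \<in> GP. sum_list (map fst ps) = N}"
proof -
  have "ps \<in> {xs. set xs \<subseteq> {0..N} \<times> letters n \<times> letters n \<and> distinct xs}"
    if ps: "ps \<in> GP" "sum_list (map fst ps) = N" for ps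
  proof -
    have R: "sorted_wrt R ps" and v: "\<forall>p\<in>set ps. npart p \<and> valid p" using ps by (auto simp: GP_def)
    have "distinct ps"
      using R by (induction ps) (auto simp: R_def)
    moreover have "fst p \<le> N" if "p \<in> set ps" for p
      unfolding ps(2)[symmetric] using that v valid_nonneg by (intro member_le_sum_list) auto
    ultimately show ?thesis using v valid_nonneg by (fastforce simp: npart_def lpart_def)
  qed
  then have "{ps \<in> GP. sum_list (map fst ps) = N} \<subseteq> {xs. set xs \<subseteq> {0..N} \<times> letters n \<times> letters n \<and> distinct xs}"
    by blast
  then show ?thesis by (rule finite_subset) (rule finite_subset_distinct, simp)
qed

end

section \<open>Comparison with the abstract module\<close>

text \<open>A vector \<open>b\<close> of another eigenvalue \<open>m\<close> is eliminated by
  \<open>T - m\<close>, which kills \<open>b\<close> and multiplies \<open>v\<close> by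
  \<open>\<mu> - m\<close>. The set \<open>B\<close> may be linearly dependent.\<close>

lemma (in vector_space) eigen_filter:
  assumes lin: "\<And>x y. T (x + y) = T x + T y" "\<And>c x. T (scale c x) = scale c (T x)"
    and eig: "\<And>b. b \<in> B \<Longrightarrow> \<exists>m. T b = scale m b" and v: "v \<in> span B" "T v = scale \<mu> v"
  shows "v \<in> span {b \<in> B. T b = scale \<mu> b}"
proof -
  let ?B0 = "{b \<in> B. T b = scale \<mu> b}"
  have stable: "T x - scale c x \<in> span S" if x: "x \<in> span S" and S: "S \<subseteq> B" for x c S
  proof -
    have "T x \<in> span S" using x
    proof (induction rule: span_induct_alt)
      case base
      have "T 0 = 0" using lin(2)[of 0 0] by simp
      then show ?case by (simp add: span_zero)
    next
      case (step c x y)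
      obtain m where "T x = scale m x" using eig step S by blast
      then show ?case using step by (simp add: lin span_add span_scale span_base)
    qed
    then show ?thesis using x by (simp add: span_diff span_scale)
  qed
  have red: "v \<in> span ?B0" if "finite S" "S \<subseteq> B" "v \<in> span (S \<union> ?B0)" for S
    using that
  proof (induction S rule: finite_induct)
    case (insert b S)
    show ?case
    proof (cases "T b = scale \<mu> b")
      case True
      then have "insert b S \<union> ?B0 = S \<union> ?B0" using insert by auto
      then show ?thesis using insert by simp
    next
      case False
      obtain m where m: "T b = scale m b" using eig insert by blast
      then have ne: "\<mu> \<noteq> m" using False by auto
      obtain k where k: "v - scale k b \<in> span (S \<union> ?B0)"
        using insert.prems(2) span_breakdown_eq[of v b "S \<union> ?B0"] by auto
      let ?w = "v - scale k b"
      have "T ?w = scale \<mu> v - scale k (scale m b)"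
        using lin(1)[of ?w "scale k b"] by (simp add: lin(2) m v(2) algebra_simps)
      then have "T ?w - scale m ?w = scale (\<mu> - m) v"
        by (simp add: scale_left_diff_distrib scale_right_diff_distrib mult.commute)
      then have "scale (\<mu> - m) v \<in> span (S \<union> ?B0)"
        using stable[OF k, of m] insert.prems by auto
      then have "scale (inverse (\<mu> - m)) (scale (\<mu> - m) v) \<in> span (S \<union> ?B0)" by (rule span_scale)
      then show ?thesis using ne insert by simp
    qed
  qed simp
  obtain S where S: "finite S" "S \<subseteq> B" "v \<in> span S"
    using v(1) unfolding span_explicit by (force intro: span_sum span_scale span_base)
  then have "v \<in> span (S \<union> ?B0)" using span_mono[of S "S \<union> ?B0"] by auto
  then show ?thesis using red S by blast
qed

locale affine_rep = affine_C scale bracket n H h d e f \<alpha> \<Lambda>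
    + irreducible_highest_weight_module scale bracket scaleL act n H e "\<Lambda> i"
  for scale :: "complex \<Rightarrow> 'g::ab_group_add \<Rightarrow> 'g" and bracket :: "'g \<Rightarrow> 'g \<Rightarrow> 'g"
    and n i :: nat and H :: "'g set" and h e f :: "nat \<Rightarrow> 'g" and d :: 'g
    and \<alpha> \<Lambda> :: "nat \<Rightarrow> 'g \<Rightarrow> complex"
    and scaleL :: "complex \<Rightarrow> 'v::ab_group_add \<Rightarrow> 'v" and act :: "'g \<Rightarrow> 'v \<Rightarrow> 'v" +
  fixes vL :: 'v
  assumes i_le: "i \<le> n" and vL_neq: "vL \<noteq> 0" and vL_e: "j \<le> n \<Longrightarrow> act (e j) vL = 0"
    and vL_H: "x \<in> H \<Longrightarrow> act x vL = scaleL (\<Lambda> i x) vL"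
    and vL_gen: "submodule M \<Longrightarrow> vL \<in> M \<Longrightarrow> M = UNIV"
begin

sublocale K: fock n i
  by unfold_locales (rule n_ge_2, rule i_le)

text \<open>Zero off \<open>letters n\<close>, so that \<open>u (h j)\<close> and
  \<open>K.hw j\<close> agree as functions on all letters.\<close>

definition u :: "'g \<Rightarrow> letter \<Rightarrow> complex" where
  "u x c = (if c \<in> letters n then letter_exponent \<alpha> n c x else 0)"

abbreviation \<delta> :: "'g \<Rightarrow> complex" where
  "\<delta> \<equiv> null_root \<alpha> n"

definition hF :: "'g \<Rightarrow> fvec \<Rightarrow> fvec" where
  "hF x = K.Dg (\<Lambda> i x) (K.Om (u x) (\<delta> x))"

lemma letter_exponent_bar: "letter_exponent \<alpha> n (bar c) x = - letter_exponent \<alpha> n c x"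
  by (cases c) auto

lemma u_odd: "K.odd_wt (u x)"
  by (simp add: K.odd_wt_def u_def letter_exponent_bar)

lemma plain_letters: "1 \<le> j \<Longrightarrow> j \<le> n \<Longrightarrow> Plain j \<in> letters n \<and> Barred j \<in> letters n"
  by (auto simp: letters_def)

lemma rt_root: "k \<le> n \<Longrightarrow> K.rt (u x) (\<delta> x) k = \<alpha> k x"
proof -
  assume k: "k \<le> n"
  consider "k = 0" | "k = n" "k \<noteq> 0" | "0 < k" "k < n" using k by linarith
  then show ?thesis
  proof cases
    case 1
    have "{1..<n} = {1..n - 1}" using n_ge_2 by auto
    then show ?thesis using 1 n_ge_2 plain_letters[of 1]
      by (simp add: K.rt_def K.chA_def K.chB_def K.chM_def u_def null_root_def)
  next
    case 2
    then show ?thesis using plain_letters[of n]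
      by (simp add: K.rt_def K.chA_def K.chB_def K.chM_def u_def)
  next
    case 3
    have "(\<Sum>v\<in>{k..<n}. \<alpha> v x) = \<alpha> k x + (\<Sum>v\<in>{k + 1..<n}. \<alpha> v x)"
      using 3 by (simp add: sum.atLeast_Suc_lessThan)
    then show ?thesis using 3 plain_letters[of k] plain_letters[of "k + 1"]
      by (simp add: K.rt_def K.chA_def K.chB_def K.chM_def u_def)
  qed
qed

lemma u_coroot_plain: "j \<le> n \<Longrightarrow> 1 \<le> c \<Longrightarrow> c \<le> n \<Longrightarrow> letter_exponent \<alpha> n (Plain c) (h j) = K.hw j (Plain c)"
proof -
  assume j: "j \<le> n" and c: "1 \<le> c" "c \<le> n"
  from c(2,1) show ?thesis
  proof (induction rule: inc_induct)
    case base
    have "j = 0 \<or> j = n \<or> 0 < j \<and> j < n" using j by linarith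
    then show ?case using j n_ge_2
      by (auto simp: root_coroot cartan_C_def K.hw_def K.chA_def K.chB_def)
  next
    case (step c)
    have s: "(\<Sum>v\<in>{c..<n}. \<alpha> v (h j)) = \<alpha> c (h j) + (\<Sum>v\<in>{Suc c..<n}. \<alpha> v (h j))"
      using step by (simp add: sum.atLeast_Suc_lessThan)
    have IH: "letter_exponent \<alpha> n (Plain (Suc c)) (h j) = K.hw j (Plain (Suc c))" using step by simp
    have "letter_exponent \<alpha> n (Plain c) (h j) = \<alpha> c (h j) + K.hw j (Plain (Suc c))"
      unfolding IH[symmetric] by (simp add: s)
    also have "\<dots> = K.hw j (Plain c)"
    proof -
      have "j = 0 \<or> j = n \<or> 0 < j \<and> j < n" using j by linarith
      then show ?thesis using j n_ge_2 step
        by (auto simp: root_coroot cartan_C_def K.hw_def K.chA_def K.chB_def)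
    qed
    finally show ?case .
  qed
qed

lemma hw_outside: "j \<le> n \<Longrightarrow> c \<notin> letters n \<Longrightarrow> K.hw j c = 0"
  using K.ch_letters[of j] by (auto simp: K.hw_def)

lemma u_coroot: "j \<le> n \<Longrightarrow> u (h j) = K.hw j"
proof
  fix c assume j: "j \<le> n"
  show "u (h j) c = K.hw j c"
  proof (cases "c \<in> letters n")
    case False
    then show ?thesis using j hw_outside by (simp add: u_def)
  next
    case True
    show ?thesis
    proof (cases c)
      case (Plain k)
      then show ?thesis using True u_coroot_plain[OF j, of k] by (auto simp: u_def letters_def)
    next
      case (Barred k)
      then have k: "1 \<le> k" "k \<le> n" using True by (auto simp: letters_def)
      have "K.hw j (bar (Plain k)) = - K.hw j (Plain k)" using K.hw_odd[of j] unfolding K.odd_wt_def by blast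
      moreover have "u (h j) (bar (Plain k)) = - letter_exponent \<alpha> n (Plain k) (h j)"
        unfolding u_def letter_exponent_bar using Barred True by simp
      ultimately show ?thesis using Barred u_coroot_plain[OF j k] by (simp del: letter_exponent.simps)
    qed
  qed
qed

lemma delta_coroot: "j \<le> n \<Longrightarrow> \<delta> (h j) = 0"
proof -
  assume j: "j \<le> n"
  have "{1..<n} = {1..n - 1}" using n_ge_2 by auto
  then have "\<delta> (h j) = \<alpha> 0 (h j) + 2 * letter_exponent \<alpha> n (Plain 1) (h j)"
    by (simp add: null_root_def)
  also have "\<dots> = \<alpha> 0 (h j) + 2 * K.hw j (Plain 1)" using u_coroot_plain[OF j, of 1] n_ge_2 by simp
  also have "\<dots> = 0"
  proof -
    have "j = 0 \<or> j = n \<or> 0 < j \<and> j < n" using j by linarith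
    then show ?thesis using j n_ge_2
      by (auto simp: root_coroot cartan_C_def K.hw_def K.chA_def K.chB_def)
  qed
  finally show ?thesis .
qed

lemma hF_coroot: "j \<le> n \<Longrightarrow> hF (h j) = K.Dg (of_bool (j = i)) (\<lambda>p. K.hw j (snd p))"
  unfolding hF_def K.hw_Om using i_le by (simp add: u_coroot delta_coroot fund_coroot)

lemma H_mem: "d \<in> H" "j \<le> n \<Longrightarrow> h j \<in> H"
  unfolding cartan_span by (auto intro: span_base)

section \<open>Matching the lowering words on both sides\<close>

definition wL :: "nat list \<Rightarrow> 'v" where
  "wL I = foldr (\<lambda>k. act (f k)) I vL"

lemma wL_simps [simp]: "wL [] = vL" "wL (k # I) = act (f k) (wL I)"
  by (simp_all add: wL_def)

lemma act_0_right [simp]: "act x 0 = 0"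
  using act_scale_right[of x 0 0] by simp

lemma act_swap: "act x (act y w) = act y (act x w) + act (bracket x y) w"
  by (simp add: act_bracket)

lemma wL_H: "x \<in> H \<Longrightarrow> set I \<subseteq> {..n} \<Longrightarrow> act x (wL I) = scaleL (\<Lambda> i x - (\<Sum>k\<leftarrow>I. \<alpha> k x)) (wL I)"
proof (induction I)
  case Nil
  then show ?case by (simp add: vL_H)
next
  case (Cons k I)
  define c where "c = \<Lambda> i x - (\<Sum>k\<leftarrow>I. \<alpha> k x)"
  have IH: "act x (wL I) = scaleL c (wL I)" using Cons by (simp add: c_def)
  have "act x (wL (k # I)) = act (f k) (act x (wL I)) + act (bracket x (f k)) (wL I)"
    by (simp add: act_swap[of x])
  also have "\<dots> = scaleL c (act (f k) (wL I)) + scaleL (- \<alpha> k x) (act (f k) (wL I))"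
    using Cons.prems by (simp only: IH act_scale_right bracket_H_f act_scale_left list.set insert_subset atMost_iff)
  also have "\<dots> = scaleL (c + - \<alpha> k x) (act (f k) (wL I))" by (simp only: V.scale_left_distrib)
  finally show ?case by (simp add: c_def algebra_simps)
qed

text \<open>The graph of the isomorphism from the module onto \<open>K.Vs\<close>.\<close>

inductive Kr :: "'v \<Rightarrow> fvec \<Rightarrow> bool" where
  base: "set I \<subseteq> {..n} \<Longrightarrow> Kr (wL I) (K.wF I)"
| add: "Kr a b \<Longrightarrow> Kr a' b' \<Longrightarrow> Kr (a + a') (b + b')"
| scale: "Kr a b \<Longrightarrow> Kr (scaleL c a) (scl c b)"

lemma Kr_0: "Kr 0 0"
  using Kr.scale[OF Kr.base[of "[]"], of 0] by simp

lemma Kr_diff: "Kr a b \<Longrightarrow> Kr a' b' \<Longrightarrow> Kr (a - a') (b - b')"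
  using Kr.add[OF _ Kr.scale[of a' b' "-1"], of a b] by simp

lemma Kr_sum: "(\<And>x. x \<in> S \<Longrightarrow> Kr (p x) (q x)) \<Longrightarrow> Kr (\<Sum>x\<in>S. p x) (\<Sum>x\<in>S. q x)"
  by (induction S rule: infinite_finite_induct) (auto simp: Kr_0 Kr.add)

lemma Kr_Vs: "Kr a b \<Longrightarrow> b \<in> K.Vs"
  by (induction rule: Kr.induct) (auto simp: K.wF_Vs K.Vs_add K.Vs_scl)

lemma Kr_Fock: "Kr a b \<Longrightarrow> b \<in> K.Fock"
  using Kr_Vs K.Vs_Fock by blast

lemma Kr_F: "Kr a b \<Longrightarrow> k \<le> n \<Longrightarrow> Kr (act (f k) a) (K.F k b)"
proof (induction rule: Kr.induct)
  case (base I)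
  then show ?case using Kr.base[of "k # I"] by simp
next
  case (add a b a' b')
  then show ?case using Kr_Fock by (simp add: act_add_right K.F_add Kr.add)
next
  case (scale a b c)
  then show ?case using Kr_Fock by (simp add: act_scale_right K.F_scl Kr.scale)
qed

lemma wF_H: "set I \<subseteq> {..n} \<Longrightarrow> hF x (K.wF I) = scl (\<Lambda> i x - (\<Sum>k\<leftarrow>I. \<alpha> k x)) (K.wF I)"
proof -
  assume I: "set I \<subseteq> {..n}"
  have "(\<Sum>k\<leftarrow>I. K.rt (u x) (\<delta> x) k) = (\<Sum>k\<leftarrow>I. \<alpha> k x)"
    by (rule arg_cong[where f=sum_list], rule map_cong) (use I rt_root in auto)
  then show ?thesis unfolding hF_def K.wF_Om[OF u_odd] by simp
qed

lemma Kr_H: "Kr a b \<Longrightarrow> x \<in> H \<Longrightarrow> Kr (act x a) (hF x b)"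
proof (induction rule: Kr.induct)
  case (base I)
  then show ?case unfolding wL_H[OF base(2,1)] wF_H[OF base(1)] by (intro Kr.scale Kr.base)
next
  case (add a b a' b')
  then show ?case by (simp add: act_add_right hF_def K.Dg_add Kr.add)
next
  case (scale a b c)
  then show ?case by (simp add: act_scale_right hF_def K.Dg_scl Kr.scale)
qed

lemma Kr_E_base: "j \<le> n \<Longrightarrow> set I \<subseteq> {..n} \<Longrightarrow> Kr (act (e j) (wL I)) (K.E j (K.wF I))"
proof (induction I)
  case Nil
  then show ?case by (simp add: vL_e K.E_vac Kr_0)
next
  case (Cons k I)
  have a: "act (e j) (wL (k # I)) = act (f k) (act (e j) (wL I)) + act (bracket (e j) (f k)) (wL I)"
    by (simp add: act_swap[of "e j"])
  have IH: "Kr (act (f k) (act (e j) (wL I))) (K.F k (K.E j (K.wF I)))"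
    using Cons by (intro Kr_F) auto
  show ?case
  proof (cases "j = k")
    case True
    have "Kr (act (h j) (wL I)) (hF (h j) (K.wF I))" using Cons H_mem by (intro Kr_H Kr.base) auto
    then have "Kr (act (h j) (wL I)) (K.Dg (of_bool (j = i)) (\<lambda>p. K.hw j (snd p)) (K.wF I))"
      using Cons.prems by (simp only: hF_coroot)
    from Kr.add[OF IH this] show ?thesis
      using True Cons.prems unfolding a by (simp add: bracket_e_f K.EF_comm_same K.wF_Fock)
  next
    case False
    have "act 0 w = 0" for w using act_scale_left[of 0 0 w] by simp
    then show ?thesis using IH False Cons.prems unfolding a by (simp add: bracket_e_f K.EF_comm_diff K.wF_Fock)
  qed
qed

lemma Kr_E: "Kr a b \<Longrightarrow> j \<le> n \<Longrightarrow> Kr (act (e j) a) (K.E j b)"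
proof (induction rule: Kr.induct)
  case (base I)
  then show ?case by (simp add: Kr_E_base)
next
  case (add a b a' b')
  then show ?case using Kr_Fock by (simp add: act_add_right K.E_add Kr.add)
next
  case (scale a b c)
  then show ?case using Kr_Fock by (simp add: act_scale_right K.E_scl Kr.scale)
qed

text \<open>The elements that preserve \<open>M\<close> form a Lie subalgebra containing the
  generators, hence everything.\<close>

lemma submoduleI:
  assumes M: "V.subspace M" "\<And>x a. x \<in> H \<Longrightarrow> a \<in> M \<Longrightarrow> act x a \<in> M"
    "\<And>j a. j \<le> n \<Longrightarrow> a \<in> M \<Longrightarrow> act (e j) a \<in> M" "\<And>j a. j \<le> n \<Longrightarrow> a \<in> M \<Longrightarrow> act (f j) a \<in> M"
  shows "submodule M"
proof -
  define S where "S = {x. \<forall>a\<in>M. act x a \<in> M}"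
  have act0: "act 0 w = 0" for w using act_scale_left[of 0 0 w] by simp
  have "lie_subalgebra S"
    unfolding lie_subalgebra_def subspace_def
  proof (intro conjI ballI allI)
    show "0 \<in> S" using V.subspace_0[OF M(1)] by (simp add: S_def act0)
    fix x y assume "x \<in> S" "y \<in> S"
    then show "x + y \<in> S" "bracket x y \<in> S"
      using V.subspace_add[OF M(1)] V.subspace_diff[OF M(1)] by (auto simp: S_def act_add_left act_bracket)
  next
    fix c x assume "x \<in> S"
    then show "scale c x \<in> S" using V.subspace_scale[OF M(1)] by (simp add: S_def act_scale_left)
  qed
  moreover have "H \<union> e ` {..n} \<union> f ` {..n} \<subseteq> S" using M by (auto simp: S_def)
  ultimately have "S = UNIV" by (rule generated)
  then show ?thesis using M(1) by (auto simp: submodule_def S_def)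
qed

lemma Kr_total: "\<exists>b. Kr a b"
proof -
  have "submodule {a. \<exists>b. Kr a b}"
  proof (rule submoduleI)
    show "V.subspace {a. \<exists>b. Kr a b}"
      unfolding V.subspace_def using Kr_0 Kr.add Kr.scale by blast
  qed (use Kr_H Kr_E Kr_F in blast)+
  moreover have "vL \<in> {a. \<exists>b. Kr a b}" using Kr.base[of "[]"] by auto
  ultimately show ?thesis using vL_gen by blast
qed

lemma Kr_surj: "b \<in> K.Vs \<Longrightarrow> \<exists>a. Kr a b"
proof -
  assume b: "b \<in> K.Vs"
  have "K.Vs \<subseteq> {b. \<exists>a. Kr a b}"
    unfolding K.Vs_def
  proof (rule FV.span_minimal)
    show "{K.wF I |I. set I \<subseteq> {..n}} \<subseteq> {b. \<exists>a. Kr a b}" using Kr.base by blast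
    show "FV.subspace {b. \<exists>a. Kr a b}" unfolding FV.subspace_def using Kr_0 Kr.add Kr.scale by blast
  qed
  then show ?thesis using b by blast
qed

text \<open>Nonempty words have a weight different from that of \<open>vL\<close>, by independence
  of the simple roots. Triangular test elements prove it: \<open>d\<close> sees only
  \<open>\<alpha> 0\<close>, and \<open>h (j - 1)\<close> sees \<open>\<alpha> j\<close> but no
  later root. Filtering by their eigenvalues removes the words containing 0, then those containing
  1, and so on.\<close>

lemma vL_not_lower: "vL \<notin> V.span {wL I |I. set I \<subseteq> {..n} \<and> I \<noteq> []}"
proof
  assume v: "vL \<in> V.span {wL I |I. set I \<subseteq> {..n} \<and> I \<noteq> []}"
  define B where "B j = {wL I |I. set I \<subseteq> {j..n} \<and> I \<noteq> []}" for j
  have "vL \<in> V.span (B j)" if "j \<le> Suc n" for j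
    using that
  proof (induction j)
    case 0
    then show ?case using v by (simp add: B_def atLeast0AtMost)
  next
    case (Suc j)
    then have vj: "vL \<in> V.span (B j)" and j: "j \<le> n" by auto
    define x where "x = (if j = 0 then d else h (j - 1))"
    have x: "x \<in> H" using H_mem j by (auto simp: x_def)
    have ax: "\<alpha> j x \<noteq> 0" "\<And>k. j < k \<Longrightarrow> k \<le> n \<Longrightarrow> \<alpha> k x = 0"
      using j by (auto simp: x_def root_d root_coroot cartan_C_def)
    have cnt: "(\<Sum>k\<leftarrow>I. \<alpha> k x) = of_nat (count_list I j) * \<alpha> j x" if "set I \<subseteq> {j..n}" for I
      using that
    proof (induction I)
      case (Cons k I)
      then show ?case using ax(2)[of k] by (cases "k = j") (auto simp: algebra_simps)
    qed simp
    have le: "{j..n} \<subseteq> {..n}" by auto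
    have eig: "act x (wL I) = scaleL (\<Lambda> i x - of_nat (count_list I j) * \<alpha> j x) (wL I)" if "set I \<subseteq> {j..n}" for I
      using wL_H[OF x order_trans[OF that le]] cnt[OF that] by simp
    have "vL \<in> V.span {b \<in> B j. act x b = scaleL (\<Lambda> i x) b}"
    proof (rule V.eigen_filter[OF act_add_right act_scale_right _ vj])
      show "\<exists>m. act x b = scaleL m b" if "b \<in> B j" for b using that eig by (auto simp: B_def)
      show "act x vL = scaleL (\<Lambda> i x) vL" using vL_H[OF x] .
    qed
    moreover have "{b \<in> B j. act x b = scaleL (\<Lambda> i x) b} \<subseteq> insert 0 (B (Suc j))"
    proof
      fix b assume "b \<in> {b \<in> B j. act x b = scaleL (\<Lambda> i x) b}"
      then obtain I where I: "b = wL I" "set I \<subseteq> {j..n}" "I \<noteq> []" "act x b = scaleL (\<Lambda> i x) b" by (auto simp: B_def)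
      show "b \<in> insert 0 (B (Suc j))"
      proof (cases "j \<in> set I")
        case False
        then have "set I \<subseteq> {Suc j..n}" using I(2) by (force simp: Suc_le_eq order_le_less)
        then show ?thesis using I by (auto simp: B_def)
      next
        case True
        then have "count_list I j \<noteq> 0" by (simp add: count_list_0_iff)
        moreover have "scaleL (\<Lambda> i x - of_nat (count_list I j) * \<alpha> j x) b = scaleL (\<Lambda> i x) b"
          using eig[OF I(2)] I(1,4) by simp
        ultimately have "b = 0" using ax(1) by (simp add: V.scale_cancel_right)
        then show ?thesis by simp
      qed
    qed
    ultimately have "vL \<in> V.span (insert 0 (B (Suc j)))" using V.span_mono by blast
    then show ?case by (simp add: V.span_insert_0)
  qed
  from this[of "Suc n"] have "vL \<in> V.span (B (Suc n))" by simp
  moreover have "B (Suc n) = {}" by (auto simp: B_def)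
  ultimately show False using vL_neq by simp
qed

text \<open>The coefficient of the vacuum corresponds to that of \<open>vL\<close> modulo lower
  words, because a nonempty word in the \<open>F j\<close> is orthogonal to the vacuum: its first
  factor moves over as \<open>E k\<close>. Both uniqueness proofs rest on this.\<close>

lemma Kr_vacuum: "Kr a b \<Longrightarrow> a - scaleL (coef b {}) vL \<in> V.span {wL I |I. set I \<subseteq> {..n} \<and> I \<noteq> []}" (is "_ \<Longrightarrow> _ \<in> V.span ?B")
proof (induction rule: Kr.induct)
  case (base I)
  show ?case
  proof (cases I)
    case Nil
    then show ?thesis by (simp add: vac_def V.span_zero)
  next
    case (Cons k I')
    have E0: "K.E k vac = 0" using base Cons K.E_vac by simp
    have "coef (K.wF I) {} = ip (K.wF I) vac" by (simp add: ip_vac K.fsupp_Fock K.wF_Fock)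
    also have "\<dots> = cnj (ip vac (K.F k (K.wF I')))"
      using Cons by (subst ip_commute) (auto simp: K.fsupp_Fock K.wF_Fock K.F_Fock K.Fock.vac)
    also have "\<dots> = 0" using E0 K.ip_E[OF K.Fock.vac K.wF_Fock, of k I'] by simp
    finally have "coef (K.wF I) {} = 0" .
    moreover have "wL I \<in> ?B" using base Cons by blast
    ultimately show ?thesis using V.span_base by simp
  qed
next
  case (add a b a' b')
  have eq: "(a + a') - scaleL (coef (b + b') {}) vL = (a - scaleL (coef b {}) vL) + (a' - scaleL (coef b' {}) vL)"
    by (simp add: V.scale_left_distrib)
  show ?case unfolding eq by (rule V.span_add[OF add.IH])
next
  case (scale a b c)
  have eq: "scaleL c a - scaleL (coef (scl c b) {}) vL = scaleL c (a - scaleL (coef b {}) vL)"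
    by (simp add: V.scale_right_diff_distrib)
  show ?case unfolding eq by (rule V.span_scale[OF scale.IH])
qed

text \<open>The vectors related to 0 form a submodule. It does not contain \<open>vL\<close>, which
  would otherwise be a lower vector, so irreducibility makes it zero.\<close>

lemma Kr_left_unique: "Kr a 0 \<Longrightarrow> a = 0"
proof -
  assume a: "Kr a 0"
  have E0: "K.E j 0 = 0" "K.F j 0 = 0" "hF x 0 = 0" for j x by (simp_all add: K.E_def K.F_def hF_def)
  have "submodule {a. Kr a 0}"
  proof (rule submoduleI)
    show "V.subspace {a. Kr a 0}"
      unfolding V.subspace_def using Kr_0 Kr.add[of _ 0 _ 0] Kr.scale[of _ 0] by auto
  qed (use Kr_H[of _ 0] Kr_E[of _ 0] Kr_F[of _ 0] E0 in auto)
  moreover have "{a. Kr a 0} \<noteq> UNIV"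
  proof
    assume "{a. Kr a 0} = UNIV"
    then have "Kr vL 0" by blast
    from Kr_vacuum[OF this] show False using vL_not_lower by simp
  qed
  ultimately have "{a. Kr a 0} = {0}" using irreducible by blast
  then show "a = 0" using a by blast
qed

text \<open>On this side the positive definite form takes the place of irreducibility: the vectors
  related to 0 are stable under all \<open>K.E j\<close> and have no vacuum component.\<close>

lemma Kr_right_unique: "Kr 0 b \<Longrightarrow> b = 0"
proof -
  assume b: "Kr 0 b"
  show "b = 0"
  proof (rule K.Vs_nondegenerate[of "{b. Kr 0 b}"])
    show "{b. Kr 0 b} \<subseteq> K.Vs" using Kr_Vs by blast
    show "K.E j g \<in> {b. Kr 0 b}" if "j \<le> n" "g \<in> {b. Kr 0 b}" for j g
      using Kr_E[of 0 g j] that by simp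
    show "coef g {} = 0" if "g \<in> {b. Kr 0 b}" for g
    proof (rule ccontr)
      assume c: "coef g {} \<noteq> 0"
      have "- scaleL (coef g {}) vL \<in> V.span {wL I |I. set I \<subseteq> {..n} \<and> I \<noteq> []}"
        using Kr_vacuum[of 0 g] that by simp
      then have "scaleL (- inverse (coef g {})) (- scaleL (coef g {}) vL) \<in> V.span {wL I |I. set I \<subseteq> {..n} \<and> I \<noteq> []}"
        by (rule V.span_scale)
      then show False using c vL_not_lower by simp
    qed
  qed (use b in simp)
qed

section \<open>Weights of grounded partitions and weight multiplicities\<close>

definition wt :: "part list \<Rightarrow> 'g \<Rightarrow> complex" where
  "wt ps x = (\<Sum>(m, a, b)\<leftarrow>ps. u x a + u x b - \<delta> x * of_int m)"

lemma hF_XW: "hF x (K.XW ps vac) = scl (\<Lambda> i x + wt ps x) (K.XW ps vac)"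
  unfolding hF_def wt_def by (rule K.XW_Om[OF u_odd])

lemma exponent_gp: "ps \<in> K.GP \<Longrightarrow> partition_exponent \<alpha> n (K.gp ps) = wt ps"
proof -
  assume "ps \<in> K.GP"
  then have l: "\<forall>p\<in>set ps. K.lpart p" by (auto simp: K.GP_def K.npart_def)
  have g: "colour_exponent \<alpha> n (Col (ground i)) x = 0" for x by (simp add: ground_def)
  have "(\<Sum>p\<leftarrow>map emb_part ps. colour_exponent \<alpha> n (snd p) x) - of_int (sum_list (map fst (map emb_part ps))) * \<delta> x = wt ps x" for x
    using l
  proof (induction ps)
    case (Cons p ps)
    obtain m a b where p: "p = (m, a, b)" by (cases p)
    show ?case using Cons by (simp add: p emb_part_def wt_def K.lpart_def u_def algebra_simps)
  qed (simp add: wt_def)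
  then show ?thesis by (simp add: fun_eq_iff partition_exponent_def part_size_def K.gp_def g)
qed

lemma u_d: "u d c = 0"
proof -
  have "letter_exponent \<alpha> n (Plain k) d = 0" if "1 \<le> k" for k
    using that n_ge_2 by (auto simp: root_d intro!: sum.neutral)
  then have p: "u d (Plain k) = 0" for k by (auto simp: u_def letters_def)
  show ?thesis
  proof (cases c)
    case (Barred k)
    then show ?thesis using u_odd[of d] p[of k] unfolding K.odd_wt_def by (metis bar.simps(1) neg_0_equal_iff_equal)
  qed (simp add: p)
qed

lemma delta_d: "\<delta> d = 1"
proof -
  have "(\<Sum>j=1..n - 1. \<alpha> j d) = 0" by (intro sum.neutral) (auto simp: root_d)
  then show ?thesis using n_ge_2 by (simp add: null_root_def root_d)
qed

lemma wt_d: "wt ps d = - of_int (sum_list (map fst ps))"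
  by (induction ps) (auto simp: wt_def u_d delta_d)

text \<open>Evaluated at \<open>d\<close>, the weight is minus the total size, so a weight
  determines the size.\<close>

lemma finite_weight: "finite {ps \<in> K.GP. wt ps = \<mu>}"
proof (cases "\<exists>ps\<in>K.GP. wt ps = \<mu>")
  case True
  then obtain qs where qs: "wt qs = \<mu>" by blast
  have "{ps \<in> K.GP. wt ps = \<mu>} \<subseteq> {ps \<in> K.GP. sum_list (map fst ps) = sum_list (map fst qs)}"
  proof safe
    fix ps assume "\<mu> = wt ps"
    then have "wt ps d = wt qs d" using qs by simp
    then show "sum_list (map fst ps) = sum_list (map fst qs)" unfolding wt_d by simp
  qed
  then show ?thesis by (rule finite_subset) (rule K.finite_GP_size)
next
  case False
  then have "{ps \<in> K.GP. wt ps = \<mu>} = {}" by blast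
  then show ?thesis by (metis finite.emptyI)
qed

lemma root_outside: "j \<le> n \<Longrightarrow> x \<notin> H \<Longrightarrow> \<alpha> j x = 0"
  using root_dual[of j] by (simp add: dual_of_def)

lemma u_dual: "x \<in> H \<Longrightarrow> y \<in> H \<Longrightarrow> u (x + y) c = u x c + u y c" "x \<in> H \<Longrightarrow> u (scale r x) c = r * u x c"
  "x \<notin> H \<Longrightarrow> u x c = 0"
proof -
  have a: "\<alpha> j (x + y) = \<alpha> j x + \<alpha> j y" if "x \<in> H" "y \<in> H" "j \<le> n" for j
    using root_dual[OF that(3)] that by (simp add: dual_of_def)
  have s: "\<alpha> j (scale r x) = r * \<alpha> j x" if "x \<in> H" "j \<le> n" for j
    using root_dual[OF that(2)] that by (simp add: dual_of_def)
  show "u (x + y) c = u x c + u y c" if "x \<in> H" "y \<in> H"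
    using that by (cases c) (auto simp: u_def a sum.distrib add_divide_distrib)
  show "u (scale r x) c = r * u x c" if "x \<in> H"
    using that by (cases c) (auto simp: u_def s algebra_simps sum_distrib_left)
  show "u x c = 0" if "x \<notin> H"
    using that by (cases c) (auto simp: u_def root_outside)
qed

lemma delta_dual: "x \<in> H \<Longrightarrow> y \<in> H \<Longrightarrow> \<delta> (x + y) = \<delta> x + \<delta> y" "x \<in> H \<Longrightarrow> \<delta> (scale r x) = r * \<delta> x"
  "x \<notin> H \<Longrightarrow> \<delta> x = 0"
proof -
  have a: "\<alpha> j (x + y) = \<alpha> j x + \<alpha> j y" if "x \<in> H" "y \<in> H" "j \<le> n" for j
    using root_dual[OF that(3)] that by (simp add: dual_of_def)
  have s: "\<alpha> j (scale r x) = r * \<alpha> j x" if "x \<in> H" "j \<le> n" for j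
    using root_dual[OF that(2)] that by (simp add: dual_of_def)
  have le: "j \<in> {1..n - 1} \<Longrightarrow> j \<le> n" for j by auto
  show "\<delta> (x + y) = \<delta> x + \<delta> y" if "x \<in> H" "y \<in> H"
    using that by (simp add: null_root_def a le sum.distrib)
  show "\<delta> (scale r x) = r * \<delta> x" if "x \<in> H"
    using that by (simp add: null_root_def s le distrib_left sum_distrib_left mult_ac)
  show "\<delta> x = 0" if "x \<notin> H"
    using that by (simp add: null_root_def root_outside le)
qed

lemma wt_dual: "wt ps \<in> dual_of scale H"
proof -
  have "wt ps (x + y) = wt ps x + wt ps y" if "x \<in> H" "y \<in> H" for x y
    using that by (induction ps) (auto simp: wt_def u_dual delta_dual algebra_simps)
  moreover have "wt ps (scale c x) = c * wt ps x" if "x \<in> H" for c x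
    using that by (induction ps) (auto simp: wt_def u_dual delta_dual algebra_simps)
  moreover have "wt ps x = 0" if "x \<notin> H" for x
    using that by (induction ps) (auto simp: wt_def u_dual delta_dual)
  ultimately show ?thesis by (simp add: dual_of_def)
qed

lemma Kr_unique: "Kr a b \<Longrightarrow> Kr a' b \<Longrightarrow> a = a'" "Kr a b \<Longrightarrow> Kr a b' \<Longrightarrow> b = b'"
  using Kr_left_unique[of "a - a'"] Kr_right_unique[of "b - b'"] Kr_diff[of a b a' b] Kr_diff[of a b a b'] by auto

text \<open>Pulled back along \<open>Kr\<close>, the words \<open>K.XW ps vac\<close> with
  \<open>wt ps = \<mu>\<close> give the basis. A weight vector is first expanded in words of all
  weights; comparing the action of each \<open>x \<in> H\<close> and using independence, the
  coefficients at other weights vanish.\<close>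

lemma weight_space_basis:
  assumes \<mu>: "\<mu> \<in> dual_of scale H"
  shows "\<exists>B. finite B \<and> card B = card {ps \<in> K.GP. wt ps = \<mu>} \<and> V.independent B \<and>
    B \<subseteq> weight_space H scaleL act (\<lambda>x. \<mu> x + \<Lambda> i x) \<and>
    weight_space H scaleL act (\<lambda>x. \<mu> x + \<Lambda> i x) \<subseteq> V.span B"
proof -
  define P where "P = {ps \<in> K.GP. wt ps = \<mu>}"
  have fin: "finite P" by (simp add: P_def finite_weight)
  have "\<exists>a. Kr a (K.XW ps vac)" if "ps \<in> K.GP" for ps
    using that by (intro Kr_surj K.XW_Vs) (auto simp: K.GP_def K.npart_def)
  then obtain y where y: "\<And>ps. ps \<in> K.GP \<Longrightarrow> Kr (y ps) (K.XW ps vac)" by metis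
  have ind: "c ps = 0" if "(\<Sum>ps\<in>P. scaleL (c ps) (y ps)) = 0" "ps \<in> P" for c ps
  proof -
    have "Kr (\<Sum>ps\<in>P. scaleL (c ps) (y ps)) (\<Sum>ps\<in>P. scl (c ps) (K.XW ps vac))"
      by (intro Kr_sum Kr.scale y) (simp add: P_def)
    then have "(\<Sum>ps\<in>P. scl (c ps) (K.XW ps vac)) = 0" using that Kr_right_unique by simp
    then show ?thesis using K.GP_independent[OF fin _ _ that(2)] by (auto simp: P_def)
  qed
  have inj: "inj_on y P"
  proof (rule inj_onI, rule ccontr)
    fix ps qs assume pq: "ps \<in> P" "qs \<in> P" "y ps = y qs" "ps \<noteq> qs"
    define c where "c rs = (if rs = ps then 1 else if rs = qs then - 1 else 0 :: complex)" for rs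
    have "(\<Sum>rs\<in>P. scaleL (c rs) (y rs)) = (\<Sum>rs\<in>{ps, qs}. scaleL (c rs) (y rs))"
      using pq fin by (intro sum.mono_neutral_right) (auto simp: c_def)
    also have "\<dots> = 0" using pq by (simp add: c_def)
    finally have "c ps = 0" using ind pq by blast
    then show False by (simp add: c_def)
  qed
  have indep: "V.independent (y ` P)"
  proof
    assume "V.dependent (y ` P)"
    then obtain g where g: "\<exists>v\<in>y ` P. g v \<noteq> 0" "(\<Sum>v\<in>y ` P. scaleL (g v) v) = 0"
      using V.dependent_finite[of "y ` P"] fin by auto
    then have "(\<Sum>ps\<in>P. scaleL (g (y ps)) (y ps)) = 0" using inj by (simp add: sum.reindex)
    then show False using g(1) ind[of "\<lambda>ps. g (y ps)"] by blast
  qed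
  have sub: "y ` P \<subseteq> weight_space H scaleL act (\<lambda>x. \<mu> x + \<Lambda> i x)"
  proof (clarsimp simp: weight_space_def)
    fix ps x assume ps: "ps \<in> P" and x: "x \<in> H"
    have k: "Kr (y ps) (K.XW ps vac)" using ps y by (simp add: P_def)
    have "Kr (act x (y ps)) (scl (\<mu> x + \<Lambda> i x) (K.XW ps vac))"
      using Kr_H[OF k x] ps by (simp add: hF_XW P_def add.commute)
    moreover have "Kr (scaleL (\<mu> x + \<Lambda> i x) (y ps)) (scl (\<mu> x + \<Lambda> i x) (K.XW ps vac))"
      using k by (rule Kr.scale)
    ultimately show "act x (y ps) = scaleL (\<mu> x + \<Lambda> i x) (y ps)" by (rule Kr_unique(1))
  qed
  have span: "weight_space H scaleL act (\<lambda>x. \<mu> x + \<Lambda> i x) \<subseteq> V.span (y ` P)"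
  proof
    fix a assume a: "a \<in> weight_space H scaleL act (\<lambda>x. \<mu> x + \<Lambda> i x)"
    obtain b where b: "Kr a b" using Kr_total by blast
    then have "b \<in> FV.span {K.XW ps vac |ps. ps \<in> K.GP}" using Kr_Vs K.Vs_eq_Sp by (simp add: K.Sp_def)
    then obtain T r where T: "finite T" "T \<subseteq> {K.XW ps vac |ps. ps \<in> K.GP}" "b = (\<Sum>t\<in>T. scl (r t) t)"
      unfolding FV.span_explicit by blast
    have "\<exists>ps. ps \<in> K.GP \<and> t = K.XW ps vac" if "t \<in> T" for t using T(2) that by blast
    then obtain \<pi> where \<pi>: "\<And>t. t \<in> T \<Longrightarrow> \<pi> t \<in> K.GP \<and> t = K.XW (\<pi> t) vac" by metis
    have inj\<pi>: "inj_on \<pi> T" using \<pi> by (metis inj_onI)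
    define S where "S = \<pi> ` T"
    define c where "c ps = r (K.XW ps vac)" for ps
    have S: "finite S" "S \<subseteq> K.GP" using T \<pi> by (auto simp: S_def)
    have bS: "b = (\<Sum>ps\<in>S. scl (c ps) (K.XW ps vac))"
      unfolding T(3) S_def using inj\<pi> \<pi> by (auto simp: sum.reindex c_def intro!: sum.cong)
    have z: "c ps * (wt ps x - \<mu> x) = 0" if "x \<in> H" "ps \<in> S" for ps x
    proof -
      have "act x a = scaleL (\<mu> x + \<Lambda> i x) a" using a that by (simp add: weight_space_def)
      then have "hF x b = scl (\<mu> x + \<Lambda> i x) b"
        using Kr_unique(2)[OF Kr_H[OF b that(1)]] Kr.scale[OF b] by metis
      then have "(\<Sum>ps\<in>S. scl (c ps * (\<Lambda> i x + wt ps x)) (K.XW ps vac)) = (\<Sum>ps\<in>S. scl (c ps * (\<mu> x + \<Lambda> i x)) (K.XW ps vac))"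
        unfolding bS using hF_XW[of x] by (simp add: hF_def K.Dg_sum K.Dg_scl FV.scale_sum_right mult.commute)
      then have "(\<Sum>ps\<in>S. scl (c ps * (\<Lambda> i x + wt ps x)) (K.XW ps vac) - scl (c ps * (\<mu> x + \<Lambda> i x)) (K.XW ps vac)) = 0"
        by (simp only: sum_subtractf) simp
      moreover have "scl (c ps * (\<Lambda> i x + wt ps x)) g - scl (c ps * (\<mu> x + \<Lambda> i x)) g = scl (c ps * (wt ps x - \<mu> x)) g" for ps g
        unfolding FV.scale_left_diff_distrib[symmetric] by (simp add: algebra_simps)
      ultimately have "(\<Sum>ps\<in>S. scl (c ps * (wt ps x - \<mu> x)) (K.XW ps vac)) = 0" by simp
      then show ?thesis using K.GP_independent[OF S _ that(2), of "\<lambda>ps. c ps * (wt ps x - \<mu> x)"] by simp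
    qed
    have inP: "ps \<in> P" if "ps \<in> S" "c ps \<noteq> 0" for ps
    proof -
      \<comment> \<open>Functionals are zero off \<open>H\<close> by convention, so agreement on
        \<open>H\<close> is equality.\<close>
      have "wt ps x = \<mu> x" for x
      proof (cases "x \<in> H")
        case True
        then show ?thesis using z[OF True that(1)] that(2) by simp
      next
        case False
        then show ?thesis using wt_dual[of ps] \<mu> by (simp add: dual_of_def)
      qed
      then show ?thesis using that S by (auto simp: P_def)
    qed
    have "Kr (\<Sum>ps\<in>S. scaleL (c ps) (y ps)) b"
      unfolding bS by (intro Kr_sum Kr.scale y) (use S in auto)
    then have "a = (\<Sum>ps\<in>S. scaleL (c ps) (y ps))" using b Kr_unique(1) by blast
    also have "\<dots> \<in> V.span (y ` P)"
    proof (rule V.span_sum)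
      fix ps assume ps: "ps \<in> S"
      show "scaleL (c ps) (y ps) \<in> V.span (y ` P)"
      proof (cases "c ps = 0")
        case True
        then show ?thesis by (simp add: V.span_zero)
      next
        case False
        then show ?thesis using inP[OF ps] by (intro V.span_scale V.span_base) simp
      qed
    qed
    finally show "a \<in> V.span (y ` P)" .
  qed
  show ?thesis
    using fin indep sub span card_image[OF inj] by (intro exI[of _ "y ` P"]) (simp add: P_def)
qed

lemma exponent_fibre: "{\<pi> \<in> grounded_partitions n i. partition_exponent \<alpha> n \<pi> = \<mu>} = K.gp ` {ps \<in> K.GP. wt ps = \<mu>}"
  unfolding K.grounded_partitions_eq using exponent_gp by auto

lemma dual_add: "\<mu> \<in> dual_of scale H \<Longrightarrow> (\<lambda>x. \<mu> x + \<Lambda> i x) \<in> dual_of scale H"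
  "\<mu> \<in> dual_of scale H \<Longrightarrow> (\<lambda>x. \<mu> x - \<Lambda> i x) \<in> dual_of scale H"
  using fund_dual[OF i_le] by (auto simp: dual_of_def algebra_simps)

lemma character:
  "(\<forall>\<mu>\<in>dual_of scale H. finite_dim scaleL (weight_space H scaleL act \<mu>)) \<and>
    formal_summable (partition_exponent \<alpha> n) (grounded_partitions n i) \<and>
    formal_sum (partition_exponent \<alpha> n) (grounded_partitions n i) =
      exp_times (\<lambda>x. - \<Lambda> i x) (formal_character scale H scaleL act)"
proof (intro conjI ballI)
  fix \<mu> assume "\<mu> \<in> dual_of scale H"
  from weight_space_basis[OF dual_add(2)[OF this]]
  show "finite_dim scaleL (weight_space H scaleL act \<mu>)" by (auto simp: finite_dim_def)
next
  show "formal_summable (partition_exponent \<alpha> n) (grounded_partitions n i)"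
    unfolding formal_summable_def exponent_fibre using finite_weight by simp
next
  show "formal_sum (partition_exponent \<alpha> n) (grounded_partitions n i) =
      exp_times (\<lambda>x. - \<Lambda> i x) (formal_character scale H scaleL act)"
  proof
    fix \<mu>
    have l: "formal_sum (partition_exponent \<alpha> n) (grounded_partitions n i) \<mu> = card {ps \<in> K.GP. wt ps = \<mu>}"
      unfolding formal_sum_def exponent_fibre
      by (rule card_image[OF inj_on_subset[OF K.gp_inj subset_UNIV]])
    have r: "exp_times (\<lambda>x. - \<Lambda> i x) (formal_character scale H scaleL act) \<mu> =
      formal_character scale H scaleL act (\<lambda>x. \<mu> x + \<Lambda> i x)" by (simp add: exp_times_def)
    show "formal_sum (partition_exponent \<alpha> n) (grounded_partitions n i) \<mu> =
      exp_times (\<lambda>x. - \<Lambda> i x) (formal_character scale H scaleL act) \<mu>"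
    proof (cases "\<mu> \<in> dual_of scale H")
      case True
      obtain B where B: "finite B" "card B = card {ps \<in> K.GP. wt ps = \<mu>}" "V.independent B"
        "B \<subseteq> weight_space H scaleL act (\<lambda>x. \<mu> x + \<Lambda> i x)"
        "weight_space H scaleL act (\<lambda>x. \<mu> x + \<Lambda> i x) \<subseteq> V.span B"
        using weight_space_basis[OF True] by blast
      have "V.dim (weight_space H scaleL act (\<lambda>x. \<mu> x + \<Lambda> i x)) = card B"
        using V.dim_unique[OF B(4,5,3)] by simp
      then show ?thesis unfolding l r using B(2) dual_add(1)[OF True] by (simp add: formal_character_def)
    next
      case False
      have "(\<lambda>x. \<mu> x + \<Lambda> i x) \<notin> dual_of scale H"
        using False dual_add(2)[of "\<lambda>x. \<mu> x + \<Lambda> i x"] by auto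
      moreover have "{ps \<in> K.GP. wt ps = \<mu>} = {}" using False wt_dual by auto
      then have "card {ps \<in> K.GP. wt ps = \<mu>} = 0" by (simp only: card.empty)
      ultimately show ?thesis
        by (simp only: l exp_times_def formal_character_def if_False diff_minus_eq_add)
    qed
  qed
qed

end

theorem theorem1p10:
  fixes scale :: "complex \<Rightarrow> 'g::ab_group_add \<Rightarrow> 'g" and bracket :: "'g \<Rightarrow> 'g \<Rightarrow> 'g"
    and n i :: nat and H :: "'g set" and h e f :: "nat \<Rightarrow> 'g" and d :: 'g
    and \<alpha> \<Lambda> :: "nat \<Rightarrow> 'g \<Rightarrow> complex"
    and scaleL :: "complex \<Rightarrow> 'v::ab_group_add \<Rightarrow> 'v" and act :: "'g \<Rightarrow> 'v \<Rightarrow> 'v"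
  assumes "affine_C scale bracket n H h d e f \<alpha> \<Lambda>"
    and "i \<le> n"
    and "irreducible_highest_weight_module scale bracket scaleL act n H e (\<Lambda> i)"
  shows "(\<forall>\<mu>\<in>dual_of scale H. finite_dim scaleL (weight_space H scaleL act \<mu>)) \<and>
    formal_summable (partition_exponent \<alpha> n) (grounded_partitions n i) \<and>
    formal_sum (partition_exponent \<alpha> n) (grounded_partitions n i) =
      exp_times (\<lambda>x. - \<Lambda> i x) (formal_character scale H scaleL act)"
proof -
  interpret C: affine_C scale bracket n H h d e f \<alpha> \<Lambda> by (fact assms(1))
  interpret L: irreducible_highest_weight_module scale bracket scaleL act n H e "\<Lambda> i" by (fact assms(3))
  obtain v where v: "v \<noteq> 0" "\<forall>j\<le>n. act (e j) v = 0" "\<forall>x\<in>H. act x v = scaleL (\<Lambda> i x) v"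
    "\<forall>W. L.submodule W \<longrightarrow> v \<in> W \<longrightarrow> W = UNIV"
    using L.highest_weight_vector by blast
  interpret affine_rep scale bracket n i H h e f d \<alpha> \<Lambda> scaleL act v
    by unfold_locales (use assms(2) v in auto)
  show ?thesis by (fact character)
qed

end
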